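(* Let $U\subset(\mathbb{R}^n)^*$ be open and let $\Delta := U\cap\{x\in(\mathbb{R}^n)^*\mid\langle x,\eta_i\rangle\le\kappa_i,\ i=1,\dots,N\}$ be a unimodular set. Give $U\times T^n$ the standard coordinates $(x,\theta)=(x_1,\dots,x_n,\theta_1,\dots,\theta_n)$. Consider the Hamiltonian $T^n\times T^N$-space $U\times T^n\times\mathbb{C}^N$ with symplectic form $\sum_i dx_i\wedge d\theta_i+\sqrt{-1}\sum_{i=1}^N dz_i\wedge d\overline{z}_i$, action $$(s_1,\dots,s_n,t_1,\dots,t_N)\cdot(x,\theta,z_1,\dots,z_N)=\Big(x,\ \theta+\sum_{i=1}^n s_ie_i+\sum_{i=1}^N t_i\eta_i,\ e^{\sqrt{-1}t_1}z_1,\dots,e^{\sqrt{-1}t_N}z_N\Big),$$ where $e_1,\dots,e_n$ is the standard basis of $\mathbb{R}^n$, and moment map $$\Psi:U\times T^n\times\mathbb{C}^N\to(\mathbb{R}^n\oplus\mathbb{R}^N)^*,\quad (x,\theta,z_1,\dots,z_N)\mapsto x\oplus(\langle x,\eta_1\rangle+\|z_1\|^2-\kappa_1,\dots,\langle x,\eta_N\rangle+\|z_N\|^2-\kappa_N).$$ Denote the $(\mathbb{R}^N)^*$-part of $\Psi$ by $\mu$ and let $M_\Delta:=\mu^{-1}(0)/T^N$. Then there are an induced symplectic form $\omega_\Delta$, an induced $T^n$-action and an induced moment map $\Phi_\Delta$ on $M_\Delta$. Moreover $\mathrm{Im}\,\Phi_\Delta=\Delta$ holds.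
   Context: Tori: $T^m=\mathbb{R}^m/2\pi\mathbb{Z}^m$ with Lie algebra $\mathbb{R}^m$. The moment map $\mu$ of a symplectic torus action satisfies $\iota_{X_M}\omega=-d\langle\mu,X\rangle$, where $X_M$ is the vector field induced by $X$, and is invariant. Unimodular set: let $\Pi=\{x\in(\mathbb{R}^n)^*\mid\langle x,\eta_i\rangle\le\kappa_i,\ i=1,\dots,N\}$ be a convex polyhedral set, with $\eta_i\in\mathbb{R}^n$ the outward conormal vector of the $i$-th facet and $\kappa_i\in\mathbb{R}$. A unimodular set $\Delta$ is a relatively open subset of $\Pi$ such that (1) if $\Delta$ has vertices, then each vertex is simple, i.e. exactly $n$ edges meet there; (2) each outward conormal vector of a facet of $\Delta$ lies in $\mathbb{Z}^n$ and is primitive; (3) for every $I\subset\{1,\dots,N\}$, if $\Delta\cap F_I\ne\emptyset$, where $F_I=\{x\in\Pi\mid\langle x,\eta_i\rangle=\kappa_i,\ i\in I\}$, then $\{\eta_i\}_{i\in I}$ is a basis of the integral lattice of a subtorus of $T^n$. "Induced" refers to symplectic reduction by $T^N$ at level $0$: the pullback of $\omega_\Delta$ to $\mu^{-1}(0)$ is the restriction of the given symplectic form, the $T^n$-action descends, and $\Phi_\Delta$ is the map induced by the $(\mathbb{R}^n)^*$-part $(x,\theta,z)\mapsto x$ of $\Psi$. *)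

theory Defs
  imports "HOL-Analysis.Analysis"
begin

section \<open>Smooth maps between open subsets of Euclidean spaces\<close>

text \<open>\<open>S\<close> is meant to be open. In finite dimension, a function is of class \<open>C\<^sup>k\<^sup>+\<^sup>1\<close> iff it is
  differentiable and all its directional derivatives are of class \<open>C\<^sup>k\<close>.\<close>

primrec Ck_on :: "nat \<Rightarrow> 'a::euclidean_space set \<Rightarrow> ('a \<Rightarrow> 'b::euclidean_space) \<Rightarrow> bool" where
  "Ck_on 0 S f \<longleftrightarrow> continuous_on S f"
| "Ck_on (Suc k) S f \<longleftrightarrow>
     (\<forall>x\<in>S. f differentiable (at x)) \<and> (\<forall>v. Ck_on k S (\<lambda>x. frechet_derivative f (at x) v))"

definition smooth_on :: "'a::euclidean_space set \<Rightarrow> ('a \<Rightarrow> 'b::euclidean_space) \<Rightarrow> bool" where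
  "smooth_on S f \<longleftrightarrow> (\<forall>k. Ck_on k S f)"


section \<open>Smooth manifolds\<close>

text \<open>A chart is a pair of its domain and its coordinate map; the values of the coordinate map
  outside the domain are irrelevant. An atlas determines the smooth structure and is not
  required to be maximal. The dimension of the manifold is that of the model space \<^typ>\<open>'e\<close>.\<close>

type_synonym ('a, 'e) chart = "'a set \<times> ('a \<Rightarrow> 'e)"

definition coord_rep :: "('a \<Rightarrow> 'b) \<Rightarrow> ('a, 'e) chart \<Rightarrow> ('b, 'f) chart \<Rightarrow> 'e \<Rightarrow> 'f" where
  "coord_rep f c d = snd d \<circ> f \<circ> inv_into (fst c) (snd c)"

definition coord_deriv ::
    "('a \<Rightarrow> 'b) \<Rightarrow> ('a, 'e::euclidean_space) chart \<Rightarrow> ('b, 'f::euclidean_space) chart \<Rightarrow> 'e \<Rightarrow> 'e \<Rightarrow> 'f"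
  where "coord_deriv f c d x = frechet_derivative (coord_rep f c d) (at x)"

definition smooth_atlas :: "'a topology \<Rightarrow> ('a, 'e::euclidean_space) chart set \<Rightarrow> bool" where
  "smooth_atlas X A \<longleftrightarrow>
     (\<Union>c\<in>A. fst c) = topspace X \<and>
     (\<forall>c\<in>A. openin X (fst c) \<and> open (snd c ` fst c) \<and>
        homeomorphic_map (subtopology X (fst c)) (top_of_set (snd c ` fst c)) (snd c)) \<and>
     (\<forall>c\<in>A. \<forall>d\<in>A. smooth_on (snd c ` (fst c \<inter> fst d)) (coord_rep (\<lambda>p. p) c d))"

definition second_countable_space :: "'a topology \<Rightarrow> bool" where
  "second_countable_space X \<longleftrightarrow>
     (\<exists>\<B>. countable \<B> \<and> (\<forall>V\<in>\<B>. openin X V) \<and>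
        (\<forall>W p. openin X W \<and> p \<in> W \<longrightarrow> (\<exists>V\<in>\<B>. p \<in> V \<and> V \<subseteq> W)))"

definition smooth_manifold :: "'a topology \<Rightarrow> ('a, 'e::euclidean_space) chart set \<Rightarrow> bool" where
  "smooth_manifold X A \<longleftrightarrow> Hausdorff_space X \<and> second_countable_space X \<and> smooth_atlas X A"

definition smooth_map ::
    "'a topology \<Rightarrow> ('a, 'e::euclidean_space) chart set \<Rightarrow>
     'b topology \<Rightarrow> ('b, 'f::euclidean_space) chart set \<Rightarrow> ('a \<Rightarrow> 'b) \<Rightarrow> bool" where
  "smooth_map X A Y B f \<longleftrightarrow>
     continuous_map X Y f \<and>
     (\<forall>c\<in>A. \<forall>d\<in>B. smooth_on (snd c ` (fst c \<inter> f -` fst d)) (coord_rep f c d))"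

definition submersion ::
    "'a topology \<Rightarrow> ('a, 'e::euclidean_space) chart set \<Rightarrow>
     'b topology \<Rightarrow> ('b, 'f::euclidean_space) chart set \<Rightarrow> ('a \<Rightarrow> 'b) \<Rightarrow> bool" where
  "submersion X A Y B f \<longleftrightarrow>
     smooth_map X A Y B f \<and>
     (\<forall>c\<in>A. \<forall>d\<in>B. \<forall>p \<in> fst c \<inter> f -` fst d. surj (coord_deriv f c d (snd c p)))"

definition immersion ::
    "'a topology \<Rightarrow> ('a, 'e::euclidean_space) chart set \<Rightarrow>
     'b topology \<Rightarrow> ('b, 'f::euclidean_space) chart set \<Rightarrow> ('a \<Rightarrow> 'b) \<Rightarrow> bool" where
  "immersion X A Y B f \<longleftrightarrow>
     smooth_map X A Y B f \<and>
     (\<forall>c\<in>A. \<forall>d\<in>B. \<forall>p \<in> fst c \<inter> f -` fst d. inj (coord_deriv f c d (snd c p)))"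

text \<open>The subset \<open>S\<close>, with its subspace topology and the atlas \<open>B\<close>, is an embedded submanifold
  of \<open>(X, A)\<close>.\<close>

definition embedded_submanifold ::
    "'a topology \<Rightarrow> ('a, 'e::euclidean_space) chart set \<Rightarrow>
     'a set \<Rightarrow> ('a, 'f::euclidean_space) chart set \<Rightarrow> bool" where
  "embedded_submanifold X A S B \<longleftrightarrow>
     S \<subseteq> topspace X \<and> smooth_manifold (subtopology X S) B \<and>
     immersion (subtopology X S) B X A (\<lambda>p. p)"

definition prod_atlas ::
    "('a, 'e) chart set \<Rightarrow> ('b, 'f) chart set \<Rightarrow> ('a \<times> 'b, 'e \<times> 'f) chart set" where
  "prod_atlas A B = (\<lambda>(c, d). (fst c \<times> fst d, map_prod (snd c) (snd d))) ` (A \<times> B)"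

text \<open>The standard smooth structure of an open subset of a Euclidean space.\<close>

definition open_atlas :: "'e set \<Rightarrow> ('e, 'e) chart set" where
  "open_atlas S = {(S, \<lambda>x. x)}"

definition quotient_topology :: "'a topology \<Rightarrow> ('a \<Rightarrow> 'b) \<Rightarrow> 'b topology" where
  "quotient_topology X f =
     topology (\<lambda>V. V \<subseteq> f ` topspace X \<and> openin X {p \<in> topspace X. f p \<in> V})"

lemma openin_quotient_topology:
  "openin (quotient_topology X f) V \<longleftrightarrow>
     V \<subseteq> f ` topspace X \<and> openin X {p \<in> topspace X. f p \<in> V}"
proof -
  have "istopology (\<lambda>V. V \<subseteq> f ` topspace X \<and> openin X {p \<in> topspace X. f p \<in> V})"
    unfolding istopology_def
  proof (intro conjI allI impI)
    fix S T
    assume S: "S \<subseteq> f ` topspace X \<and> openin X {p \<in> topspace X. f p \<in> S}"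
      and T: "T \<subseteq> f ` topspace X \<and> openin X {p \<in> topspace X. f p \<in> T}"
    have "{p \<in> topspace X. f p \<in> S \<inter> T} =
        {p \<in> topspace X. f p \<in> S} \<inter> {p \<in> topspace X. f p \<in> T}" by auto
    then show "openin X {p \<in> topspace X. f p \<in> S \<inter> T}" using S T by auto
    show "S \<inter> T \<subseteq> f ` topspace X" using S by auto
  next
    fix \<K>
    assume K: "\<forall>K\<in>\<K>. K \<subseteq> f ` topspace X \<and> openin X {p \<in> topspace X. f p \<in> K}"
    have "{p \<in> topspace X. f p \<in> \<Union>\<K>} = (\<Union>K\<in>\<K>. {p \<in> topspace X. f p \<in> K})" by auto
    then show "openin X {p \<in> topspace X. f p \<in> \<Union>\<K>}" using K by auto
    show "\<Union>\<K> \<subseteq> f ` topspace X" using K by auto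
  qed
  then show ?thesis by (simp add: quotient_topology_def)
qed

lemma topspace_quotient_topology: "topspace (quotient_topology X f) = f ` topspace X"
proof -
  have "{p \<in> topspace X. f p \<in> f ` topspace X} = topspace X" by auto
  then have "openin (quotient_topology X f) (f ` topspace X)"
    by (simp add: openin_quotient_topology)
  moreover have "topspace (quotient_topology X f) \<subseteq> f ` topspace X"
    using openin_topspace[of "quotient_topology X f"] unfolding openin_quotient_topology by (rule conjunct1)
  ultimately show ?thesis by (simp add: openin_subset subset_antisym)
qed

lemma quotient_map_quotient_topology: "quotient_map X (quotient_topology X f) f"
  by (simp add: quotient_map_def topspace_quotient_topology openin_quotient_topology)


section \<open>Symplectic forms\<close>

text \<open>A 2-form is given by its local expressions: \<open>\<omega> c x u v\<close> is the value at the point with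
  coordinates \<open>x\<close> in the chart \<open>c\<close> on the tangent vectors with components \<open>u\<close> and \<open>v\<close>. Only the
  values at charts of the atlas and at points of their images are relevant.\<close>

type_synonym ('a, 'e) form2 = "('a, 'e) chart \<Rightarrow> 'e \<Rightarrow> 'e \<Rightarrow> 'e \<Rightarrow> real"

text \<open>The expression in the chart \<open>c\<close> of the pullback of \<open>\<beta>\<close> by \<open>f\<close>, computed with the chart \<open>d\<close>
  of the target.\<close>

definition local_pullback ::
    "('a \<Rightarrow> 'b) \<Rightarrow> ('a, 'e::euclidean_space) chart \<Rightarrow> ('b, 'f::euclidean_space) chart \<Rightarrow>
     ('b, 'f) form2 \<Rightarrow> 'e \<Rightarrow> 'e \<Rightarrow> 'e \<Rightarrow> real" where
  "local_pullback f c d \<beta> x u v =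
     \<beta> d (coord_rep f c d x) (coord_deriv f c d x u) (coord_deriv f c d x v)"

definition is_pullback ::
    "('a, 'e::euclidean_space) chart set \<Rightarrow> ('b, 'f::euclidean_space) chart set \<Rightarrow>
     ('a \<Rightarrow> 'b) \<Rightarrow> ('b, 'f) form2 \<Rightarrow> ('a, 'e) form2 \<Rightarrow> bool" where
  "is_pullback A B f \<beta> \<alpha> \<longleftrightarrow>
     (\<forall>c\<in>A. \<forall>d\<in>B. \<forall>p \<in> fst c \<inter> f -` fst d. \<forall>u v.
        \<alpha> c (snd c p) u v = local_pullback f c d \<beta> (snd c p) u v)"

text \<open>The last conjunct is the compatibility of the local expressions under changes of charts.\<close>

definition smooth_2form :: "('a, 'e::euclidean_space) chart set \<Rightarrow> ('a, 'e) form2 \<Rightarrow> bool" where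
  "smooth_2form A \<omega> \<longleftrightarrow>
     (\<forall>c\<in>A. \<forall>x \<in> snd c ` fst c. bilinear (\<omega> c x) \<and> (\<forall>u v. \<omega> c x u v = - \<omega> c x v u)) \<and>
     (\<forall>c\<in>A. \<forall>u v. smooth_on (snd c ` fst c) (\<lambda>x. \<omega> c x u v)) \<and>
     is_pullback A A (\<lambda>p. p) \<omega> \<omega>"

definition closed_2form :: "('a, 'e::euclidean_space) chart set \<Rightarrow> ('a, 'e) form2 \<Rightarrow> bool" where
  "closed_2form A \<omega> \<longleftrightarrow>
     (\<forall>c\<in>A. \<forall>x \<in> snd c ` fst c. \<forall>u v w.
        frechet_derivative (\<lambda>y. \<omega> c y v w) (at x) u +
        frechet_derivative (\<lambda>y. \<omega> c y w u) (at x) v +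
        frechet_derivative (\<lambda>y. \<omega> c y u v) (at x) w = 0)"

definition symplectic_form :: "('a, 'e::euclidean_space) chart set \<Rightarrow> ('a, 'e) form2 \<Rightarrow> bool" where
  "symplectic_form A \<omega> \<longleftrightarrow>
     smooth_2form A \<omega> \<and> closed_2form A \<omega> \<and>
     (\<forall>c\<in>A. \<forall>x \<in> snd c ` fst c. \<forall>u. (\<forall>v. \<omega> c x u v = 0) \<longrightarrow> u = 0)"


section \<open>Tori\<close>

definition integral_vector :: "real^'m \<Rightarrow> bool" where
  "integral_vector v \<longleftrightarrow> (\<forall>i. v $ i \<in> \<int>)"

lemma integral_vector_0: "integral_vector 0"
  and integral_vector_add: "integral_vector v \<Longrightarrow> integral_vector w \<Longrightarrow> integral_vector (v + w)"
  and integral_vector_minus: "integral_vector v \<Longrightarrow> integral_vector (- v)"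
  by (auto simp: integral_vector_def)

definition torus_rel :: "real^'m \<Rightarrow> real^'m \<Rightarrow> bool" where
  "torus_rel x y \<longleftrightarrow> (\<exists>k. integral_vector k \<and> x - y = (2 * pi) *\<^sub>R k)"

lemma equivp_torus_rel: "equivp torus_rel"
proof (rule equivpI)
  show "reflp torus_rel"
    unfolding reflp_def torus_rel_def by (metis diff_self integral_vector_0 scaleR_zero_right)
  show "symp torus_rel"
    unfolding symp_def torus_rel_def
    by (metis integral_vector_minus minus_diff_eq scaleR_minus_right)
  show "transp torus_rel"
  proof (rule transpI)
    fix x y z assume "torus_rel x y" "torus_rel y z"
    then obtain k l where "integral_vector k" "x - y = (2 * pi) *\<^sub>R k"
      and "integral_vector l" "y - z = (2 * pi) *\<^sub>R l"
      unfolding torus_rel_def by blast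
    moreover from this have "x - z = (2 * pi) *\<^sub>R (k + l)"
      by (simp add: scaleR_right_distrib flip: \<open>x - y = _\<close> \<open>y - z = _\<close>)
    ultimately show "torus_rel x z"
      unfolding torus_rel_def by (blast intro: integral_vector_add)
  qed
qed

text \<open>The torus \<open>T\<^sup>m\<close> is the quotient of \<^typ>\<open>real^'m\<close> by the lattice of the vectors with entries
  in \<open>2\<pi>\<int>\<close>; its Lie algebra is \<^typ>\<open>real^'m\<close> and \<open>torus_of\<close> is both the projection and the
  exponential map.\<close>

quotient_type 'm torus = "real^('m::finite)" / torus_rel
  morphisms rep_torus torus_of
  by (rule equivp_torus_rel)

instantiation torus :: (finite) ab_group_add
begin

lift_definition zero_torus :: "'a torus" is "0" .

lift_definition plus_torus :: "'a torus \<Rightarrow> 'a torus \<Rightarrow> 'a torus" is "(+)"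
proof -
  fix x x' y y' :: "real^'a"
  assume "torus_rel x x'" "torus_rel y y'"
  then obtain k l where "integral_vector k" "x - x' = (2 * pi) *\<^sub>R k"
    and "integral_vector l" "y - y' = (2 * pi) *\<^sub>R l"
    unfolding torus_rel_def by blast
  moreover from this have "x + y - (x' + y') = (2 * pi) *\<^sub>R (k + l)"
    by (simp add: scaleR_right_distrib add_diff_add)
  ultimately show "torus_rel (x + y) (x' + y')"
    unfolding torus_rel_def by (blast intro: integral_vector_add)
qed

lift_definition uminus_torus :: "'a torus \<Rightarrow> 'a torus" is "uminus"
proof -
  fix x y :: "real^'a"
  assume "torus_rel x y"
  then obtain k where "integral_vector k" "x - y = (2 * pi) *\<^sub>R k"
    unfolding torus_rel_def by blast
  moreover from this have "- x - - y = (2 * pi) *\<^sub>R (- k)"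
    by (simp flip: \<open>x - y = _\<close>)
  ultimately show "torus_rel (- x) (- y)"
    unfolding torus_rel_def by (blast intro: integral_vector_minus)
qed

definition minus_torus :: "'a torus \<Rightarrow> 'a torus \<Rightarrow> 'a torus" where
  "minus_torus a b = a + - b"

instance
proof
  have eq: "x = y \<Longrightarrow> torus_rel x y" for x y :: "real^'a"
    using equivp_reflp[OF equivp_torus_rel] by simp
  fix a b c :: "'a torus"
  show "a + b + c = a + (b + c)" by transfer (simp add: eq add.assoc)
  show "a + b = b + a" by transfer (simp add: eq add.commute)
  show "0 + a = a" by transfer (simp add: eq)
  show "- a + a = 0" by transfer (simp add: eq)
  show "a - b = a + - b" by (rule minus_torus_def)
qed

end

instantiation torus :: (finite) topological_space
begin

definition open_torus :: "'a torus set \<Rightarrow> bool" where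
  "open_torus S \<longleftrightarrow> open (torus_of -` S)"

instance
  by standard (auto simp: open_torus_def vimage_Union)

end

text \<open>The local inverses of the projection are the charts of the torus.\<close>

definition torus_atlas :: "('m::finite torus, real^'m) chart set" where
  "torus_atlas = {(torus_of ` B, inv_into B torus_of) | B. open B \<and> inj_on torus_of B}"

lemma torus_of_eq_iff: "torus_of x = torus_of y \<longleftrightarrow> torus_rel x y"
  by (rule torus.abs_eq_iff)

lemma torus_of_add: "torus_of (x + y) = torus_of x + torus_of y"
  by (simp add: plus_torus.abs_eq)

lemma torus_of_rep: "torus_of (rep_torus t) = t"
  using Quotient3_abs_rep[OF Quotient3_torus] .


section \<open>Hamiltonian actions\<close>

text \<open>The acting group is a (product of) tori \<^typ>\<open>'g\<close> with smooth structure \<open>G\<close>, written additively.\<close>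

definition smooth_action ::
    "('g::{ab_group_add,topological_space}, 'l::euclidean_space) chart set \<Rightarrow>
     'a topology \<Rightarrow> ('a, 'e::euclidean_space) chart set \<Rightarrow> ('g \<Rightarrow> 'a \<Rightarrow> 'a) \<Rightarrow> bool" where
  "smooth_action G X A act \<longleftrightarrow>
     smooth_map (prod_topology euclidean X) (prod_atlas G A) X A (\<lambda>(g, p). act g p) \<and>
     (\<forall>p \<in> topspace X. act 0 p = p \<and> (\<forall>g h. act (g + h) p = act g (act h p)))"

text \<open>The components in the chart \<open>c\<close> at the point \<open>p\<close> of the vector field induced by \<open>\<xi>\<close>.\<close>

definition induced_field ::
    "('l::real_vector \<Rightarrow> 'g) \<Rightarrow> ('g \<Rightarrow> 'a \<Rightarrow> 'a) \<Rightarrow> 'l \<Rightarrow>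
     ('a, 'e::euclidean_space) chart \<Rightarrow> 'a \<Rightarrow> 'e" where
  "induced_field ex act \<xi> c p = vector_derivative (\<lambda>s. snd c (act (ex (s *\<^sub>R \<xi>)) p)) (at 0)"

text \<open>The dual of the Lie algebra \<^typ>\<open>'l\<close> is identified with \<^typ>\<open>'l\<close> by the standard inner
  product. The last conjunct is \<open>\<iota>(\<xi>\<^sub>M) \<omega> = - d\<langle>\<Phi>, \<xi>\<rangle>\<close>.\<close>

definition moment_map ::
    "('l::euclidean_space \<Rightarrow> 'g) \<Rightarrow> 'a topology \<Rightarrow> ('a, 'e::euclidean_space) chart set \<Rightarrow>
     ('a, 'e) form2 \<Rightarrow> ('g \<Rightarrow> 'a \<Rightarrow> 'a) \<Rightarrow> ('a \<Rightarrow> 'l) \<Rightarrow> bool" where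
  "moment_map ex X A \<omega> act \<Phi> \<longleftrightarrow>
     smooth_map X A euclidean (open_atlas UNIV) \<Phi> \<and>
     (\<forall>g. \<forall>p \<in> topspace X. \<Phi> (act g p) = \<Phi> p) \<and>
     (\<forall>\<xi>. \<forall>c\<in>A. \<forall>p \<in> fst c. \<forall>v.
        \<omega> c (snd c p) (induced_field ex act \<xi> c p) v =
        - frechet_derivative (\<lambda>x. \<Phi> (inv_into (fst c) (snd c) x) \<bullet> \<xi>) (at (snd c p)) v)"

definition hamiltonian_space ::
    "('g::{ab_group_add,topological_space}, 'l::euclidean_space) chart set \<Rightarrow> ('l \<Rightarrow> 'g) \<Rightarrow>
     'a topology \<Rightarrow> ('a, 'e::euclidean_space) chart set \<Rightarrow> ('a, 'e) form2 \<Rightarrow>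
     ('g \<Rightarrow> 'a \<Rightarrow> 'a) \<Rightarrow> ('a \<Rightarrow> 'l) \<Rightarrow> bool" where
  "hamiltonian_space G ex X A \<omega> act \<Phi> \<longleftrightarrow>
     smooth_manifold X A \<and> symplectic_form A \<omega> \<and>
     smooth_action G X A act \<and> (\<forall>g. is_pullback A A (act g) \<omega> \<omega>) \<and>
     moment_map ex X A \<omega> act \<Phi>"


section \<open>Unimodular sets\<close>

definition primitive_vector :: "real^'n \<Rightarrow> bool" where
  "primitive_vector v \<longleftrightarrow>
     integral_vector v \<and> (\<forall>k w. integral_vector w \<and> v = of_int k *\<^sub>R w \<longrightarrow> \<bar>k\<bar> = 1)"

definition subtorus :: "'n::finite torus set \<Rightarrow> bool" where
  "subtorus H \<longleftrightarrow>
     0 \<in> H \<and> (\<forall>a\<in>H. \<forall>b\<in>H. a + b \<in> H) \<and> (\<forall>a\<in>H. - a \<in> H) \<and> closed H \<and> connected H"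

text \<open>The Lie algebra of \<open>H\<close> intersected with \<open>\<int>\<^sup>n\<close>, that is, the kernel of the exponential map
  of \<open>H\<close> up to the factor \<open>2\<pi>\<close>.\<close>

definition integral_lattice :: "'n::finite torus set \<Rightarrow> (real^'n) set" where
  "integral_lattice H = {v. integral_vector v \<and> (\<forall>s. torus_of (s *\<^sub>R v) \<in> H)}"

definition lattice_basis :: "(real^'n) set \<Rightarrow> 'i::finite set \<Rightarrow> ('i \<Rightarrow> real^'n) \<Rightarrow> bool" where
  "lattice_basis L I b \<longleftrightarrow>
     L = range (\<lambda>k :: 'i \<Rightarrow> int. \<Sum>i\<in>I. of_int (k i) *\<^sub>R b i) \<and>
     (\<forall>k :: 'i \<Rightarrow> int. (\<Sum>i\<in>I. of_int (k i) *\<^sub>R b i) = 0 \<longrightarrow> (\<forall>i\<in>I. k i = 0))"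

definition polyhedron_of :: "('N \<Rightarrow> real^'n) \<Rightarrow> ('N \<Rightarrow> real) \<Rightarrow> (real^'n) set" where
  "polyhedron_of \<eta> \<kappa> = {x. \<forall>i. x \<bullet> \<eta> i \<le> \<kappa> i}"

definition polyhedron_face :: "('N \<Rightarrow> real^'n) \<Rightarrow> ('N \<Rightarrow> real) \<Rightarrow> 'N set \<Rightarrow> (real^'n) set" where
  "polyhedron_face \<eta> \<kappa> I = {x \<in> polyhedron_of \<eta> \<kappa>. \<forall>i\<in>I. x \<bullet> \<eta> i = \<kappa> i}"

text \<open>The first two conjuncts say that \<open>\<eta> i\<close> is an outward conormal vector of the \<open>i\<close>-th facet of
  the polyhedral set, the facets being pairwise distinct (and hence that this set has interior
  points). As \<open>\<Delta>\<close> is relatively open, its vertices are the vertices of the polyhedral set that it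
  contains, the edges of \<open>\<Delta>\<close> at such a point are germs of edges of the polyhedral set, and the
  facets of \<open>\<Delta>\<close> are its nonempty intersections with the facets of the polyhedral set.\<close>

definition unimodular_set ::
    "('N::finite \<Rightarrow> real^'n) \<Rightarrow> ('N \<Rightarrow> real) \<Rightarrow> (real^'n) set \<Rightarrow> bool" where
  "unimodular_set \<eta> \<kappa> \<Delta> \<longleftrightarrow>
     (\<forall>i. polyhedron_face \<eta> \<kappa> {i} facet_of polyhedron_of \<eta> \<kappa>) \<and>
     inj (\<lambda>i. polyhedron_face \<eta> \<kappa> {i}) \<and>
     openin (top_of_set (polyhedron_of \<eta> \<kappa>)) \<Delta> \<and>
     (\<forall>v\<in>\<Delta>. v extreme_point_of polyhedron_of \<eta> \<kappa> \<longrightarrow>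
        card {F. F edge_of polyhedron_of \<eta> \<kappa> \<and> v \<in> F} = CARD('n)) \<and>
     (\<forall>i. \<Delta> \<inter> polyhedron_face \<eta> \<kappa> {i} \<noteq> {} \<longrightarrow> primitive_vector (\<eta> i)) \<and>
     (\<forall>I. \<Delta> \<inter> polyhedron_face \<eta> \<kappa> I \<noteq> {} \<longrightarrow>
        (\<exists>H. subtorus H \<and> lattice_basis (integral_lattice H) I \<eta>))"


section \<open>The Hamiltonian space \<open>U \<times> T\<^sup>n \<times> \<complex>\<^sup>N\<close>\<close>

type_synonym ('n, 'N) total_space = "(real^'n) \<times> 'n torus \<times> (complex^'N)"
type_synonym ('n, 'N) total_model = "(real^'n) \<times> (real^'n) \<times> (complex^'N)"

definition total_topology :: "(real^'n::finite) set \<Rightarrow> ('n, 'N::finite) total_space topology" where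
  "total_topology U = prod_topology (top_of_set U) (prod_topology euclidean euclidean)"

definition total_atlas ::
    "(real^'n::finite) set \<Rightarrow> (('n, 'N::finite) total_space, ('n, 'N) total_model) chart set" where
  "total_atlas U = prod_atlas (open_atlas U) (prod_atlas torus_atlas (open_atlas UNIV))"

text \<open>The form \<open>\<Sum> dx\<^sub>i \<and> d\<theta>\<^sub>i + \<surd>-1 \<Sum> dz\<^sub>i \<and> dz\<^sub>i\<^sup>*\<close> on the tangent vectors \<open>(a, \<alpha>, u)\<close> and
  \<open>(b, \<beta>, v)\<close>. Its coefficients are the same in all charts of the atlas, as these differ by
  translations of \<open>\<theta>\<close>. The operator \<^const>\<open>Re\<close> only changes the type, as its argument is real.\<close>

definition total_form :: "(('n::finite, 'N::finite) total_space, ('n, 'N) total_model) form2" where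
  "total_form c p = (\<lambda>(a, \<alpha>, u) (b, \<beta>, v).
     (\<Sum>i\<in>UNIV. a $ i * \<beta> $ i - b $ i * \<alpha> $ i) +
     Re (\<i> * (\<Sum>i\<in>UNIV. u $ i * cnj (v $ i) - v $ i * cnj (u $ i))))"

text \<open>Torus elements are evaluated on representatives; \<open>total_act_torus_of\<close> shows that the result
  does not depend on them if the vectors \<open>\<eta> i\<close> are integral.\<close>

definition total_act ::
    "('N::finite \<Rightarrow> real^'n::finite) \<Rightarrow> 'n torus \<times> 'N torus \<Rightarrow>
     ('n, 'N) total_space \<Rightarrow> ('n, 'N) total_space" where
  "total_act \<eta> = (\<lambda>(s, t) (x, \<theta>, z).
     (x,
      \<theta> + torus_of (\<Sum>i\<in>UNIV. rep_torus s $ i *\<^sub>R axis i 1) +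
          torus_of (\<Sum>i\<in>UNIV. rep_torus t $ i *\<^sub>R \<eta> i),
      \<chi> i. exp (\<i> * of_real (rep_torus t $ i)) * z $ i))"

lemma total_act_torus_of:
  fixes \<eta> :: "'N::finite \<Rightarrow> real^'n::finite"
  assumes "\<And>i. integral_vector (\<eta> i)"
  shows "total_act \<eta> (torus_of s, torus_of t) (x, torus_of \<theta>, z) =
     (x, torus_of (\<theta> + (\<Sum>i\<in>UNIV. s $ i *\<^sub>R axis i 1) + (\<Sum>i\<in>UNIV. t $ i *\<^sub>R \<eta> i)),
      \<chi> i. exp (\<i> * of_real (t $ i)) * z $ i)"
proof -
  have basis: "(\<Sum>i\<in>UNIV. y $ i *\<^sub>R axis i 1) = y" for y :: "real^'n"
    using basis_expansion[of y] by (simp add: scalar_mult_eq_scaleR)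
  have "torus_rel (rep_torus (torus_of t)) t"
    by (simp add: torus_of_eq_iff[symmetric] torus_of_rep)
  then obtain k where k: "integral_vector k" "rep_torus (torus_of t) - t = (2 * pi) *\<^sub>R k"
    by (auto simp: torus_rel_def)
  have rk: "rep_torus (torus_of t) $ i = t $ i + 2 * pi * k $ i" for i
    using arg_cong[OF k(2), of "\<lambda>y. y $ i"] by simp
  have int: "k $ i \<in> \<int>" for i using k(1) by (simp add: integral_vector_def)
  have 1: "torus_of (\<Sum>i\<in>UNIV. rep_torus (torus_of t) $ i *\<^sub>R \<eta> i) =
      torus_of (\<Sum>i\<in>UNIV. t $ i *\<^sub>R \<eta> i)"
    unfolding torus_of_eq_iff torus_rel_def
  proof (intro exI conjI)
    show "integral_vector (\<Sum>i\<in>UNIV. k $ i *\<^sub>R \<eta> i)"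
      using assms int by (auto simp: integral_vector_def intro!: Ints_sum)
    show "(\<Sum>i\<in>UNIV. rep_torus (torus_of t) $ i *\<^sub>R \<eta> i) - (\<Sum>i\<in>UNIV. t $ i *\<^sub>R \<eta> i) =
        (2 * pi) *\<^sub>R (\<Sum>i\<in>UNIV. k $ i *\<^sub>R \<eta> i)"
      by (simp add: rk scaleR_left_distrib sum.distrib scaleR_sum_right)
  qed
  have 2: "exp (\<i> * of_real (rep_torus (torus_of t) $ i)) = exp (\<i> * of_real (t $ i))" for i
  proof -
    obtain m where m: "k $ i = of_int m" using int by (auto elim: Ints_cases)
    have "\<i> * of_real (rep_torus (torus_of t) $ i) =
        \<i> * of_real (t $ i) + \<i> * (of_int m * (of_real pi * 2))"
      by (simp add: rk m algebra_simps)
    then show ?thesis by (simp only: exp_plus_2pin)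
  qed
  show ?thesis
    by (simp add: total_act_def 1 2 basis torus_of_rep torus_of_add)
qed

definition total_moment ::
    "('N::finite \<Rightarrow> real^'n::finite) \<Rightarrow> ('N \<Rightarrow> real) \<Rightarrow>
     ('n, 'N) total_space \<Rightarrow> (real^'n) \<times> (real^'N)" where
  "total_moment \<eta> \<kappa> = (\<lambda>(x, \<theta>, z). (x, \<chi> i. x \<bullet> \<eta> i + (norm (z $ i))\<^sup>2 - \<kappa> i))"

definition zero_level ::
    "(real^'n::finite) set \<Rightarrow> ('N::finite \<Rightarrow> real^'n) \<Rightarrow> ('N \<Rightarrow> real) \<Rightarrow> ('n, 'N) total_space set"
  where
  "zero_level U \<eta> \<kappa> = {p \<in> U \<times> UNIV \<times> UNIV. snd (total_moment \<eta> \<kappa> p) = 0}"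

text \<open>The points of \<open>M\<^sub>\<Delta>\<close> are the orbits of \<open>T\<^sup>N\<close> in the zero level, as sets.\<close>

definition orbit ::
    "('N::finite \<Rightarrow> real^'n::finite) \<Rightarrow> ('n, 'N) total_space \<Rightarrow> ('n, 'N) total_space set" where
  "orbit \<eta> p = range (\<lambda>t. total_act \<eta> (0, t) p)"

definition reduced_topology ::
    "(real^'n::finite) set \<Rightarrow> ('N::finite \<Rightarrow> real^'n) \<Rightarrow> ('N \<Rightarrow> real) \<Rightarrow>
     ('n, 'N) total_space set topology" where
  "reduced_topology U \<eta> \<kappa> =
     quotient_topology (subtopology (total_topology U) (zero_level U \<eta> \<kappa>)) (orbit \<eta>)"

end

theory Submission
  imports Defs
begin

text \<open>Locally, \<open>x\<close> lies on the face \<open>F\<^sub>I\<close> with \<open>I = {i. z\<^sub>i = 0}\<close>. Unimodularity says that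
  a real combination of the \<open>\<eta>\<^sub>i\<close>, \<open>i \<in> I\<close>, is integral only if its coefficients are integers; so these
  vectors are linearly independent and \<open>T\<^sup>N\<close> acts freely on the zero level. Complete them to a real
  basis \<open>b\<^sub>k\<close> of \<open>\<real>\<^sup>n\<close>. A slice for the action consists of the points
  with \<open>z\<^sub>j > 0\<close> for \<open>j \<notin> I\<close> and \<open>\<theta>\<close> in the span of the \<open>b\<^sub>k\<close> that complete the basis. The coordinates
  \<open>(\<langle>x, b\<^sub>k\<rangle>, \<theta>\<^sub>k)\<close> for these \<open>k\<close> together with \<open>z\<^sub>i = (a + \<surd>-1 \<alpha>) / \<surd>2\<close> for \<open>i \<in> I\<close>
  parametrize the slice, and in them the reduced form is \<open>\<Sum> da\<^sub>k \<and> d\<alpha>\<^sub>k\<close>. Adding the angles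
  \<open>t \<in> \<real>\<^sup>N\<close> gives coordinates of the zero level in which the orbit map is a projection. All maps are
  studied through their lifts to the covering \<open>U \<times> \<real>\<^sup>n \<times> \<complex>\<^sup>N\<close>, where they are given by global
  formulas.\<close>

section \<open>Smooth maps near a point\<close>

text \<open>Charts are inverted by Hilbert choice, so changes of charts and their Jacobians have no
  formula to compute with. A map is instead represented near a point by a germ between models, and
  derivatives are controlled indirectly: whenever a smooth germ with values in the lifted level is
  factored through \<open>level_map\<close>, the given form on its derivative equals
  \<open>red_form\<close> on the slice part of the derivative of the factor. From this come the
  compatibility of the reduced form with changes of charts, its invariance, its pullback property
  and, with nondegeneracy, the surjectivity of the differential of the orbit map. The induced vector
  field is likewise found by factoring its flow.

  The completed basis may be real because the covering has real angles; integrality serves to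
  compare points with the same image in the torus, which is where saturation gives freeness. The
  number of discs varies from point to point while the model does not: each facet of the frame
  trades a pair of coordinates of \<open>(x, \<theta>)\<close> for the pair
  \<open>(Re z, Im z)\<close>.\<close>

lemma Ck_on_subset: "Ck_on k S f \<Longrightarrow> T \<subseteq> S \<Longrightarrow> Ck_on k T f"
  by (induction k arbitrary: f) (auto intro: continuous_on_subset)

text \<open>Coordinate changes must be smooth on images of sets under charts, where an open
  neighbourhood of each single point is easier to produce. This suffices because
  \<open>Ck_on\<close> differentiates with \<open>at x\<close>, independently of
  \<open>S\<close>.\<close>

lemma Ck_on_local:
  assumes "\<And>x. x \<in> S \<Longrightarrow> \<exists>T. open T \<and> x \<in> T \<and> Ck_on k T f"
  shows "Ck_on k S f"
  using assms
proof (induction k arbitrary: f)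
  case 0
  have "continuous (at x within S) f" if "x \<in> S" for x
  proof -
    obtain T where "open T" "x \<in> T" "continuous_on T f"
      using 0[OF \<open>x \<in> S\<close>] by auto
    then show ?thesis
      by (metis at_within_open continuous_at_imp_continuous_at_within continuous_on_eq_continuous_within)
  qed
  then show ?case by (simp add: continuous_on_eq_continuous_within)
next
  case (Suc k)
  show ?case
    unfolding Ck_on.simps
  proof (intro conjI ballI allI)
    fix x assume "x \<in> S"
    then show "f differentiable at x" using Suc.prems by force
  next
    fix v
    show "Ck_on k S (\<lambda>x. frechet_derivative f (at x) v)"
    proof (rule Suc.IH)
      fix x assume "x \<in> S"
      then obtain T where "open T" "x \<in> T" "Ck_on (Suc k) T f"
        using Suc.prems by blast
      then show "\<exists>T. open T \<and> x \<in> T \<and> Ck_on k T (\<lambda>x. frechet_derivative f (at x) v)"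
        by auto
    qed
  qed
qed

lemma Ck_on_pred: "Ck_on (Suc k) S f \<Longrightarrow> Ck_on k S f"
proof (induction k arbitrary: f)
  case 0
  then show ?case
    by (auto intro!: continuous_at_imp_continuous_on differentiable_imp_continuous_within)
next
  case (Suc k)
  show ?case
    unfolding Ck_on.simps
  proof (intro conjI allI)
    show "\<forall>x\<in>S. f differentiable at x" using Suc.prems by simp
    fix v
    have "Ck_on (Suc k) S (\<lambda>x. frechet_derivative f (at x) v)" using Suc.prems by simp
    then show "Ck_on k S (\<lambda>x. frechet_derivative f (at x) v)" by (rule Suc.IH)
  qed
qed

lemma frechet_derivative_cong_open:
  assumes "open S" "x \<in> S" "\<And>y. y \<in> S \<Longrightarrow> f y = g y"
  shows "frechet_derivative f (at x) = frechet_derivative g (at x)"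
proof -
  have "(f has_derivative D) (at x) \<longleftrightarrow> (g has_derivative D) (at x)" for D
    using assms has_derivative_transform_within_open[of f D x UNIV S g]
      has_derivative_transform_within_open[of g D x UNIV S f] by auto
  then show ?thesis by (simp add: frechet_derivative_def)
qed

lemma Ck_on_cong:
  assumes "open S" "\<And>x. x \<in> S \<Longrightarrow> f x = g x" "Ck_on k S f"
  shows "Ck_on k S g"
  using assms(2,3)
proof (induction k arbitrary: f g)
  case 0
  then show ?case by (auto cong: continuous_on_cong)
next
  case (Suc k)
  show ?case
    unfolding Ck_on.simps
  proof (intro conjI ballI allI)
    fix x assume "x \<in> S"
    then have "(f has_derivative frechet_derivative f (at x)) (at x)"
      using Suc.prems by (simp add: frechet_derivative_works[symmetric])
    then have "(g has_derivative frechet_derivative f (at x)) (at x)"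
      using has_derivative_transform_within_open[OF _ \<open>open S\<close> \<open>x \<in> S\<close>] Suc.prems(1) by blast
    then show "g differentiable at x" by (auto simp: differentiable_def)
  next
    fix v
    show "Ck_on k S (\<lambda>x. frechet_derivative g (at x) v)"
    proof (rule Suc.IH[of "\<lambda>x. frechet_derivative f (at x) v"])
      show "frechet_derivative f (at x) v = frechet_derivative g (at x) v" if "x \<in> S" for x
        using frechet_derivative_cong_open[OF \<open>open S\<close> that Suc.prems(1)] by simp
    qed (use Suc.prems in simp)
  qed
qed

text \<open>Replaces the choice operator in \<open>frechet_derivative\<close> by an explicit
  derivative, so that inductions on \<open>k\<close> can run on formulas.\<close>

lemma Ck_on_SucI:
  assumes "open S" "\<And>x. x \<in> S \<Longrightarrow> (f has_derivative f' x) (at x)"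
    and "\<And>v. Ck_on k S (\<lambda>x. f' x v)"
  shows "Ck_on (Suc k) S f"
  unfolding Ck_on.simps
proof (intro conjI ballI allI)
  fix x assume "x \<in> S"
  then show "f differentiable at x" using assms(2) by (auto simp: differentiable_def)
next
  fix v
  show "Ck_on k S (\<lambda>x. frechet_derivative f (at x) v)"
    by (rule Ck_on_cong[OF \<open>open S\<close> _ assms(3)[of v]])
      (use assms(2) frechet_derivative_at in fastforce)
qed

lemma Ck_on_SucD:
  assumes "Ck_on (Suc k) S f" "x \<in> S"
  shows "(f has_derivative frechet_derivative f (at x)) (at x)"
  using assms by (simp add: frechet_derivative_works[symmetric])

lemma Ck_on_const: "open S \<Longrightarrow> Ck_on k S (\<lambda>x. c)"
proof (induction k arbitrary: c)
  case (Suc k)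
  show ?case
    by (rule Ck_on_SucI[OF Suc.prems has_derivative_const]) (use Suc in auto)
qed auto

lemma Ck_on_linear: "open S \<Longrightarrow> bounded_linear f \<Longrightarrow> Ck_on k S f"
proof (cases k)
  case (Suc j)
  assume "open S" "bounded_linear f"
  then show ?thesis unfolding Suc
    by (intro Ck_on_SucI[OF _ bounded_linear_imp_has_derivative] Ck_on_const) auto
qed (simp add: linear_continuous_on)

lemma Ck_on_add: "open S \<Longrightarrow> Ck_on k S f \<Longrightarrow> Ck_on k S g \<Longrightarrow> Ck_on k S (\<lambda>x. f x + g x)"
proof (induction k arbitrary: f g)
  case (Suc k)
  show ?case
    by (rule Ck_on_SucI[OF Suc.prems(1) has_derivative_add[OF Ck_on_SucD Ck_on_SucD]])
      (use Suc in auto)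
qed (auto intro: continuous_intros)

lemma Ck_on_bilinear:
  assumes "bounded_bilinear p"
  shows "open S \<Longrightarrow> Ck_on k S f \<Longrightarrow> Ck_on k S g \<Longrightarrow> Ck_on k S (\<lambda>x. p (f x) (g x))"
proof (induction k arbitrary: f g)
  case 0
  then show ?case by (simp add: bounded_bilinear.continuous_on[OF assms])
next
  case (Suc k)
  show ?case
  proof (rule Ck_on_SucI[OF Suc.prems(1) bounded_bilinear.FDERIV[OF assms Ck_on_SucD Ck_on_SucD]])
    fix v
    show "Ck_on k S (\<lambda>x. p (f x) (frechet_derivative g (at x) v) + p (frechet_derivative f (at x) v) (g x))"
      by (intro Ck_on_add Suc.IH Suc.prems) (use Suc.prems Ck_on_pred in auto)
  qed (use Suc.prems in auto)
qed

lemma Ck_on_sum: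
  assumes "open S" "finite A" "\<And>i. i \<in> A \<Longrightarrow> Ck_on k S (f i)"
  shows "Ck_on k S (\<lambda>x. \<Sum>i\<in>A. f i x)"
  using assms(2,3)
  by (induction A rule: finite_induct) (auto intro!: Ck_on_const Ck_on_add \<open>open S\<close>)

lemma Ck_on_linear_compose:
  assumes "bounded_linear L"
  shows "open S \<Longrightarrow> Ck_on k S f \<Longrightarrow> Ck_on k S (\<lambda>x. L (f x))"
proof (induction k arbitrary: f)
  case 0
  then show ?case by (simp add: bounded_linear.continuous_on[OF assms])
next
  case (Suc k)
  show ?case
    by (rule Ck_on_SucI[OF Suc.prems(1) bounded_linear.has_derivative[OF assms Ck_on_SucD]])
      (use Suc in auto)
qed

text \<open>The chain rule applies the derivative of \<open>g\<close> to the moving vector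
  \<open>f'(x) v\<close>, whereas \<open>Ck_on\<close> controls derivatives along fixed vectors
  only. Expanding in \<open>Basis\<close> gives a finite sum of products to which the induction
  hypothesis applies.\<close>

lemma Ck_on_compose:
  fixes f :: "'a::euclidean_space \<Rightarrow> 'b::euclidean_space" and g :: "'b \<Rightarrow> 'c::euclidean_space"
  shows "open S \<Longrightarrow> open T \<Longrightarrow> f ` S \<subseteq> T \<Longrightarrow> Ck_on k S f \<Longrightarrow> Ck_on k T g \<Longrightarrow> Ck_on k S (\<lambda>x. g (f x))"
proof (induction k arbitrary: g)
  case 0
  then show ?case by (metis Ck_on.simps(1) continuous_on_compose2)
next
  case (Suc k)
  have f: "Ck_on k S f" using Suc.prems Ck_on_pred by blast
  show ?case
  proof (rule Ck_on_SucI[OF Suc.prems(1)])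
    fix x assume "x \<in> S"
    have gd: "(g has_derivative frechet_derivative g (at (f x))) (at (f x))"
      using Suc.prems \<open>x \<in> S\<close> by (intro Ck_on_SucD) auto
    have lin: "linear (frechet_derivative g (at (f x)))"
      using gd has_derivative_linear by blast
    have "frechet_derivative g (at (f x)) (frechet_derivative f (at x) v) =
      (\<Sum>b\<in>Basis. (frechet_derivative f (at x) v \<bullet> b) *\<^sub>R frechet_derivative g (at (f x)) b)" for v
    proof -
      have "frechet_derivative g (at (f x)) w = (\<Sum>b\<in>Basis. (w \<bullet> b) *\<^sub>R frechet_derivative g (at (f x)) b)" for w
        using linear_sum[OF lin, of "\<lambda>b. (w \<bullet> b) *\<^sub>R b" Basis]
        by (simp add: euclidean_representation linear_cmul[OF lin])
      then show ?thesis .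
    qed
    then show "((\<lambda>x. g (f x)) has_derivative (\<lambda>v. \<Sum>b\<in>Basis. (frechet_derivative f (at x) v \<bullet> b) *\<^sub>R frechet_derivative g (at (f x)) b)) (at x)"
      using has_derivative_compose[OF Ck_on_SucD[OF Suc.prems(4) \<open>x \<in> S\<close>] gd] by simp
  next
    fix v
    show "Ck_on k S (\<lambda>x. \<Sum>b\<in>Basis. (frechet_derivative f (at x) v \<bullet> b) *\<^sub>R frechet_derivative g (at (f x)) b)"
    proof (intro Ck_on_sum Ck_on_bilinear[OF bounded_bilinear_scaleR] Suc.prems)
      fix b :: 'b
      show "Ck_on k S (\<lambda>x. frechet_derivative f (at x) v \<bullet> b)"
        using Suc.prems by (intro Ck_on_linear_compose[OF bounded_linear_inner_left]) auto
      show "Ck_on k S (\<lambda>x. frechet_derivative g (at (f x)) b)"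
        by (rule Suc.IH[of "\<lambda>y. frechet_derivative g (at y) b"]) (use Suc.prems f in \<open>simp_all\<close>)
    qed auto
  qed
qed

text \<open>The notion for a germ: its rules need no bookkeeping of domains, and side conditions
  such as positivity under a root are required at the single point.\<close>

definition smooth_at :: "('a::euclidean_space \<Rightarrow> 'b::euclidean_space) \<Rightarrow> 'a \<Rightarrow> bool" where
  "smooth_at f x \<longleftrightarrow> (\<exists>S. open S \<and> x \<in> S \<and> smooth_on S f)"

lemma smooth_on_if_smooth_at:
  assumes "\<And>x. x \<in> S \<Longrightarrow> smooth_at f x"
  shows "smooth_on S f"
  unfolding smooth_on_def
proof (intro allI Ck_on_local)
  fix k x assume "x \<in> S"
  then show "\<exists>T. open T \<and> x \<in> T \<and> Ck_on k T f"
    using assms by (metis smooth_at_def smooth_on_def)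
qed

lemma smooth_atI: "open S \<Longrightarrow> x \<in> S \<Longrightarrow> (\<And>k. Ck_on k S f) \<Longrightarrow> smooth_at f x"
  by (auto simp: smooth_at_def smooth_on_def)

lemma smooth_at_cong:
  assumes "smooth_at f x" "\<forall>\<^sub>F y in nhds x. f y = g y"
  shows "smooth_at g x"
proof -
  obtain S where S: "open S" "x \<in> S" "\<And>k. Ck_on k S f"
    using assms(1) by (auto simp: smooth_at_def smooth_on_def)
  obtain T where T: "open T" "x \<in> T" "\<And>y. y \<in> T \<Longrightarrow> f y = g y"
    using assms(2) by (auto simp: eventually_nhds)
  show ?thesis
  proof (rule smooth_atI[of "S \<inter> T"])
    show "Ck_on k (S \<inter> T) g" for k
      by (rule Ck_on_cong[of _ f]) (use S T Ck_on_subset[OF S(3)] in auto)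
  qed (use S T in auto)
qed

lemma smooth_at_differentiable: "smooth_at f x \<Longrightarrow> f differentiable at x"
  by (metis Ck_on.simps(2) smooth_at_def smooth_on_def)

lemma smooth_at_has_derivative:
  "smooth_at f x \<Longrightarrow> (f has_derivative frechet_derivative f (at x)) (at x)"
  by (simp add: smooth_at_differentiable frechet_derivative_works[symmetric])

lemma smooth_at_isCont: "smooth_at f x \<Longrightarrow> isCont f x"
  by (simp add: differentiable_imp_continuous_within smooth_at_differentiable)

section \<open>Smoothness rules for composite expressions\<close>

named_theorems smooth_intros

lemma smooth_at_const [smooth_intros]: "smooth_at (\<lambda>x. c) x"
  by (rule smooth_atI[of UNIV]) (auto intro: Ck_on_const)

lemma smooth_at_ident [smooth_intros]: "smooth_at (\<lambda>x. x) x"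
  by (rule smooth_atI[of UNIV]) (auto intro: Ck_on_linear bounded_linear_ident)

lemma smooth_at_compose:
  assumes "smooth_at f x" "smooth_at g (f x)"
  shows "smooth_at (\<lambda>x. g (f x)) x"
proof -
  obtain S where S: "open S" "x \<in> S" "\<And>k. Ck_on k S f"
    using assms(1) by (auto simp: smooth_at_def smooth_on_def)
  obtain T where T: "open T" "f x \<in> T" "\<And>k. Ck_on k T g"
    using assms(2) by (auto simp: smooth_at_def smooth_on_def)
  have op: "open (S \<inter> f -` T)"
    using S T by (metis Ck_on.simps(1) Int_commute continuous_on_open_vimage)
  show ?thesis
    by (rule smooth_atI[OF op _ Ck_on_compose[OF op T(1) _ Ck_on_subset[OF S(3)] T(3)]])
      (use S T in auto)
qed

lemma smooth_at_bilinear: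
  assumes p: "bounded_bilinear p" and "smooth_at f x" "smooth_at g x"
  shows "smooth_at (\<lambda>x. p (f x) (g x)) x"
proof -
  obtain S where S: "open S" "x \<in> S" "\<And>k. Ck_on k S f"
    using assms(2) by (auto simp: smooth_at_def smooth_on_def)
  obtain T where T: "open T" "x \<in> T" "\<And>k. Ck_on k T g"
    using assms(3) by (auto simp: smooth_at_def smooth_on_def)
  show ?thesis
    by (rule smooth_atI[of "S \<inter> T"])
      (use S T in \<open>auto intro!: Ck_on_bilinear[OF p] Ck_on_subset[OF S(3)] Ck_on_subset[OF T(3)]\<close>)
qed

lemma smooth_at_linear: "bounded_linear L \<Longrightarrow> smooth_at f x \<Longrightarrow> smooth_at (\<lambda>x. L (f x)) x"
  by (rule smooth_at_compose, assumption, rule smooth_atI[of UNIV])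
    (auto intro: Ck_on_linear)

lemma smooth_at_add [smooth_intros]:
  assumes "smooth_at f x" "smooth_at g x"
  shows "smooth_at (\<lambda>x. f x + g x) x"
proof -
  obtain S where S: "open S" "x \<in> S" "\<And>k. Ck_on k S f"
    using assms(1) by (auto simp: smooth_at_def smooth_on_def)
  obtain T where T: "open T" "x \<in> T" "\<And>k. Ck_on k T g"
    using assms(2) by (auto simp: smooth_at_def smooth_on_def)
  show ?thesis
    by (rule smooth_atI[of "S \<inter> T"])
      (use S T in \<open>auto intro!: Ck_on_add Ck_on_subset[OF S(3)] Ck_on_subset[OF T(3)]\<close>)
qed

lemmas smooth_at_scaleR [smooth_intros] = smooth_at_bilinear[OF bounded_bilinear_scaleR]
lemmas smooth_at_inner [smooth_intros] = smooth_at_bilinear[OF bounded_bilinear_inner]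
lemmas smooth_at_Re [smooth_intros] = smooth_at_linear[OF bounded_linear_Re]
lemmas smooth_at_Im [smooth_intros] = smooth_at_linear[OF bounded_linear_Im]
lemmas smooth_at_fst [smooth_intros] = smooth_at_linear[OF bounded_linear_fst]
lemmas smooth_at_snd [smooth_intros] = smooth_at_linear[OF bounded_linear_snd]
lemmas smooth_at_minus [smooth_intros] = smooth_at_linear[OF bounded_linear_minus[OF bounded_linear_ident]]
lemmas smooth_at_vec_nth [smooth_intros] = smooth_at_linear[OF bounded_linear_vec_nth]

lemma smooth_at_mult [smooth_intros]:
  fixes f g :: "'a::euclidean_space \<Rightarrow> 'b::{euclidean_space, real_normed_algebra}"
  shows "smooth_at f x \<Longrightarrow> smooth_at g x \<Longrightarrow> smooth_at (\<lambda>x. f x * g x) x"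
  by (rule smooth_at_bilinear[OF bounded_bilinear_mult])

lemma smooth_at_diff [smooth_intros]:
  "smooth_at f x \<Longrightarrow> smooth_at g x \<Longrightarrow> smooth_at (\<lambda>x. f x - g x) x"
  using smooth_at_add[OF _ smooth_at_minus, of f x g] by simp

lemma smooth_at_sum [smooth_intros]:
  "(\<And>i. i \<in> A \<Longrightarrow> smooth_at (f i) x) \<Longrightarrow> smooth_at (\<lambda>x. \<Sum>i\<in>A. f i x) x"
  by (induction A rule: infinite_finite_induct) (auto intro: smooth_intros)

lemma smooth_at_power [smooth_intros]:
  fixes f :: "'a::euclidean_space \<Rightarrow> 'b::{euclidean_space, real_normed_algebra_1}"
  shows "smooth_at f x \<Longrightarrow> smooth_at (\<lambda>x. f x ^ m) x"
  by (induction m) (auto intro: smooth_intros)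

lemma smooth_at_componentwise:
  fixes f :: "'a::euclidean_space \<Rightarrow> 'b::euclidean_space"
  assumes "\<And>b. b \<in> Basis \<Longrightarrow> smooth_at (\<lambda>x. f x \<bullet> b) x"
  shows "smooth_at f x"
proof -
  have "smooth_at (\<lambda>x. \<Sum>b\<in>Basis. (f x \<bullet> b) *\<^sub>R b) x"
    by (intro smooth_at_sum smooth_at_scaleR smooth_at_const assms)
  then show ?thesis by (simp add: euclidean_representation)
qed

lemma smooth_at_Pair [smooth_intros]:
  assumes "smooth_at f x" "smooth_at g x"
  shows "smooth_at (\<lambda>x. (f x, g x)) x"
proof -
  have "bounded_linear (\<lambda>y. (y, 0))" "bounded_linear (\<lambda>y. (0, y))"
    by (auto intro!: bounded_linear_Pair bounded_linear_ident bounded_linear_zero)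
  from smooth_at_add[OF smooth_at_linear[OF this(1) assms(1)] smooth_at_linear[OF this(2) assms(2)]]
  show ?thesis by simp
qed

lemma smooth_at_vec_lambda [smooth_intros]:
  fixes f :: "'i::finite \<Rightarrow> 'a::euclidean_space \<Rightarrow> 'b::euclidean_space"
  assumes "\<And>i. smooth_at (f i) x"
  shows "smooth_at (\<lambda>x. \<chi> i. f i x) x"
proof (rule smooth_at_componentwise)
  fix b :: "'b ^ 'i" assume "b \<in> Basis"
  then obtain i u where "b = axis i u" by (auto simp: Basis_vec_def)
  then show "smooth_at (\<lambda>x. (\<chi> i. f i x) \<bullet> b) x"
    by (auto simp: inner_axis intro: smooth_intros assms)
qed

lemma smooth_at_complex_of_real [smooth_intros]:
  "smooth_at f x \<Longrightarrow> smooth_at (\<lambda>x. complex_of_real (f x)) x"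
  by (rule smooth_at_linear[OF bounded_linear_of_real])

lemma smooth_at_Complex [smooth_intros]:
  "smooth_at f x \<Longrightarrow> smooth_at g x \<Longrightarrow> smooth_at (\<lambda>x. Complex (f x) (g x)) x"
  unfolding Complex_eq by (intro smooth_intros)

lemma smooth_at_exp [smooth_intros]:
  fixes f :: "'a::euclidean_space \<Rightarrow> complex"
  assumes "smooth_at f x"
  shows "smooth_at (\<lambda>x. exp (f x)) x"
proof -
  \<comment> \<open>The factor \<open>c\<close> absorbs the direction of differentiation, so the
    family is closed under derivatives.\<close>
  have "Ck_on k UNIV (\<lambda>z::complex. c * exp z)" for k c
  proof (induction k arbitrary: c)
    case (Suc k)
    show ?case
    proof (rule Ck_on_SucI)
      show "((\<lambda>z. c * exp z) has_derivative (\<lambda>v. (c * v) * exp z)) (at z)" for z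
        by (auto intro!: derivative_eq_intros)
      show "Ck_on k UNIV (\<lambda>z. (c * v) * exp z)" for v by (rule Suc.IH)
    qed simp
  qed (auto intro!: continuous_intros)
  from this[of _ 1] have "smooth_at (\<lambda>z::complex. exp z) y" for y
    by (intro smooth_atI[of UNIV]) auto
  then show ?thesis by (rule smooth_at_compose[OF assms])
qed

lemma smooth_at_Ln [smooth_intros]:
  fixes f :: "'a::euclidean_space \<Rightarrow> complex"
  assumes "smooth_at f x" "f x \<notin> \<real>\<^sub>\<le>\<^sub>0"
  shows "smooth_at (\<lambda>x. Ln (f x)) x"
proof -
  have op: "open (- \<real>\<^sub>\<le>\<^sub>0 :: complex set)"
    by (rule open_Compl[OF closed_nonpos_Reals_complex])
  \<comment> \<open>Negative powers with a free coefficient are closed under differentiation; the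
    derivative of \<open>Ln\<close> along \<open>v\<close> is the case of exponent 1.\<close>
  have inv: "Ck_on k (- \<real>\<^sub>\<le>\<^sub>0) (\<lambda>z::complex. c * inverse z ^ m)" for k c m
  proof (induction k arbitrary: c m)
    case 0
    show ?case by (auto intro!: continuous_intros)
  next
    case (Suc k)
    show ?case
    proof (rule Ck_on_SucI[OF op])
      fix z :: complex assume "z \<in> - \<real>\<^sub>\<le>\<^sub>0"
      then have "z \<noteq> 0" by auto
      show "((\<lambda>z. c * inverse z ^ m) has_derivative (\<lambda>v. (- c * of_nat m * v) * inverse z ^ Suc m)) (at z)"
      proof (cases m)
        case (Suc j)
        have "((\<lambda>z. c * inverse z ^ Suc j) has_field_derivative
            c * ((1 + of_nat j) * (- (inverse z ^ Suc (Suc 0)) * inverse z ^ j))) (at z)"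
          by (intro DERIV_cmult DERIV_power_Suc DERIV_inverse \<open>z \<noteq> 0\<close>)
        moreover have "(*) (c * ((1 + of_nat j) * (- (inverse z ^ Suc (Suc 0)) * inverse z ^ j))) =
            (\<lambda>v. (- c * of_nat m * v) * inverse z ^ Suc m)"
          by (simp add: Suc fun_eq_iff algebra_simps)
        ultimately show ?thesis
          by (simp only: Suc has_field_derivative_def)
      qed simp
    next
      show "Ck_on k (- \<real>\<^sub>\<le>\<^sub>0) (\<lambda>z. (- c * of_nat m * v) * inverse z ^ Suc m)" for v
        by (rule Suc.IH)
    qed
  qed
  have "Ck_on k (- \<real>\<^sub>\<le>\<^sub>0) Ln" for k
  proof (cases k)
    case 0
    then show ?thesis by (auto intro!: continuous_intros)
  next
    case (Suc j)
    show ?thesis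
      unfolding Suc
    proof (rule Ck_on_SucI[OF op])
      show "(Ln has_derivative (\<lambda>v. v * inverse z ^ 1)) (at z)" if "z \<in> - \<real>\<^sub>\<le>\<^sub>0" for z
      proof -
        have "(*) (inverse z) = (\<lambda>v. v * inverse z ^ 1)" by (auto simp: mult.commute)
        then show ?thesis
          using that has_field_derivative_Ln[of z] by (simp add: has_field_derivative_def)
      qed
      show "Ck_on j (- \<real>\<^sub>\<le>\<^sub>0) (\<lambda>z::complex. v * inverse z ^ 1)" for v by (rule inv)
    qed
  qed
  then have "smooth_at Ln (f x)"
    by (intro smooth_atI[OF op]) (use assms in auto)
  then show ?thesis by (rule smooth_at_compose[OF assms(1)])
qed

lemma smooth_at_sqrt [smooth_intros]:
  assumes "smooth_at f x" "f x > 0"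
  shows "smooth_at (\<lambda>x. sqrt (f x)) x"
proof -
  \<comment> \<open>As for \<open>Ln\<close>: real powers with a free coefficient are closed under
    differentiation, and the root is the exponent 1/2.\<close>
  have powr: "Ck_on k {0<..} (\<lambda>y::real. c * y powr r)" for k c r
  proof (induction k arbitrary: c r)
    case 0
    show ?case by (auto intro!: continuous_intros)
  next
    case (Suc k)
    show ?case
    proof (rule Ck_on_SucI)
      show "((\<lambda>y. c * y powr r) has_derivative (\<lambda>v. (c * r * v) * y powr (r - 1))) (at y)"
        if "y \<in> {0<..}" for y
        using that by (auto intro!: derivative_eq_intros ext simp: powr_diff field_simps)
      show "Ck_on k {0<..} (\<lambda>y. (c * r * v) * y powr (r - 1))" for v by (rule Suc.IH)
    qed simp
  qed
  have "Ck_on k {0<..} sqrt" for k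
    by (rule Ck_on_cong[OF _ _ powr[of k 1 "1/2"]]) (auto simp: powr_half_sqrt)
  then have "smooth_at sqrt (f x)"
    by (intro smooth_atI[of "{0<..}"]) (use assms in auto)
  then show ?thesis by (rule smooth_at_compose[OF assms(1)])
qed

section \<open>Charts given by parametrizations\<close>

text \<open>The map \<open>\<phi>\<close> is the inverse of the chart, given explicitly. Its
  openness encodes the continuity of the chart.\<close>

definition chart_param ::
    "'a topology \<Rightarrow> ('a, 'e::euclidean_space) chart \<Rightarrow> 'e set \<Rightarrow> ('e \<Rightarrow> 'a) \<Rightarrow> bool" where
  "chart_param X c D \<phi> \<longleftrightarrow>
     open D \<and> fst c = \<phi> ` D \<and> (\<forall>x\<in>D. snd c (\<phi> x) = x) \<and>
     continuous_map (top_of_set D) X \<phi> \<and> (\<forall>V. open V \<and> V \<subseteq> D \<longrightarrow> openin X (\<phi> ` V))"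

lemma chart_paramD:
  assumes "chart_param X c D \<phi>"
  shows chart_param_open: "open D" and chart_param_fst: "fst c = \<phi> ` D"
    and chart_param_snd: "x \<in> D \<Longrightarrow> snd c (\<phi> x) = x"
    and chart_param_continuous: "continuous_map (top_of_set D) X \<phi>"
    and chart_param_openin: "open V \<Longrightarrow> V \<subseteq> D \<Longrightarrow> openin X (\<phi> ` V)"
  using assms by (auto simp: chart_param_def)

lemma chart_param_mem: "chart_param X c D \<phi> \<Longrightarrow> p \<in> fst c \<Longrightarrow> snd c p \<in> D \<and> \<phi> (snd c p) = p"
  by (auto simp: chart_param_def)

lemma chart_param_image: "chart_param X c D \<phi> \<Longrightarrow> snd c ` fst c = D"
  by (force simp: chart_param_def image_iff)

lemma chart_param_inv:
  assumes "chart_param X c D \<phi>" "x \<in> D"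
  shows "inv_into (fst c) (snd c) x = \<phi> x"
proof (rule inv_into_f_eq)
  show "inj_on (snd c) (fst c)"
    using chart_param_mem[OF assms(1)] by (metis inj_onI)
qed (use assms in \<open>auto simp: chart_param_def\<close>)

lemma chart_param_coord_rep:
  "chart_param X c D \<phi> \<Longrightarrow> x \<in> D \<Longrightarrow> coord_rep f c d x = snd d (f (\<phi> x))"
  by (simp add: coord_rep_def chart_param_inv)

text \<open>\<open>g\<close> represents \<open>f\<close> near \<open>x\<close>. Unlike \<^const>\<open>coord_rep\<close>, which involves the Hilbert choice
  inverses of charts, \<open>g\<close> may be an explicit formula.\<close>

definition local_lift ::
    "'a topology \<Rightarrow> ('a, 'e::euclidean_space) chart \<Rightarrow> 'b topology \<Rightarrow> ('b, 'f::euclidean_space) chart \<Rightarrow>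
     ('a \<Rightarrow> 'b) \<Rightarrow> 'e \<Rightarrow> ('e \<Rightarrow> 'f) \<Rightarrow> bool" where
  "local_lift X c Y d f x g \<longleftrightarrow>
     (\<exists>D \<phi> D' \<phi>'. chart_param X c D \<phi> \<and> chart_param Y d D' \<phi>' \<and> x \<in> D \<and> g x \<in> D' \<and>
        smooth_at g x \<and> (\<forall>\<^sub>F y in nhds x. f (\<phi> y) = \<phi>' (g y)))"

lemma local_liftI:
  assumes "chart_param X c D \<phi>" "chart_param Y d D' \<phi>'" "x \<in> D" "g x \<in> D'"
    "smooth_at g x" "\<forall>\<^sub>F y in nhds x. f (\<phi> y) = \<phi>' (g y)"
  shows "local_lift X c Y d f x g"
  using assms unfolding local_lift_def by blast

lemma smooth_at_eventually_in:
  assumes "smooth_at g x" "open D" "g x \<in> D"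
  shows "\<forall>\<^sub>F y in nhds x. g y \<in> D"
  using smooth_at_isCont[OF assms(1)] assms(2,3)
  by (simp add: isCont_def topological_tendstoD eventually_nhds_conv_at)

text \<open>Continuity of \<open>g\<close> keeps \<open>g y\<close> in \<open>D'\<close>, where the
  chart \<open>d\<close> undoes \<open>\<phi>'\<close>. Value and derivative of the coordinate
  representation can therefore be read from \<open>g\<close>.\<close>

lemma local_lift_coord_rep:
  assumes "local_lift X c Y d f x g"
  shows "\<forall>\<^sub>F y in nhds x. g y = coord_rep f c d y"
proof -
  obtain D \<phi> D' \<phi>' where *: "chart_param X c D \<phi>" "chart_param Y d D' \<phi>'" "x \<in> D" "g x \<in> D'"
    "smooth_at g x" "\<forall>\<^sub>F y in nhds x. f (\<phi> y) = \<phi>' (g y)"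
    using assms unfolding local_lift_def by blast
  have "\<forall>\<^sub>F y in nhds x. g y \<in> D'"
    using * by (intro smooth_at_eventually_in) (auto simp: chart_param_open)
  moreover have "\<forall>\<^sub>F y in nhds x. y \<in> D"
    using * by (auto simp: chart_param_open intro: eventually_nhds_in_open)
  ultimately show ?thesis
    using *(6)
    by eventually_elim (simp add: chart_param_coord_rep[OF *(1)] chart_param_snd[OF *(2)])
qed

lemma local_lift_smooth: "local_lift X c Y d f x g \<Longrightarrow> smooth_at (coord_rep f c d) x"
  by (rule smooth_at_cong[OF _ local_lift_coord_rep]) (auto simp: local_lift_def)

lemma local_lift_value: "local_lift X c Y d f x g \<Longrightarrow> coord_rep f c d x = g x"
  by (rule sym, rule eventually_nhds_x_imp_x[OF local_lift_coord_rep])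

lemma local_lift_deriv:
  assumes "local_lift X c Y d f x g"
  shows "coord_deriv f c d x = frechet_derivative g (at x)"
proof -
  obtain S where "open S" "x \<in> S" "\<And>y. y \<in> S \<Longrightarrow> g y = coord_rep f c d y"
    using local_lift_coord_rep[OF assms] unfolding eventually_nhds by blast
  then show ?thesis
    unfolding coord_deriv_def using frechet_derivative_cong_open[of S x g "coord_rep f c d"] by simp
qed

definition param_atlas :: "'a topology \<Rightarrow> ('a, 'e::euclidean_space) chart set \<Rightarrow> bool" where
  "param_atlas X A \<longleftrightarrow> (\<Union>c\<in>A. fst c) = topspace X \<and> (\<forall>c\<in>A. \<exists>D \<phi>. chart_param X c D \<phi>)"

text \<open>Continuity follows from the lifts as well: they are continuous between the models, the
  target parametrization is continuous, and the source parametrization is open.\<close>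

lemma smooth_mapI:
  assumes A: "param_atlas X A" and B: "param_atlas Y B" and f: "f ` topspace X \<subseteq> topspace Y"
    and lift: "\<And>c d p. c \<in> A \<Longrightarrow> d \<in> B \<Longrightarrow> p \<in> fst c \<Longrightarrow> f p \<in> fst d \<Longrightarrow>
      \<exists>g. local_lift X c Y d f (snd c p) g"
  shows "smooth_map X A Y B f"
  unfolding smooth_map_def
proof (intro conjI ballI)
  show "continuous_map X Y f"
    unfolding continuous_map_def
  proof (intro conjI allI impI)
    fix W assume W: "openin Y W"
    show "openin X {p \<in> topspace X. f p \<in> W}"
    proof (subst openin_subopen, intro ballI)
      fix p assume p: "p \<in> {p \<in> topspace X. f p \<in> W}"
      then obtain c d where cd: "c \<in> A" "d \<in> B" "p \<in> fst c" "f p \<in> fst d"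
        using A B f unfolding param_atlas_def by (metis (no_types, lifting) UN_E image_subset_iff mem_Collect_eq)
      from lift[OF this] obtain D \<phi> D' \<phi>' g where *: "chart_param X c D \<phi>" "chart_param Y d D' \<phi>'"
        "snd c p \<in> D" "g (snd c p) \<in> D'" "smooth_at g (snd c p)"
        "\<forall>\<^sub>F y in nhds (snd c p). f (\<phi> y) = \<phi>' (g y)"
        unfolding local_lift_def by blast
      define E where "E = {y \<in> D'. \<phi>' y \<in> W}"
      have "open E"
        using openin_continuous_map_preimage[OF chart_param_continuous[OF *(2)] W]
          chart_param_open[OF *(2)]
        by (auto simp: E_def openin_open_eq)
      have p': "\<phi> (snd c p) = p" using chart_param_mem[OF *(1) cd(3)] by simp
      have "g (snd c p) \<in> E"
        using *(4) eventually_nhds_x_imp_x[OF *(6)] p' p by (auto simp: E_def)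
      then have "\<forall>\<^sub>F y in nhds (snd c p). g y \<in> E"
        using *(5) \<open>open E\<close> smooth_at_eventually_in by blast
      moreover have "\<forall>\<^sub>F y in nhds (snd c p). y \<in> D"
        using *(1,3) by (auto simp: chart_param_open intro: eventually_nhds_in_open)
      ultimately have "\<forall>\<^sub>F y in nhds (snd c p). y \<in> D \<and> f (\<phi> y) \<in> W"
        using *(6) by eventually_elim (simp add: E_def)
      then obtain V where V: "open V" "snd c p \<in> V" "\<And>y. y \<in> V \<Longrightarrow> y \<in> D \<and> f (\<phi> y) \<in> W"
        unfolding eventually_nhds by blast
      have op: "openin X (\<phi> ` V)" using V chart_param_openin[OF *(1)] by blast
      show "\<exists>T. openin X T \<and> p \<in> T \<and> T \<subseteq> {p \<in> topspace X. f p \<in> W}"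
        using op V p' openin_subset[OF op] by (intro exI[of _ "\<phi> ` V"]) force
    qed
  qed (use f in auto)
next
  fix c d assume cd: "c \<in> A" "d \<in> B"
  show "smooth_on (snd c ` (fst c \<inter> f -` fst d)) (coord_rep f c d)"
  proof (rule smooth_on_if_smooth_at)
    fix x assume "x \<in> snd c ` (fst c \<inter> f -` fst d)"
    then obtain p where "p \<in> fst c" "f p \<in> fst d" "x = snd c p" by auto
    then show "smooth_at (coord_rep f c d) x" using lift[OF cd] local_lift_smooth by blast
  qed
qed

lemma smooth_atlasI:
  assumes A: "param_atlas X A"
    and lift: "\<And>c d p. c \<in> A \<Longrightarrow> d \<in> A \<Longrightarrow> p \<in> fst c \<Longrightarrow> p \<in> fst d \<Longrightarrow>
      \<exists>g. local_lift X c X d (\<lambda>p. p) (snd c p) g"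
  shows "smooth_atlas X A"
  unfolding smooth_atlas_def
proof (intro conjI ballI)
  show "(\<Union>c\<in>A. fst c) = topspace X" using A by (simp add: param_atlas_def)
next
  fix c assume "c \<in> A"
  then obtain D \<phi> where c: "chart_param X c D \<phi>" using A unfolding param_atlas_def by blast
  show "openin X (fst c)"
    using chart_param_openin[OF c] chart_param_open[OF c] by (simp add: chart_param_fst[OF c])
  show "open (snd c ` fst c)"
    by (simp add: chart_param_image[OF c] chart_param_open[OF c])
  have "homeomorphic_maps (subtopology X (fst c)) (top_of_set D) (snd c) \<phi>"
    unfolding homeomorphic_maps_def
  proof (intro conjI)
    have sub: "fst c \<subseteq> topspace X"
      using \<open>openin X (fst c)\<close> openin_subset by blast
    show "continuous_map (subtopology X (fst c)) (top_of_set D) (snd c)"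
      unfolding continuous_map_def
    proof (intro conjI allI impI)
      fix V assume "openin (top_of_set D) V"
      then have V: "open V" "V \<subseteq> D" using chart_param_open[OF c] by (auto simp: openin_open_eq)
      \<comment> \<open>The preimage of \<open>V\<close> under the chart is its image under the
        parametrization; here openness of \<open>\<phi>\<close> becomes continuity of
        \<open>snd c\<close>.\<close>
      have "{p \<in> topspace (subtopology X (fst c)). snd c p \<in> V} = \<phi> ` V"
        using V sub chart_param_mem[OF c] by (force simp: chart_param_fst[OF c] chart_param_snd[OF c])
      then show "openin (subtopology X (fst c)) {p \<in> topspace (subtopology X (fst c)). snd c p \<in> V}"
        using chart_param_openin[OF c V] V(2)
        by (auto simp: chart_param_fst[OF c] openin_subtopology intro!: exI[of _ "\<phi> ` V"])
    qed (use chart_param_mem[OF c] in auto)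
    show "continuous_map (top_of_set D) (subtopology X (fst c)) \<phi>"
      using chart_param_continuous[OF c] by (auto simp: continuous_map_in_subtopology chart_param_fst[OF c])
  qed (use chart_param_mem[OF c] chart_param_snd[OF c] in auto)
  then show "homeomorphic_map (subtopology X (fst c)) (top_of_set (snd c ` fst c)) (snd c)"
    unfolding chart_param_image[OF c] using homeomorphic_maps_map by blast
next
  fix c d assume cd: "c \<in> A" "d \<in> A"
  show "smooth_on (snd c ` (fst c \<inter> fst d)) (coord_rep (\<lambda>p. p) c d)"
  proof (rule smooth_on_if_smooth_at)
    fix x assume "x \<in> snd c ` (fst c \<inter> fst d)"
    then show "smooth_at (coord_rep (\<lambda>p. p) c d) x" using lift[OF cd] local_lift_smooth by blast
  qed
qed

lemma is_pullbackI:
  assumes "\<And>c d p. c \<in> A \<Longrightarrow> d \<in> B \<Longrightarrow> p \<in> fst c \<Longrightarrow> f p \<in> fst d \<Longrightarrow>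
     \<exists>g. local_lift X c Y d f (snd c p) g \<and> (\<forall>u v. \<alpha> c (snd c p) u v =
       \<beta> d (g (snd c p)) (frechet_derivative g (at (snd c p)) u) (frechet_derivative g (at (snd c p)) v))"
  shows "is_pullback A B f \<beta> \<alpha>"
  unfolding is_pullback_def local_pullback_def
proof (intro ballI allI)
  fix c d p u v
  assume "c \<in> A" "d \<in> B" "p \<in> fst c \<inter> f -` fst d"
  with assms obtain g where g: "local_lift X c Y d f (snd c p) g"
    "\<forall>u v. \<alpha> c (snd c p) u v =
       \<beta> d (g (snd c p)) (frechet_derivative g (at (snd c p)) u) (frechet_derivative g (at (snd c p)) v)"
    by blast
  show "\<alpha> c (snd c p) u v = \<beta> d (coord_rep f c d (snd c p)) (coord_deriv f c d (snd c p) u) (coord_deriv f c d (snd c p) v)"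
    using g(2) by (simp add: local_lift_value[OF g(1)] local_lift_deriv[OF g(1)])
qed

section \<open>Products of charts, open subsets, induced fields and topology\<close>

lemma chart_param_prod:
  assumes c: "chart_param X c D \<phi>" and d: "chart_param Y d E \<psi>"
  shows "chart_param (prod_topology X Y) (fst c \<times> fst d, map_prod (snd c) (snd d)) (D \<times> E) (map_prod \<phi> \<psi>)"
  unfolding chart_param_def
proof (intro conjI allI impI ballI)
  show "open (D \<times> E)" using c d by (simp add: chart_param_open open_Times)
  show "fst (fst c \<times> fst d, map_prod (snd c) (snd d)) = map_prod \<phi> \<psi> ` (D \<times> E)"
    by (simp add: chart_param_fst[OF c] chart_param_fst[OF d] map_prod_surj_on)
  show "snd (fst c \<times> fst d, map_prod (snd c) (snd d)) (map_prod \<phi> \<psi> x) = x" if "x \<in> D \<times> E" for x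
    using that by (auto simp: chart_param_snd[OF c] chart_param_snd[OF d])
  have "continuous_map (prod_topology (top_of_set D) (top_of_set E)) (prod_topology X Y) (\<lambda>(x, y). (\<phi> x, \<psi> y))"
    using continuous_map_prod_top[of "top_of_set D" "top_of_set E" X Y \<phi> \<psi>]
      chart_param_continuous[OF c] chart_param_continuous[OF d] by blast
  then show "continuous_map (top_of_set (D \<times> E)) (prod_topology X Y) (map_prod \<phi> \<psi>)"
    by (simp add: map_prod_def euclidean_product_topology)
  fix V assume V: "open V \<and> V \<subseteq> D \<times> E"
  show "openin (prod_topology X Y) (map_prod \<phi> \<psi> ` V)"
    unfolding openin_prod_topology_alt
  proof (intro allI impI)
    fix p q assume "(p, q) \<in> map_prod \<phi> \<psi> ` V"
    then obtain x y where xy: "(x, y) \<in> V" "p = \<phi> x" "q = \<psi> y" by auto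
    then obtain S T where ST: "open S" "open T" "(x, y) \<in> S \<times> T" "S \<times> T \<subseteq> V"
      using open_prod_elim[of V "(x, y)"] V by blast
    then have "S \<subseteq> D" "T \<subseteq> E" using V by blast+
    then show "\<exists>U W. openin X U \<and> openin Y W \<and> p \<in> U \<and> q \<in> W \<and> U \<times> W \<subseteq> map_prod \<phi> \<psi> ` V"
      using ST xy chart_param_openin[OF c ST(1)] chart_param_openin[OF d ST(2)]
      by (intro exI[of _ "\<phi> ` S"] exI[of _ "\<psi> ` T"]) auto
  qed
qed

lemma chart_param_open_chart: "open S \<Longrightarrow> chart_param (top_of_set S) (S, \<lambda>x. x) S (\<lambda>x. x)"
  by (auto simp: chart_param_def openin_open_eq)

lemma param_atlas_open: "open S \<Longrightarrow> param_atlas (top_of_set S) (open_atlas S)"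
  using chart_param_open_chart by (auto simp: param_atlas_def open_atlas_def)

lemma param_atlas_prod:
  assumes "param_atlas X A" "param_atlas Y B"
  shows "param_atlas (prod_topology X Y) (prod_atlas A B)"
  unfolding param_atlas_def
proof
  show "(\<Union>c\<in>prod_atlas A B. fst c) = topspace (prod_topology X Y)"
    using assms by (fastforce simp: param_atlas_def prod_atlas_def set_eq_iff)
  show "\<forall>c\<in>prod_atlas A B. \<exists>D \<phi>. chart_param (prod_topology X Y) c D \<phi>"
    using assms chart_param_prod unfolding param_atlas_def prod_atlas_def by fast
qed

text \<open>The flow line is lifted to a curve \<open>\<gamma>\<close> in the model. Continuity
  keeps \<open>\<gamma>\<close> in \<open>D\<close> near 0, so the chart returns it and the induced
  vector is its velocity.\<close>

lemma induced_field_eq: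
  assumes c: "chart_param X c D \<phi>" and "\<gamma> 0 \<in> D" "(\<gamma> has_vector_derivative v) (at 0)"
    and "\<forall>\<^sub>F s in nhds 0. act (ex (s *\<^sub>R \<xi>)) p = \<phi> (\<gamma> s)"
  shows "induced_field ex act \<xi> c p = v"
proof -
  have "isCont \<gamma> 0"
    using assms(3) has_vector_derivative_continuous by blast
  then have "\<forall>\<^sub>F s in nhds 0. \<gamma> s \<in> D"
    using \<open>\<gamma> 0 \<in> D\<close> chart_param_open[OF c]
    by (metis isCont_def topological_tendstoD eventually_nhds_conv_at)
  then have ev: "\<forall>\<^sub>F s in nhds 0. \<gamma> s = snd c (act (ex (s *\<^sub>R \<xi>)) p)"
    using assms(4) by eventually_elim (simp add: chart_param_snd[OF c])
  have "((\<lambda>s. snd c (act (ex (s *\<^sub>R \<xi>)) p)) has_vector_derivative v) (at 0)"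
    using assms(3) ev eventually_nhds_x_imp_x[OF ev]
    by (subst (asm) has_vector_derivative_cong_ev) (auto elim: eventually_mono)
  then show ?thesis
    unfolding induced_field_def by (rule vector_derivative_at)
qed

text \<open>The images of a countable base under a continuous open surjection form a base. The total
  space, the zero level and the quotient are all images of subsets of a Euclidean space under such
  maps.\<close>

lemma second_countable_space_open_image:
  fixes S :: "'e::euclidean_space set"
  assumes cont: "continuous_map (top_of_set S) X q" and op: "open_map (top_of_set S) X q"
    and surj: "q ` S = topspace X"
  shows "second_countable_space X"
proof -
  obtain \<B> :: "'e set set" where \<B>: "countable \<B>" "\<And>C. C \<in> \<B> \<Longrightarrow> open C"
      "\<And>T. open T \<Longrightarrow> \<exists>\<U>. \<U> \<subseteq> \<B> \<and> T = \<Union>\<U>"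
    using univ_second_countable by blast
  show ?thesis
    unfolding second_countable_space_def
  proof (intro exI conjI ballI allI impI)
    show "countable ((\<lambda>b. q ` (S \<inter> b)) ` \<B>)" using \<B>(1) by simp
    fix V assume "V \<in> (\<lambda>b. q ` (S \<inter> b)) ` \<B>"
    then show "openin X V" using op \<B>(2) unfolding open_map_def by (auto intro: openin_open_Int)
  next
    fix W p assume W: "openin X W \<and> p \<in> W"
    then have "p \<in> q ` S" using surj openin_subset[of X W] by auto
    then obtain x where x: "x \<in> S" "q x = p" by auto
    have "openin (top_of_set S) {x \<in> S. q x \<in> W}"
      using openin_continuous_map_preimage[OF cont] W by force
    then obtain T where T: "open T" "{x \<in> S. q x \<in> W} = S \<inter> T" by (auto simp: openin_open)
    then have "x \<in> T" using x W by blast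
    moreover obtain \<U> where "\<U> \<subseteq> \<B>" "T = \<Union>\<U>" using \<B>(3)[OF T(1)] by blast
    ultimately obtain b where "b \<in> \<B>" "x \<in> b" "b \<subseteq> T" by blast
    then show "\<exists>V\<in>(\<lambda>b. q ` (S \<inter> b)) ` \<B>. p \<in> V \<and> V \<subseteq> W"
      using x T by (intro bexI[of _ "q ` (S \<inter> b)"]) auto
  qed
qed

text \<open>The image under an open map is Hausdorff once the relation of having equal images is
  closed: a box around \<open>(x, y)\<close> that misses \<open>R\<close> has disjoint open images
  of its sides.\<close>

lemma Hausdorff_space_open_image:
  fixes S :: "'e::euclidean_space set"
  assumes op: "open_map (top_of_set S) X q" and surj: "q ` S = topspace X"
    and cl: "closed R" and R: "\<And>x y. x \<in> S \<Longrightarrow> y \<in> S \<Longrightarrow> q x = q y \<longleftrightarrow> (x, y) \<in> R"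
  shows "Hausdorff_space X"
  unfolding Hausdorff_space_def
proof (intro allI impI)
  fix p p' assume *: "p \<in> topspace X \<and> p' \<in> topspace X \<and> p \<noteq> p'"
  then have "p \<in> q ` S" "p' \<in> q ` S" using surj by auto
  then obtain x y where xy: "x \<in> S" "y \<in> S" "p = q x" "p' = q y" by blast
  then have "(x, y) \<in> - R" using R * by auto
  moreover have "open (- R)" using cl by auto
  ultimately obtain A B where AB: "open A" "open B" "(x, y) \<in> A \<times> B" "A \<times> B \<subseteq> - R"
    using open_prod_elim[of "- R" "(x, y)"] by blast
  have "openin X (q ` (S \<inter> A))" "openin X (q ` (S \<inter> B))"
    using op AB unfolding open_map_def by (auto intro: openin_open_Int)
  moreover have "disjnt (q ` (S \<inter> A)) (q ` (S \<inter> B))"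
    using R AB(4) by (auto simp: disjnt_iff)
  ultimately show "\<exists>U V. openin X U \<and> openin X V \<and> p \<in> U \<and> p' \<in> V \<and> disjnt U V"
    using xy AB by blast
qed

section \<open>The torus and the space \<open>U \<times> T\<^sup>n \<times> \<complex>\<^sup>N\<close>\<close>

type_synonym ('n, 'N) total_chart = "(('n, 'N) total_space, ('n, 'N) total_model) chart"

lemma has_derivative_vec_lambda [derivative_intros]:
  fixes f :: "'i::finite \<Rightarrow> 'a::euclidean_space \<Rightarrow> 'b::euclidean_space"
  assumes "\<And>i. (f i has_derivative f' i) (at x within S)"
  shows "((\<lambda>x. \<chi> i. f i x) has_derivative (\<lambda>v. \<chi> i. f' i v)) (at x within S)"
  unfolding has_derivative_componentwise_within[of "\<lambda>x. \<chi> i. f i x"]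
proof
  fix b :: "'b ^ 'i" assume "b \<in> Basis"
  then obtain i u where b: "b = axis i u" by (auto simp: Basis_vec_def)
  show "((\<lambda>x. (\<chi> i. f i x) \<bullet> b) has_derivative (\<lambda>v. (\<chi> i. f' i v) \<bullet> b)) (at x within S)"
    unfolding b inner_axis by (simp add: has_derivative_inner_left assms)
qed

section \<open>The torus as a quotient of its Lie algebra\<close>

lemma torus_of_eq_iff_ex:
  "torus_of x = torus_of y \<longleftrightarrow> (\<exists>k. integral_vector k \<and> x = y + (2 * pi) *\<^sub>R k)"
  by (auto simp: torus_of_eq_iff torus_rel_def algebra_simps)

lemma torus_of_add_lattice: "integral_vector k \<Longrightarrow> torus_of (x + (2 * pi) *\<^sub>R k) = torus_of x"
  by (auto simp: torus_of_eq_iff_ex)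

lemma open_torus_iff: "open S \<longleftrightarrow> open (torus_of -` S)" for S :: "'m::finite torus set"
  by (simp add: open_torus_def)

text \<open>The full preimage of the image of \<open>V\<close> is the union of the lattice
  translates of \<open>V\<close>.\<close>

lemma open_torus_image:
  assumes "open V"
  shows "open (torus_of ` V :: 'm::finite torus set)"
proof -
  have "torus_of -` (torus_of ` V) = (\<Union>k\<in>{k. integral_vector k}. (\<lambda>x. (2 * pi) *\<^sub>R k + x) ` V)"
  proof (intro set_eqI iffI)
    fix y assume "y \<in> torus_of -` (torus_of ` V)"
    then obtain x where "x \<in> V" "torus_of y = torus_of x" by auto
    then show "y \<in> (\<Union>k\<in>{k. integral_vector k}. (\<lambda>x. (2 * pi) *\<^sub>R k + x) ` V)"
      by (auto simp: torus_of_eq_iff_ex add.commute)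
  next
    fix y assume "y \<in> (\<Union>k\<in>{k. integral_vector k}. (\<lambda>x. (2 * pi) *\<^sub>R k + x) ` V)"
    then show "y \<in> torus_of -` (torus_of ` V)"
      by (auto simp: add.commute[of "(2 * pi) *\<^sub>R _"] torus_of_add_lattice)
  qed
  then show ?thesis
    unfolding open_torus_iff using assms by (auto intro: open_translation)
qed

lemma continuous_on_torus_of: "continuous_on S torus_of"
  by (rule continuous_on_subset[of UNIV]) (auto simp: continuous_on_open_vimage open_torus_iff)

text \<open>Two points of the ball are less than 2 apart, while a nonzero period has an entry of
  absolute value at least \<open>2 * pi\<close>.\<close>

lemma inj_on_torus_of_ball: "inj_on torus_of (ball (x :: real^'m::finite) 1)"
proof (rule inj_onI)
  fix y z :: "real^'m" assume yz: "y \<in> ball x 1" "z \<in> ball x 1" "torus_of y = torus_of z"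
  then obtain k where k: "integral_vector k" "y = z + (2 * pi) *\<^sub>R k"
    by (auto simp: torus_of_eq_iff_ex)
  have "k $ i = 0" for i
  proof (rule ccontr)
    assume "k $ i \<noteq> 0"
    then have "1 \<le> \<bar>k $ i\<bar>"
      using k(1) Ints_nonzero_abs_ge1 unfolding integral_vector_def by blast
    then have "2 < 2 * pi * \<bar>k $ i\<bar>"
      using pi_gt3 by (smt (verit) mult_le_cancel_left1 mult_left_le)
    also have "\<dots> = \<bar>(y - z) $ i\<bar>" by (simp add: k(2) abs_mult)
    also have "\<dots> \<le> dist y z" by (metis component_le_norm_cart dist_norm)
    also have "\<dots> < 2" using yz(1,2) dist_triangle_less_add[of y x 1 z 1] by (simp add: dist_commute)
    finally show False .
  qed
  then have "k = 0" by (simp add: vec_eq_iff)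
  then show "y = z" by (simp add: k(2))
qed

lemma chart_param_torus:
  fixes B :: "(real^'m::finite) set"
  assumes "open B" "inj_on torus_of B"
  shows "chart_param euclidean (torus_of ` B, inv_into B torus_of) B torus_of"
  using assms by (auto simp: chart_param_def continuous_on_torus_of open_torus_image)

lemma param_atlas_torus: "param_atlas euclidean (torus_atlas :: ('m::finite torus, real^'m) chart set)"
  unfolding param_atlas_def
proof (intro conjI ballI)
  have "\<exists>c\<in>torus_atlas. t \<in> fst c" for t :: "'m torus"
  proof -
    have "t \<in> torus_of ` ball (rep_torus t) 1" by (metis centre_in_ball imageI torus_of_rep zero_less_one)
    then show ?thesis
      unfolding torus_atlas_def
      by (intro bexI[of _ "(torus_of ` ball (rep_torus t) 1, inv_into (ball (rep_torus t) 1) torus_of)"])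
        (auto simp: inj_on_torus_of_ball)
  qed
  then show "(\<Union>c\<in>torus_atlas. fst c) = topspace (euclidean :: 'm torus topology)" by auto
  fix c :: "('m torus, real^'m) chart" assume "c \<in> torus_atlas"
  then show "\<exists>D \<phi>. chart_param euclidean c D \<phi>"
    using chart_param_torus by (fastforce simp: torus_atlas_def)
qed

lemma chart_param_torusE:
  assumes "c \<in> torus_atlas"
  obtains B where "chart_param euclidean c B torus_of"
  using assms chart_param_torus by (fastforce simp: torus_atlas_def)

text \<open>Continuity and openness are local on the source, so a globally defined map that is a
  parametrization near each point has both.\<close>

lemma openin_image_chart_params:
  assumes "open S" and ch: "\<And>x. x \<in> S \<Longrightarrow> \<exists>c D. chart_param X c D q \<and> x \<in> D \<and> D \<subseteq> S"
  shows "continuous_map (top_of_set S) X q" "open_map (top_of_set S) X q"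
proof -
  show "open_map (top_of_set S) X q"
    unfolding open_map_def
  proof (intro allI impI)
    fix V assume "openin (top_of_set S) V"
    then have V: "open V" "V \<subseteq> S" using \<open>open S\<close> by (auto simp: openin_open_eq)
    show "openin X (q ` V)"
    proof (subst openin_subopen, intro ballI)
      fix p assume "p \<in> q ` V"
      then obtain x where x: "x \<in> V" "p = q x" by auto
      then obtain c D where D: "chart_param X c D q" "x \<in> D" using ch V by blast
      then have "openin X (q ` (D \<inter> V))"
        using V by (intro chart_param_openin[OF D(1)]) (auto simp: chart_param_open open_Int)
      then show "\<exists>T. openin X T \<and> p \<in> T \<and> T \<subseteq> q ` V" using x D by blast
    qed
  qed
  have top: "q x \<in> topspace X" if xS: "x \<in> S" for x
  proof -
    obtain c D where D: "chart_param X c D q" "x \<in> D" using ch[OF xS] by blast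
    then show ?thesis using continuous_map_image_subset_topspace[OF chart_param_continuous[OF D(1)]] by auto
  qed
  show "continuous_map (top_of_set S) X q"
    unfolding continuous_map_def
  proof (intro conjI allI impI)
    fix W assume W: "openin X W"
    show "openin (top_of_set S) {x \<in> topspace (top_of_set S). q x \<in> W}"
    proof (subst openin_subopen, intro ballI)
      fix x assume x: "x \<in> {x \<in> topspace (top_of_set S). q x \<in> W}"
      then have "x \<in> S" by simp
      then obtain c D where D: "chart_param X c D q" "x \<in> D" "D \<subseteq> S" using ch[of x] by blast
      have "openin (top_of_set D) {x \<in> D. q x \<in> W}"
        using openin_continuous_map_preimage[OF chart_param_continuous[OF D(1)] W] by simp
      then have "open {x \<in> D. q x \<in> W}" using chart_param_open[OF D(1)] openin_open_eq by blast
      then show "\<exists>T. openin (top_of_set S) T \<and> x \<in> T \<and> T \<subseteq> {x \<in> topspace (top_of_set S). q x \<in> W}"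
        using D x \<open>open S\<close> by (intro exI[of _ "{x \<in> D. q x \<in> W}"]) (auto simp: openin_open_eq)
    qed
  qed (use top in auto)
qed

section \<open>The covering of the total space\<close>

definition total_proj :: "('n::finite, 'N::finite) total_model \<Rightarrow> ('n, 'N) total_space" where
  "total_proj = map_prod (\<lambda>x. x) (map_prod torus_of (\<lambda>z. z))"

lemma total_proj_eq [simp]: "total_proj (x, \<theta>, z) = (x, torus_of \<theta>, z)"
  by (simp add: total_proj_def)

text \<open>For integral \<open>k\<close> these are the deck transformations of the covering
  \<open>total_proj\<close>.\<close>

definition lattice_shift :: "real^'n \<Rightarrow> ('n::finite, 'N::finite) total_model" where
  "lattice_shift k = (0, (2 * pi) *\<^sub>R k, 0)"

lemma total_proj_eq_iff:
  "total_proj y = total_proj y' \<longleftrightarrow> (\<exists>k. integral_vector k \<and> y = y' + lattice_shift k)"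
  by (cases y; cases y') (auto simp: lattice_shift_def torus_of_eq_iff_ex)

lemma total_proj_shift [simp]: "integral_vector k \<Longrightarrow> total_proj (y + lattice_shift k) = total_proj y"
  using total_proj_eq_iff by blast

lemma total_proj_surj: "\<exists>y. total_proj y = p"
  by (cases p) (metis total_proj_eq torus_of_rep)

lemma total_proj_image: "total_proj ` (U \<times> UNIV) = U \<times> UNIV"
  using total_proj_surj
  by (auto simp: total_proj_def image_iff) (metis torus_of_rep)

lemma topspace_total: "topspace (total_topology U) = U \<times> UNIV"
  by (simp add: total_topology_def)

lemma chart_param_total:
  assumes "open U" "open B" "inj_on torus_of B"
  shows "chart_param (total_topology U)
    (U \<times> (torus_of ` B \<times> UNIV), map_prod (\<lambda>x. x) (map_prod (inv_into B torus_of) (\<lambda>z. z)))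
    (U \<times> (B \<times> UNIV)) total_proj"
  using chart_param_prod[OF chart_param_open_chart[OF \<open>open U\<close>]
      chart_param_prod[OF chart_param_torus[OF assms(2,3)] chart_param_open_chart[OF open_UNIV]]]
  by (simp add: total_topology_def total_proj_def)

lemma chart_param_totalE:
  assumes "open U" "c \<in> total_atlas U"
  obtains B where "open B" "chart_param (total_topology U) c (U \<times> (B \<times> UNIV)) total_proj"
proof -
  from assms(2) obtain B where "open B" "inj_on torus_of B"
    "c = (U \<times> (torus_of ` B \<times> UNIV), map_prod (\<lambda>x. x) (map_prod (inv_into B torus_of) (\<lambda>z. z)))"
    by (auto simp: total_atlas_def prod_atlas_def open_atlas_def torus_atlas_def)
  with chart_param_total[OF assms(1)] that show thesis by blast
qed

lemma param_atlas_total: "open U \<Longrightarrow> param_atlas (total_topology U) (total_atlas U)"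
  using param_atlas_prod[OF param_atlas_open[of U] param_atlas_prod[OF param_atlas_torus param_atlas_open[OF open_UNIV]]]
  by (simp add: total_topology_def total_atlas_def)

lemma total_proj_maps:
  fixes U :: "(real^'n::finite) set"
  assumes "open U"
  shows "continuous_map (top_of_set (U \<times> UNIV)) (total_topology U :: ('n, 'N::finite) total_space topology) total_proj"
    and "open_map (top_of_set (U \<times> UNIV)) (total_topology U :: ('n, 'N) total_space topology) total_proj"
proof -
  have ch: "\<exists>c D. chart_param (total_topology U) c D total_proj \<and> y \<in> D \<and> D \<subseteq> U \<times> UNIV"
    if "y \<in> U \<times> UNIV" for y :: "('n, 'N) total_model"
  proof -
    have "y \<in> U \<times> ball (fst (snd y)) 1 \<times> UNIV" using that by (cases y) auto
    then show ?thesis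
      using chart_param_total[OF assms open_ball inj_on_torus_of_ball[of "fst (snd y)"]] by blast
  qed
  have "open (U \<times> (UNIV :: ((real^'n) \<times> (complex^'N)) set))" using assms by (simp add: open_Times)
  from openin_image_chart_params[OF this ch]
  show "continuous_map (top_of_set (U \<times> UNIV)) (total_topology U :: ('n, 'N) total_space topology) total_proj"
    and "open_map (top_of_set (U \<times> UNIV)) (total_topology U :: ('n, 'N) total_space topology) total_proj"
    by auto
qed

lemma closed_integral_vectors: "closed {k :: real^'n::finite. integral_vector k}"
proof -
  have "{k :: real^'n. integral_vector k} = (\<Inter>i. (\<lambda>k. k $ i) -` \<int>)"
    by (auto simp: integral_vector_def)
  moreover have "closed ((\<lambda>k :: real^'n. k $ i) -` \<int>)" for i
    by (intro closed_vimage closed_Ints continuous_intros)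
  ultimately show ?thesis by auto
qed

text \<open>A map into the total space is given by a lift \<open>F\<close> to the covering. The
  chart \<open>d\<close> selects a sheet, which differs from that of \<open>F\<close> by a deck
  transformation. The same \<open>k\<close> serves near the point, so derivatives are
  unaffected.\<close>

lemma local_lift_total:
  assumes U: "open U" and c: "chart_param X c D \<phi>" and d: "d \<in> total_atlas U"
    and p: "p \<in> fst c" "f p \<in> fst d" and F: "smooth_at F (snd c p)"
    and ev: "\<forall>\<^sub>F y in nhds (snd c p). f (\<phi> y) = total_proj (F y)"
  shows "\<exists>k. local_lift X c (total_topology U) d f (snd c p) (\<lambda>y. F y + lattice_shift k)"
proof -
  obtain B where B: "chart_param (total_topology U) d (U \<times> (B \<times> UNIV)) total_proj"
    using chart_param_totalE[OF U d] by blast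
  note p1 = chart_param_mem[OF c p(1)] and p2 = chart_param_mem[OF B p(2)]
  have "total_proj (snd d (f p)) = total_proj (F (snd c p))"
    using eventually_nhds_x_imp_x[OF ev] p1 p2 by simp
  then obtain k where k: "integral_vector k" "snd d (f p) = F (snd c p) + lattice_shift k"
    using total_proj_eq_iff by blast
  have "local_lift X c (total_topology U) d f (snd c p) (\<lambda>y. F y + lattice_shift k)"
    by (rule local_liftI[OF c B])
      (use p1 p2 k F ev in \<open>auto intro: smooth_intros\<close>)
  then show ?thesis by blast
qed

section \<open>The symplectic form of the total space\<close>

lemma frechet_derivative_add_const:
  "f differentiable at x \<Longrightarrow> frechet_derivative (\<lambda>y. f y + c) (at x) = frechet_derivative f (at x)"
  by (metis frechet_derivative_at frechet_derivative_works has_derivative_add_const)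

text \<open>In each factor \<open>u * cnj v - v * cnj u\<close> is \<i> times twice the imaginary
  part of \<open>u * cnj v\<close>, and the outer \<i> makes it real. The factor 2 is the origin of
  the \<surd>2 in the coordinates of the slice.\<close>

lemma total_form_eq:
  fixes a \<alpha> b \<beta> :: "real^'n::finite" and u v :: "complex^'N::finite"
  shows "total_form c p (a, \<alpha>, u) (b, \<beta>, v) =
    a \<bullet> \<beta> - b \<bullet> \<alpha> + 2 * (\<Sum>i\<in>UNIV. Im (v $ i * cnj (u $ i)))"
  by (simp add: total_form_def inner_vec_def sum_subtractf sum_distrib_left algebra_simps sum.distrib)

lemma total_form_linear:
  "linear (\<lambda>u. total_form c p u v)" "linear (\<lambda>v. total_form c p u v)"
  by (cases u; cases v; force simp: total_form_eq linear_iff inner_simps algebra_simps sum.distrib sum_subtractf sum_distrib_left)+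

lemma bilinear_total_form: "bilinear (total_form c p)"
  unfolding bilinear_def by (intro conjI allI total_form_linear)

lemma total_form_antisym: "total_form c p u v = - total_form c p v u"
  by (cases u; cases v) (simp add: total_form_eq algebra_simps sum_subtractf)

lemma total_form_const: "total_form c p = total_form c' p'"
  by (simp add: total_form_def)

lemma total_form_nondegenerate:
  assumes "\<And>v. total_form c p u v = 0"
  shows "u = 0"
proof -
  obtain a \<alpha> w where u: "u = (a, \<alpha>, w)" by (cases u)
  have "a = 0" using assms[of "(0, a, 0)"] by (simp add: u total_form_eq)
  moreover have "\<alpha> = 0" using assms[of "(\<alpha>, 0, 0)"] by (simp add: u total_form_eq)
  moreover have "w = 0"
  proof -
    \<comment> \<open>Multiplication by \<i> is a compatible complex structure: pairing
      \<open>w\<close> with \<open>\<i> * w\<close> gives twice the sum of the squared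
      moduli.\<close>
    have "(\<Sum>i\<in>UNIV. Im ((\<chi> i. \<i> * w $ i) $ i * cnj (w $ i))) = 0"
      using assms[of "(0, 0, \<chi> i. \<i> * w $ i)"] by (simp add: u total_form_eq)
    then have "(\<Sum>i\<in>UNIV. (cmod (w $ i))\<^sup>2) = 0"
      by (simp add: complex_mult_cnj cmod_power2 mult.assoc del: sum_power2_eq_zero_iff)
    then show ?thesis by (simp add: sum_nonneg_eq_0_iff vec_eq_iff)
  qed
  ultimately show ?thesis by (simp add: u zero_prod_def)
qed

section \<open>The torus action and its lift\<close>

definition lift_act ::
    "('N::finite \<Rightarrow> real^'n::finite) \<Rightarrow> real^'n \<Rightarrow> real^'N \<Rightarrow> ('n, 'N) total_model \<Rightarrow> ('n, 'N) total_model" where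
  "lift_act \<eta> s t y =
     (fst y, fst (snd y) + s + (\<Sum>i\<in>UNIV. t $ i *\<^sub>R \<eta> i), \<chi> i. exp (\<i> * of_real (t $ i)) * snd (snd y) $ i)"

text \<open>\<open>lift_act\<close> is an action of the Lie algebra for arbitrary
  \<open>\<eta>\<close>; integrality enters here, where it is compared with the torus action, which
  is evaluated on representatives.\<close>

lemma total_act_proj:
  assumes "\<And>i. integral_vector (\<eta> i)"
  shows "total_act \<eta> (torus_of s, torus_of t) (total_proj y) = total_proj (lift_act \<eta> s t y)"
proof -
  have "(\<Sum>i\<in>UNIV. s $ i *\<^sub>R axis i 1) = s"
    using basis_expansion[of s] by (simp add: scalar_mult_eq_scaleR)
  then show ?thesis
    by (cases y) (simp add: total_act_torus_of[OF assms] lift_act_def)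
qed

lemma lift_act_add: "lift_act \<eta> (s + s') (t + t') y = lift_act \<eta> s t (lift_act \<eta> s' t' y)"
  by (simp add: lift_act_def algebra_simps exp_add sum.distrib vec_eq_iff)

lemma lift_act_0 [simp]: "lift_act \<eta> 0 0 y = y"
  by (simp add: lift_act_def)

lemma smooth_at_lift_act [smooth_intros]:
  assumes "smooth_at f x" "smooth_at g x" "smooth_at h x"
  shows "smooth_at (\<lambda>x. lift_act \<eta> (f x) (g x) (h x)) x"
  unfolding lift_act_def by (intro smooth_intros assms)

lemma continuous_on_lift_act [continuous_intros]:
  assumes "continuous_on S f" "continuous_on S g" "continuous_on S h"
  shows "continuous_on S (\<lambda>x. lift_act \<eta> (f x) (g x) (h x))"
  unfolding lift_act_def
  by (intro continuous_intros continuous_on_vec_lambda assms continuous_on_component)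

lemma torus_act_add:
  assumes "\<And>i. integral_vector (\<eta> i)"
  shows "total_act \<eta> (g + h) p = total_act \<eta> g (total_act \<eta> h p)"
proof -
  obtain y where y: "p = total_proj y" using total_proj_surj by metis
  obtain s t s' t' where gh: "g = (torus_of s, torus_of t)" "h = (torus_of s', torus_of t')"
    by (metis prod.collapse torus_of_rep)
  show ?thesis
    unfolding y gh plus_prod_def using assms
    by (simp add: total_act_proj lift_act_add flip: torus_of_add)
qed

lemma torus_of_0: "torus_of (0 :: real^'m::finite) = 0"
  by (simp add: zero_torus_def)

lemma torus_act_0:
  assumes "\<And>i. integral_vector (\<eta> i)"
  shows "total_act \<eta> 0 p = p"
proof -
  obtain y where y: "p = total_proj y" using total_proj_surj by metis
  show ?thesis
    using total_act_proj[OF assms, where s = 0 and t = 0 and y = y] by (simp add: y torus_of_0 zero_prod_def)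
qed

text \<open>The lattice is closed, hence so is the relation of having the same image under
  \<open>total_proj\<close>. Besides Hausdorff separation, this lets equality in the total space
  pass to limits.\<close>

lemma closed_total_kernel:
  "closed {(y, y' :: ('n::finite, 'N::finite) total_model). \<exists>k. integral_vector k \<and> y = y' + lattice_shift k}"
proof -
  have "{(y, y' :: ('n, 'N) total_model). \<exists>k. integral_vector k \<and> y = y' + lattice_shift k} =
    {w. fst (fst w) = fst (snd w)} \<inter> {w. snd (snd (fst w)) = snd (snd (snd w))} \<inter>
    ((\<lambda>w. (1 / (2 * pi)) *\<^sub>R (fst (snd (fst w)) - fst (snd (snd w)))) -` {k. integral_vector k})"
  proof (intro set_eqI iffI)
    fix w :: "('n, 'N) total_model \<times> ('n, 'N) total_model"
    assume "w \<in> {w. fst (fst w) = fst (snd w)} \<inter> {w. snd (snd (fst w)) = snd (snd (snd w))} \<inter>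
      ((\<lambda>w. (1 / (2 * pi)) *\<^sub>R (fst (snd (fst w)) - fst (snd (snd w)))) -` {k. integral_vector k})"
    then show "w \<in> {(y, y'). \<exists>k. integral_vector k \<and> y = y' + lattice_shift k}"
      by (cases w) (auto simp: lattice_shift_def prod_eq_iff
        intro!: exI[of _ "(1 / (2 * pi)) *\<^sub>R (fst (snd (fst w)) - fst (snd (snd w)))"])
  qed (auto simp: lattice_shift_def)
  then show ?thesis
    by (simp only:) (intro closed_Int closed_Collect_eq closed_vimage closed_integral_vectors continuous_intros)
qed

lemma smooth_manifold_total:
  fixes U :: "(real^'n::finite) set"
  assumes U: "open U"
  shows "smooth_manifold (total_topology U) (total_atlas U :: ('n, 'N::finite) total_chart set)"
  unfolding smooth_manifold_def
proof (intro conjI)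
  have surj: "total_proj ` (U \<times> UNIV) = topspace (total_topology U :: ('n, 'N) total_space topology)"
    by (simp add: total_proj_image topspace_total)
  show "Hausdorff_space (total_topology U :: ('n, 'N) total_space topology)"
    by (rule Hausdorff_space_open_image[OF total_proj_maps(2)[OF U] surj closed_total_kernel])
      (simp add: total_proj_eq_iff)
  show "second_countable_space (total_topology U :: ('n, 'N) total_space topology)"
    by (rule second_countable_space_open_image[OF total_proj_maps[OF U] surj])
  show "smooth_atlas (total_topology U) (total_atlas U :: ('n, 'N::finite) total_chart set)"
  proof (rule smooth_atlasI[OF param_atlas_total[OF U]])
    fix c d :: "('n, 'N) total_chart" and p
    assume *: "c \<in> total_atlas U" "d \<in> total_atlas U" "p \<in> fst c" "p \<in> fst d"
    obtain D where "chart_param (total_topology U) c D total_proj"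
      using chart_param_totalE[OF U *(1)] by blast
    from local_lift_total[OF U this *(2,3), of "\<lambda>p. p" "\<lambda>y. y"] *(4)
    show "\<exists>g. local_lift (total_topology U) c (total_topology U) d (\<lambda>p. p) (snd c p) g"
      by (auto intro: smooth_intros)
  qed
qed

lemma symplectic_form_total:
  fixes U :: "(real^'n::finite) set"
  assumes U: "open U"
  shows "symplectic_form (total_atlas U :: ('n, 'N::finite) total_chart set) total_form"
  unfolding symplectic_form_def smooth_2form_def
proof (intro conjI ballI allI impI)
  fix c :: "('n, 'N) total_chart" and x u v
  show "bilinear (total_form c x)" by (rule bilinear_total_form)
  show "total_form c x u v = - total_form c x v u" by (rule total_form_antisym)
  show "smooth_on (snd c ` fst c) (\<lambda>x. total_form c x u v)"
    by (rule smooth_on_if_smooth_at, subst total_form_const) (rule smooth_at_const)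
next
  show "is_pullback (total_atlas U) (total_atlas U) (\<lambda>p. p) total_form
      (total_form :: (('n, 'N) total_space, ('n, 'N) total_model) form2)"
  proof (rule is_pullbackI)
    fix c d :: "('n, 'N) total_chart" and p
    assume *: "c \<in> total_atlas U" "d \<in> total_atlas U" "p \<in> fst c" "p \<in> fst d"
    obtain D where "chart_param (total_topology U) c D total_proj"
      using chart_param_totalE[OF U *(1)] by blast
    from local_lift_total[OF U this *(2,3), of "\<lambda>p. p" "\<lambda>y. y"] *(4)
    obtain k where k: "local_lift (total_topology U) c (total_topology U) d (\<lambda>p. p) (snd c p) (\<lambda>y. y + lattice_shift k)"
      by (auto intro: smooth_intros)
    have "frechet_derivative (\<lambda>y :: ('n, 'N) total_model. y + lattice_shift k) (at (snd c p)) = (\<lambda>u. u)"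
      by (rule frechet_derivative_at[symmetric]) (auto intro!: derivative_eq_intros)
    with k show "\<exists>g. local_lift (total_topology U) c (total_topology U) d (\<lambda>p. p) (snd c p) g \<and>
      (\<forall>u v. total_form c (snd c p) u v = total_form d (g (snd c p)) (frechet_derivative g (at (snd c p)) u) (frechet_derivative g (at (snd c p)) v))"
      by (intro exI[of _ "\<lambda>y. y + lattice_shift k"])
        (simp add: total_form_const[of d _ c "snd c p"])
  qed
next
  show "closed_2form (total_atlas U) (total_form :: (('n, 'N) total_space, ('n, 'N) total_model) form2)"
    unfolding closed_2form_def
  proof (intro ballI allI)
    fix c :: "('n, 'N) total_chart" and x u v w
    have "frechet_derivative (\<lambda>y. total_form c y a b) (at x) = (\<lambda>_. 0)" for a b
      by (subst total_form_const[of c _ c x]) (simp add: frechet_derivative_const)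
    then show "frechet_derivative (\<lambda>y. total_form c y v w) (at x) u +
       frechet_derivative (\<lambda>y. total_form c y w u) (at x) v + frechet_derivative (\<lambda>y. total_form c y u v) (at x) w = 0"
      by simp
  qed
next
  fix c :: "('n, 'N) total_chart" and x u
  assume "\<forall>v. total_form c x u v = 0"
  then show "u = 0" using total_form_nondegenerate by blast
qed

lemma param_atlas_torus_prod:
  "param_atlas euclidean (prod_atlas torus_atlas torus_atlas ::
    ('n::finite torus \<times> 'N::finite torus, (real^'n) \<times> (real^'N)) chart set)"
  using param_atlas_prod[OF param_atlas_torus param_atlas_torus] by (simp add: euclidean_product_topology)

lemma chart_param_torus_prodE:
  fixes c :: "('n::finite torus \<times> 'N::finite torus, (real^'n) \<times> (real^'N)) chart"
  assumes "c \<in> prod_atlas torus_atlas torus_atlas"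
  obtains B where "chart_param euclidean c B (map_prod torus_of torus_of)"
proof -
  obtain c1 c2 where c: "c1 \<in> torus_atlas" "c2 \<in> torus_atlas" "c = (fst c1 \<times> fst c2, map_prod (snd c1) (snd c2))"
    using assms by (auto simp: prod_atlas_def)
  obtain B1 B2 where "chart_param euclidean c1 B1 torus_of" "chart_param euclidean c2 B2 torus_of"
    using chart_param_torusE c(1,2) by metis
  from chart_param_prod[OF this] that c(3) show thesis by (simp add: euclidean_product_topology)
qed

lemma chart_param_prod_atlasE:
  assumes "c \<in> prod_atlas A B"
  obtains a b where "a \<in> A" "b \<in> B" "\<And>X Y D E \<phi> \<psi>. chart_param X a D \<phi> \<Longrightarrow> chart_param Y b E \<psi> \<Longrightarrow>
    chart_param (prod_topology X Y) c (D \<times> E) (map_prod \<phi> \<psi>)"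
proof -
  obtain a b where "a \<in> A" "b \<in> B" "c = (fst a \<times> fst b, map_prod (snd a) (snd b))"
    using assms by (auto simp: prod_atlas_def)
  then show thesis using that[of a b] by (simp add: chart_param_prod)
qed

lemma smooth_action_total:
  fixes U :: "(real^'n::finite) set" and \<eta> :: "'N::finite \<Rightarrow> real^'n"
  assumes U: "open U" and \<eta>: "\<And>i. integral_vector (\<eta> i)"
  shows "smooth_action (prod_atlas torus_atlas torus_atlas) (total_topology U) (total_atlas U) (total_act \<eta>)"
  unfolding smooth_action_def
proof (intro conjI ballI allI)
  show "total_act \<eta> 0 p = p" "total_act \<eta> (g + h) p = total_act \<eta> g (total_act \<eta> h p)" for p g h
    using torus_act_0 torus_act_add \<eta> by blast+
  show "smooth_map (prod_topology euclidean (total_topology U))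
     (prod_atlas (prod_atlas torus_atlas torus_atlas) (total_atlas U)) (total_topology U)
     (total_atlas U) (\<lambda>(g, p). total_act \<eta> g p)" (is "smooth_map ?X ?A ?Y ?B ?f")
  proof (rule smooth_mapI)
    show "param_atlas ?X ?A" "param_atlas ?Y ?B"
      by (intro param_atlas_prod param_atlas_torus_prod param_atlas_total U)+
    show "?f ` topspace ?X \<subseteq> topspace ?Y"
      by (simp add: topspace_total image_subset_iff) (auto simp: total_act_def)
    fix c d p
    assume *: "c \<in> ?A" "d \<in> ?B" "p \<in> fst c" "?f p \<in> fst d"
    obtain a b where ab: "a \<in> prod_atlas torus_atlas torus_atlas" "b \<in> total_atlas U"
      "\<And>X Y D E \<phi> \<psi>. chart_param X a D \<phi> \<Longrightarrow> chart_param Y b E \<psi> \<Longrightarrow>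
         chart_param (prod_topology X Y) c (D \<times> E) (map_prod \<phi> \<psi>)"
      by (rule chart_param_prod_atlasE[OF *(1)]) blast
    obtain B where a: "chart_param euclidean a B (map_prod torus_of torus_of)"
      using chart_param_torus_prodE[OF ab(1)] by blast
    obtain D where b: "chart_param (total_topology U) b D total_proj"
      using chart_param_totalE[OF U ab(2)] by blast
    have "\<exists>k. local_lift ?X c ?Y d ?f (snd c p)
       (\<lambda>w. lift_act \<eta> (fst (fst w)) (snd (fst w)) (snd w) + lattice_shift k)"
    proof (rule local_lift_total[where f = ?f, OF U ab(3)[OF a b] *(2-4)])
      show "smooth_at (\<lambda>w. lift_act \<eta> (fst (fst w)) (snd (fst w)) (snd w)) (snd c p)"
        by (intro smooth_intros)
      show "\<forall>\<^sub>F y in nhds (snd c p). ?f (map_prod (map_prod torus_of torus_of) total_proj y) =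
          total_proj (lift_act \<eta> (fst (fst y)) (snd (fst y)) (snd y))"
        by (rule always_eventually) (auto simp: total_act_proj[OF \<eta>] simp del: total_proj_eq)
    qed
    then show "\<exists>g. local_lift ?X c ?Y d ?f (snd c p) g" by blast
  qed
qed

lemma has_derivative_vec_nth [derivative_intros]:
  "(f has_derivative f') F \<Longrightarrow> ((\<lambda>x. f x $ i) has_derivative (\<lambda>h. f' h $ i)) F"
  by (rule bounded_linear.has_derivative[OF bounded_linear_vec_nth])

text \<open>The action is affine. Its linear part drops the translations, that is, \<open>s\<close>
  and all conormal vectors become 0, so the derivative is again an instance of
  \<open>lift_act\<close>.\<close>

lemma lift_act_has_derivative:
  "(lift_act \<eta> s t has_derivative lift_act (\<lambda>_. 0) 0 t) (at y within S)"
  unfolding lift_act_def[abs_def]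
  by (auto intro!: derivative_eq_intros)

lemma Im_mult_cnj_exp: "Im (exp (\<i> * of_real t) * v * cnj (exp (\<i> * of_real t) * u)) = Im (v * cnj u)"
proof -
  have 1: "exp (\<i> * of_real t) * v * cnj (exp (\<i> * of_real t) * u) =
     (exp (\<i> * of_real t) * cnj (exp (\<i> * of_real t))) * (v * cnj u)" by (simp add: mult_ac)
  have 2: "exp (\<i> * of_real t) * cnj (exp (\<i> * of_real t)) = (1 :: complex)"
    by (simp only: complex_norm_square[symmetric]) simp
  show ?thesis unfolding 1 2 by simp
qed

lemma total_form_lift_act:
  fixes u v :: "('n::finite, 'N::finite) total_model"
  shows "total_form c p (lift_act (\<lambda>_. 0) 0 t u) (lift_act (\<lambda>_. 0) 0 t v) = total_form c p u v"
  by (cases u; cases v) (simp add: lift_act_def total_form_eq Im_mult_cnj_exp del: complex_cnj_mult times_complex.sel)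

lemma is_pullback_total_act:
  fixes U :: "(real^'n::finite) set" and \<eta> :: "'N::finite \<Rightarrow> real^'n"
  assumes U: "open U" and \<eta>: "\<And>i. integral_vector (\<eta> i)"
  shows "is_pullback (total_atlas U) (total_atlas U) (total_act \<eta> g) total_form total_form"
proof (rule is_pullbackI)
  fix c d :: "('n, 'N) total_chart" and p
  assume *: "c \<in> total_atlas U" "d \<in> total_atlas U" "p \<in> fst c" "total_act \<eta> g p \<in> fst d"
  obtain s t where g: "g = (torus_of s, torus_of t)" by (metis prod.collapse torus_of_rep)
  obtain D where "chart_param (total_topology U) c D total_proj"
    using chart_param_totalE[OF U *(1)] by blast
  from local_lift_total[where f = "total_act \<eta> g", OF U this *(2-4), of "lift_act \<eta> s t"]
  obtain k where k: "local_lift (total_topology U) c (total_topology U) d (total_act \<eta> g) (snd c p)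
      (\<lambda>y. lift_act \<eta> s t y + lattice_shift k)"
    using smooth_at_lift_act[OF smooth_at_const smooth_at_const smooth_at_ident, of \<eta> s t "snd c p"]
    by (auto simp: g total_act_proj[OF \<eta>] simp del: total_proj_eq)
  have "frechet_derivative (\<lambda>y. lift_act \<eta> s t y + lattice_shift k) (at (snd c p)) = lift_act (\<lambda>_. 0) 0 t"
    by (rule frechet_derivative_at[symmetric]) (intro has_derivative_add_const lift_act_has_derivative)
  with k show "\<exists>g'. local_lift (total_topology U) c (total_topology U) d (total_act \<eta> g) (snd c p) g' \<and>
    (\<forall>u v. total_form c (snd c p) u v = total_form d (g' (snd c p)) (frechet_derivative g' (at (snd c p)) u) (frechet_derivative g' (at (snd c p)) v))"
    by (intro exI[of _ "\<lambda>y. lift_act \<eta> s t y + lattice_shift k"])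
      (simp add: total_form_lift_act total_form_const[of d _ c "snd c p"])
qed

section \<open>The moment map of the total space\<close>

definition lift_moment ::
    "('N::finite \<Rightarrow> real^'n::finite) \<Rightarrow> ('N \<Rightarrow> real) \<Rightarrow> ('n, 'N) total_model \<Rightarrow> (real^'n) \<times> (real^'N)" where
  "lift_moment \<eta> \<kappa> y =
     (fst y, \<chi> i. fst y \<bullet> \<eta> i + snd (snd y) $ i \<bullet> snd (snd y) $ i - \<kappa> i)"

lemma total_moment_proj: "total_moment \<eta> \<kappa> (total_proj y) = lift_moment \<eta> \<kappa> y"
  by (cases y) (simp add: total_moment_def lift_moment_def power2_norm_eq_inner)

lemma lift_moment_act: "lift_moment \<eta> \<kappa> (lift_act \<eta> s t y) = lift_moment \<eta> \<kappa> y"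
  by (simp add: lift_moment_def lift_act_def norm_mult flip: power2_norm_eq_inner)

lemma smooth_at_lift_moment [smooth_intros]: "smooth_at (lift_moment \<eta> \<kappa>) x"
  unfolding lift_moment_def[abs_def] by (intro smooth_intros)

lemma lift_act_has_vector_derivative:
  "((\<lambda>r. lift_act \<eta> (r *\<^sub>R s) (r *\<^sub>R t) y) has_vector_derivative
     (0, s + (\<Sum>i\<in>UNIV. t $ i *\<^sub>R \<eta> i), \<chi> i. \<i> * of_real (t $ i) * snd (snd y) $ i)) (at 0)"
proof -
  have "((\<lambda>r. fst (snd y) + r *\<^sub>R s + (\<Sum>i\<in>UNIV. (r * t $ i) *\<^sub>R \<eta> i)) has_vector_derivative
      s + (\<Sum>i\<in>UNIV. t $ i *\<^sub>R \<eta> i)) (at 0)"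
    unfolding has_vector_derivative_def
    by (auto intro!: derivative_eq_intros simp: scaleR_right_distrib scaleR_sum_right)
  moreover have "((\<lambda>r. exp (\<i> * of_real (r * t $ i)) * snd (snd y) $ i) has_vector_derivative
      \<i> * of_real (t $ i) * snd (snd y) $ i) (at 0)" for i
  proof -
    \<comment> \<open>The real time is replaced by a complex variable, so that the rules for complex
      derivatives apply.\<close>
    have "((\<lambda>z. exp (\<i> * (z * of_real (t $ i))) * snd (snd y) $ i) has_field_derivative
        \<i> * of_real (t $ i) * snd (snd y) $ i) (at (of_real 0))"
      by (auto intro!: derivative_eq_intros)
    from has_vector_derivative_real_field[OF this] show ?thesis by simp
  qed
  then have "((\<lambda>r. \<chi> i. exp (\<i> * of_real (r * t $ i)) * snd (snd y) $ i) has_vector_derivative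
      (\<chi> i. \<i> * of_real (t $ i) * snd (snd y) $ i)) (at 0)"
    unfolding has_vector_derivative_def
    using has_derivative_vec_lambda[of "\<lambda>i r. exp (\<i> * of_real (r * t $ i)) * snd (snd y) $ i"
      "\<lambda>i r. r *\<^sub>R (\<i> * of_real (t $ i) * snd (snd y) $ i)"]
    by (simp add: scaleR_vec_def)
  ultimately show ?thesis
    unfolding lift_act_def vector_scaleR_component real_scaleR_def
    by (intro has_vector_derivative_Pair has_vector_derivative_const)
qed

lemma moment_map_total:
  fixes U :: "(real^'n::finite) set" and \<eta> :: "'N::finite \<Rightarrow> real^'n"
  assumes U: "open U" and \<eta>: "\<And>i. integral_vector (\<eta> i)"
  shows "moment_map (map_prod torus_of torus_of) (total_topology U) (total_atlas U) total_form (total_act \<eta>) (total_moment \<eta> \<kappa>)"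
  unfolding moment_map_def
proof (intro conjI allI ballI)
  show "smooth_map (total_topology U) (total_atlas U) euclidean (open_atlas UNIV) (total_moment \<eta> \<kappa>)"
  proof (rule smooth_mapI[OF param_atlas_total[OF U]])
    show "param_atlas euclidean (open_atlas UNIV)" using param_atlas_open[OF open_UNIV] by simp
    fix c :: "('n, 'N) total_chart"
      and d :: "((real^'n) \<times> (real^'N), (real^'n) \<times> (real^'N)) chart" and p
    assume *: "c \<in> total_atlas U" "d \<in> open_atlas UNIV" "p \<in> fst c" "total_moment \<eta> \<kappa> p \<in> fst d"
    obtain D where c: "chart_param (total_topology U) c D total_proj"
      using chart_param_totalE[OF U *(1)] by blast
    have "chart_param euclidean d UNIV (\<lambda>x. x)"
      using *(2) chart_param_open_chart[OF open_UNIV] by (simp add: open_atlas_def)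
    then have "local_lift (total_topology U) c euclidean d (total_moment \<eta> \<kappa>) (snd c p) (lift_moment \<eta> \<kappa>)"
      by (rule local_liftI[OF c]) (use chart_param_mem[OF c *(3)] in \<open>auto intro: smooth_intros simp: total_moment_proj simp del: total_proj_eq\<close>)
    then show "\<exists>g. local_lift (total_topology U) c euclidean d (total_moment \<eta> \<kappa>) (snd c p) g" by blast
  qed simp
next
  fix g :: "'n torus \<times> 'N torus" and p :: "('n, 'N) total_space"
  obtain y s t where "p = total_proj y" "g = (torus_of s, torus_of t)"
    by (metis prod.collapse torus_of_rep total_proj_surj)
  then show "total_moment \<eta> \<kappa> (total_act \<eta> g p) = total_moment \<eta> \<kappa> p"
    by (simp add: total_act_proj[OF \<eta>] total_moment_proj lift_moment_act del: total_proj_eq)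
next
  fix \<xi> :: "(real^'n) \<times> (real^'N)" and c :: "('n, 'N) total_chart" and p v
  assume *: "c \<in> total_atlas U" "p \<in> fst c"
  obtain D where c: "chart_param (total_topology U) c D total_proj"
    using chart_param_totalE[OF U *(1)] by blast
  note m = chart_param_mem[OF c *(2)]
  define y where "y = snd c p"
  have y: "y \<in> D" "total_proj y = p" using m by (auto simp: y_def)
  obtain s t where \<xi>: "\<xi> = (s, t)" by (cases \<xi>)
  have ind: "induced_field (map_prod torus_of torus_of) (total_act \<eta>) \<xi> c p =
    (0, s + (\<Sum>i\<in>UNIV. t $ i *\<^sub>R \<eta> i), \<chi> i. \<i> * of_real (t $ i) * snd (snd y) $ i)"
  proof (rule induced_field_eq[OF c _ lift_act_has_vector_derivative])
    show "lift_act \<eta> (0 *\<^sub>R s) (0 *\<^sub>R t) y \<in> D" using y by simp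
    show "\<forall>\<^sub>F r in nhds 0. total_act \<eta> (map_prod torus_of torus_of (r *\<^sub>R \<xi>)) p =
        total_proj (lift_act \<eta> (r *\<^sub>R s) (r *\<^sub>R t) y)"
      by (rule always_eventually) (simp add: \<xi> total_act_proj[OF \<eta>] del: total_proj_eq flip: y(2))
  qed
  have "frechet_derivative (\<lambda>x. total_moment \<eta> \<kappa> (inv_into (fst c) (snd c) x) \<bullet> \<xi>) (at y) =
     frechet_derivative (\<lambda>x. lift_moment \<eta> \<kappa> x \<bullet> \<xi>) (at y)"
    by (rule frechet_derivative_cong_open[OF chart_param_open[OF c] y(1)])
      (simp add: chart_param_inv[OF c] total_moment_proj)
  also have "\<dots> = (\<lambda>v. fst v \<bullet> s + (\<Sum>i\<in>UNIV. (fst v \<bullet> \<eta> i + 2 * (snd (snd y) $ i \<bullet> snd (snd v) $ i)) * t $ i))"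
    by (rule frechet_derivative_at[symmetric])
      (auto simp: lift_moment_def \<xi> inner_vec_def[of t] inner_commute mult.commute[of "t $ _"]
        intro!: derivative_eq_intros bounded_linear.has_derivative[OF bounded_linear_vec_nth])
  finally have fd: "frechet_derivative (\<lambda>x. total_moment \<eta> \<kappa> (inv_into (fst c) (snd c) x) \<bullet> \<xi>) (at y) v =
    fst v \<bullet> s + (\<Sum>i\<in>UNIV. (fst v \<bullet> \<eta> i + 2 * (snd (snd y) $ i \<bullet> snd (snd v) $ i)) * t $ i)" by simp
  obtain a \<alpha> w where v: "v = (a, \<alpha>, w)" by (cases v)
  \<comment> \<open>The contribution of one disc: doubled by the factor in the form, it is minus the
    derivative of \<open>t $ i * (norm z)\<^sup>2\<close>, in agreement with the sign in the moment
    map equation.\<close>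
  have "Im (w $ i * cnj (\<i> * of_real (t $ i) * snd (snd y) $ i)) = - (snd (snd y) $ i \<bullet> w $ i) * t $ i" for i
    by (simp add: inner_complex_def algebra_simps)
  then show "total_form c (snd c p) (induced_field (map_prod torus_of torus_of) (total_act \<eta>) \<xi> c p) v =
      - frechet_derivative (\<lambda>x. total_moment \<eta> \<kappa> (inv_into (fst c) (snd c) x) \<bullet> \<xi>) (at (snd c p)) v"
    unfolding y_def[symmetric] ind fd
    by (simp add: v total_form_eq inner_sum_right inner_add_right sum.distrib sum_distrib_left
        sum_negf distrib_left distrib_right mult.assoc mult.commute mult.left_commute del: times_complex.sel complex_cnj_mult)
qed

lemma hamiltonian_space_total:
  fixes U :: "(real^'n::finite) set" and \<eta> :: "'N::finite \<Rightarrow> real^'n"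
  assumes "open U" "\<And>i. integral_vector (\<eta> i)"
  shows "hamiltonian_space (prod_atlas torus_atlas torus_atlas) (map_prod torus_of torus_of)
     (total_topology U) (total_atlas U) total_form (total_act \<eta>) (total_moment \<eta> \<kappa>)"
  unfolding hamiltonian_space_def
  by (intro conjI allI smooth_manifold_total symplectic_form_total smooth_action_total
      is_pullback_total_act moment_map_total assms)

section \<open>Lattices\<close>

lemma integral_vector_small_zero:
  assumes "integral_vector (v :: real^'n::finite)" "norm v < 1"
  shows "v = 0"
proof -
  have "v $ i = 0" for i
  proof (rule Ints_nonzero_abs_less1)
    show "v $ i \<in> \<int>" using assms(1) by (simp add: integral_vector_def)
    show "\<bar>v $ i\<bar> < 1" using component_le_norm_cart[of v i] assms(2) by linarith
  qed
  then show ?thesis by (simp add: vec_eq_iff)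
qed

lemma integral_vector_sum:
  "(\<And>i. i \<in> A \<Longrightarrow> integral_vector (f i)) \<Longrightarrow> integral_vector (\<Sum>i\<in>A. f i)"
  by (induction A rule: infinite_finite_induct) (auto intro: integral_vector_add integral_vector_0)

lemma integral_vector_scaleR: "c \<in> \<int> \<Longrightarrow> integral_vector v \<Longrightarrow> integral_vector (c *\<^sub>R v)"
  by (simp add: integral_vector_def)

text \<open>By simultaneous Diophantine approximation, a real relation between integral vectors yields
  an integral vector of norm less than one.\<close>

lemma integral_independent_imp_real:
  fixes \<eta> :: "'N::finite \<Rightarrow> real^'n::finite"
  assumes int: "\<And>i. i \<in> I \<Longrightarrow> integral_vector (\<eta> i)"
    and ind: "\<And>k :: 'N \<Rightarrow> int. (\<Sum>i\<in>I. of_int (k i) *\<^sub>R \<eta> i) = 0 \<Longrightarrow> \<forall>i\<in>I. k i = 0"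
    and rel: "(\<Sum>i\<in>I. a i *\<^sub>R \<eta> i) = 0" and j: "j \<in> I"
  shows "a j = 0"
proof (rule ccontr)
  assume "a j \<noteq> 0"
  \<comment> \<open>The summand 1 makes \<open>C\<close> positive. An approximation error below
    \<open>1 / C\<close> yields an integral vector of norm less than 1, and an error below
    \<open>\<bar>a j\<bar>\<close> is later incompatible with \<open>k j = 0\<close>.\<close>
  define C where "C = (\<Sum>i\<in>I. norm (\<eta> i)) + 1"
  have "C > 0" unfolding C_def by (smt (verit) norm_ge_zero sum_nonneg)
  define d where "d = min (1 / C) \<bar>a j\<bar>"
  have "d > 0" using \<open>C > 0\<close> \<open>a j \<noteq> 0\<close> by (simp add: d_def)
  then obtain M :: nat where M: "M > 0" "1 / real M < d"
    by (metis nat_approx_posE of_nat_Suc zero_less_Suc)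
  obtain h where h: "bij_betw h {..<card I} I"
    using ex_bij_betw_nat_finite[of I] by (metis finite atLeast0LessThan)
  obtain q p where q: "0 < q"
    and qp: "\<And>m. m < card I \<Longrightarrow> \<bar>of_int q * a (h m) - of_int (p m)\<bar> < 1 / M"
    using Dirichlet_approx_simult[OF M(1), of "card I" "\<lambda>m. a (h m)"] by metis
  define k where "k i = p (inv_into {..<card I} h i)" for i
  have k: "\<bar>of_int q * a i - of_int (k i)\<bar> < 1 / M" if "i \<in> I" for i
    using qp[of "inv_into {..<card I} h i"] that h unfolding k_def
    by (metis bij_betw_imp_surj_on bij_betw_inv_into_right inv_into_into lessThan_iff)
  define v where "v = (\<Sum>i\<in>I. of_int (k i) *\<^sub>R \<eta> i)"
  have "v = (\<Sum>i\<in>I. (of_int (k i) - of_int q * a i) *\<^sub>R \<eta> i) + of_int q *\<^sub>R (\<Sum>i\<in>I. a i *\<^sub>R \<eta> i)"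
    by (simp add: v_def scaleR_sum_right scaleR_left_diff_distrib sum_subtractf)
  then have "norm v \<le> (\<Sum>i\<in>I. norm ((of_int (k i) - of_int q * a i) *\<^sub>R \<eta> i))"
    by (simp only: rel scaleR_zero_right add_0_right norm_sum)
  also have "\<dots> \<le> (\<Sum>i\<in>I. 1 / M * norm (\<eta> i))"
  proof (rule sum_mono)
    fix i assume "i \<in> I"
    then have "\<bar>of_int (k i) - of_int q * a i\<bar> \<le> 1 / M" using k[of i] by linarith
    then show "norm ((of_int (k i) - of_int q * a i) *\<^sub>R \<eta> i) \<le> 1 / M * norm (\<eta> i)"
      unfolding norm_scaleR by (rule mult_right_mono) simp
  qed
  also have "\<dots> = 1 / M * (C - 1)" by (simp add: C_def sum_distrib_left)
  also have "\<dots> \<le> 1 / M * C" by (intro mult_left_mono) auto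
  also have "\<dots> < 1 / C * C"
    using M(2) \<open>C > 0\<close> by (intro mult_strict_right_mono) (auto simp: d_def)
  also have "\<dots> = 1" using \<open>C > 0\<close> by simp
  finally have "norm v < 1" .
  moreover have "integral_vector v"
    unfolding v_def by (intro integral_vector_sum integral_vector_scaleR int) auto
  ultimately have "v = 0" by (rule integral_vector_small_zero[rotated])
  then have "k j = 0" using ind[of k] j by (simp add: v_def)
  then have "of_int q * \<bar>a j\<bar> < d"
    using k[OF j] M(2) q by (simp add: abs_mult)
  also have "d \<le> 1 * \<bar>a j\<bar>" by (simp add: d_def)
  finally have "(of_int q :: real) < 1" by (rule mult_right_less_imp_less) simp
  then show False using q by simp
qed

text \<open>\<open>H\<close> is a group containing every line \<open>r *\<^sub>R \<eta> i\<close>,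
  hence every real combination of these vectors. An integral combination thus lies in the integral
  lattice and is also an integer combination; real independence identifies the coefficients.\<close>

lemma lattice_saturated:
  fixes \<eta> :: "'N::finite \<Rightarrow> real^'n::finite"
  assumes H: "subtorus H" "lattice_basis (integral_lattice H) I \<eta>"
    and int: "integral_vector (\<Sum>i\<in>I. a i *\<^sub>R \<eta> i)" and j: "j \<in> I"
  shows "a j \<in> \<int>"
proof -
  have L: "integral_lattice H = range (\<lambda>k :: 'N \<Rightarrow> int. \<Sum>i\<in>I. of_int (k i) *\<^sub>R \<eta> i)"
    and ind: "\<And>k :: 'N \<Rightarrow> int. (\<Sum>i\<in>I. of_int (k i) *\<^sub>R \<eta> i) = 0 \<Longrightarrow> \<forall>i\<in>I. k i = 0"
    using H(2) unfolding lattice_basis_def by auto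
  have mem: "\<eta> i \<in> integral_lattice H" if "i \<in> I" for i
    unfolding L
  proof (rule range_eqI[of _ _ "\<lambda>j. if j = i then 1 else 0"])
    show "\<eta> i = (\<Sum>j\<in>I. of_int (if j = i then 1 else 0) *\<^sub>R \<eta> j)"
      using that by (simp add: if_distrib[of real_of_int] if_distrib[of "\<lambda>x. x *\<^sub>R _"] cong: if_cong)
  qed
  then have \<eta>: "integral_vector (\<eta> i)" "torus_of (r *\<^sub>R \<eta> i) \<in> H" if "i \<in> I" for i r
    using that by (auto simp: integral_lattice_def)
  have H0: "0 \<in> H" and Hadd: "\<And>x y. x \<in> H \<Longrightarrow> y \<in> H \<Longrightarrow> x + y \<in> H"
    using H(1) by (auto simp: subtorus_def)
  have "torus_of (\<Sum>i\<in>J. f i *\<^sub>R \<eta> i) \<in> H" if "J \<subseteq> I" for J f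
    using finite[of J] that
    by (induction J rule: finite_induct) (auto simp: torus_of_0 torus_of_add H0 intro!: Hadd \<eta>)
  from this[of I "\<lambda>i. _ * a i"] have "torus_of (r *\<^sub>R (\<Sum>i\<in>I. a i *\<^sub>R \<eta> i)) \<in> H" for r
    by (simp add: scaleR_sum_right)
  then have "(\<Sum>i\<in>I. a i *\<^sub>R \<eta> i) \<in> integral_lattice H"
    using int by (simp add: integral_lattice_def)
  then obtain k :: "'N \<Rightarrow> int" where "(\<Sum>i\<in>I. a i *\<^sub>R \<eta> i) = (\<Sum>i\<in>I. of_int (k i) *\<^sub>R \<eta> i)"
    unfolding L by auto
  then have "(\<Sum>i\<in>I. (a i - of_int (k i)) *\<^sub>R \<eta> i) = 0"
    by (simp add: scaleR_left_diff_distrib sum_subtractf)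
  from integral_independent_imp_real[OF \<eta>(1) ind this j] show ?thesis by simp
qed

text \<open>With the basis as the columns of \<open>A\<close>, the dual vectors are the rows of its
  inverse \<open>B\<close>. Duality is \<open>B ** A = mat 1\<close>, and both expansions come from
  \<open>A ** B = mat 1\<close>.\<close>

lemma dual_basis_extension:
  fixes \<eta> :: "'N::finite \<Rightarrow> real^'n::finite"
  assumes ind: "\<And>a j. (\<Sum>i\<in>I. a i *\<^sub>R \<eta> i) = 0 \<Longrightarrow> j \<in> I \<Longrightarrow> a j = 0"
  obtains \<sigma> b b' where "inj_on \<sigma> I" "\<And>i. i \<in> I \<Longrightarrow> b (\<sigma> i) = \<eta> i"
    "\<And>k l. b' k \<bullet> b l = (if k = l then 1 else (0::real))"
    "\<And>x. (\<Sum>k\<in>UNIV. (x \<bullet> b k) *\<^sub>R b' k) = x" "\<And>x. (\<Sum>k\<in>(UNIV :: 'n set). (b' k \<bullet> x) *\<^sub>R b k) = (x :: real^'n)"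
proof -
  have inj: "inj_on \<eta> I"
  proof (rule inj_onI, rule ccontr)
    fix i j assume ij: "i \<in> I" "j \<in> I" "\<eta> i = \<eta> j" "i \<noteq> j"
    \<comment> \<open>The hypothesis concerns a family, so a repeated vector is excluded by the
      relation with coefficients 1 and -1.\<close>
    define a :: "'N \<Rightarrow> real" where "a m = (if m = i then 1 else if m = j then -1 else 0)" for m
    have "(\<Sum>m\<in>I. a m *\<^sub>R \<eta> m) = (\<Sum>m\<in>{i, j}. a m *\<^sub>R \<eta> m)"
      by (rule sum.mono_neutral_right) (use ij in \<open>auto simp: a_def\<close>)
    also have "\<dots> = 0" using ij by (simp add: a_def)
    finally show False using ind[of a i] ij by (simp add: a_def)
  qed
  have "independent (\<eta> ` I)"
  proof
    assume "dependent (\<eta> ` I)"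
    then obtain u where u: "\<exists>v\<in>\<eta> ` I. u v \<noteq> 0" "(\<Sum>v\<in>\<eta> ` I. u v *\<^sub>R v) = 0"
      using dependent_finite[of "\<eta> ` I"] by auto
    then have "(\<Sum>i\<in>I. u (\<eta> i) *\<^sub>R \<eta> i) = 0" by (simp add: sum.reindex[OF inj])
    then show False using ind[of "\<lambda>i. u (\<eta> i)"] u(1) by auto
  qed
  then obtain Bs where Bs: "\<eta> ` I \<subseteq> Bs" "independent Bs" "UNIV \<subseteq> span Bs"
    using maximal_independent_subset_extend[of "\<eta> ` I" UNIV] by auto
  then have "card Bs = CARD('n)" "finite Bs"
    using basis_card_eq_dim[of Bs UNIV] independent_imp_finite by auto
  then obtain b where b: "bij_betw b (UNIV :: 'n set) Bs"
    using finite_same_card_bij[of "UNIV :: 'n set" Bs] by auto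
  define A :: "real^'n^'n" where "A = (\<chi> i l. b l $ i)"
  have Av: "A *v w = (\<Sum>l\<in>UNIV. w $ l *\<^sub>R b l)" for w
    by (simp add: vec_eq_iff A_def matrix_vector_mult_def mult.commute)
  have "surj ((*v) A)"
  proof -
    have "\<exists>w. x = A *v w" for x
    proof -
      have "x \<in> span Bs" using Bs by auto
      then obtain u where "x = (\<Sum>v\<in>Bs. u v *\<^sub>R v)"
        unfolding span_finite[OF \<open>finite Bs\<close>] by auto
      also have "\<dots> = (\<Sum>l\<in>UNIV. u (b l) *\<^sub>R b l)"
        by (rule sum.reindex_bij_betw[OF b, symmetric])
      also have "\<dots> = A *v (\<chi> l. u (b l))" by (simp add: Av)
      finally show ?thesis by blast
    qed
    then show ?thesis by (auto simp: surj_def)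
  qed
  then obtain B where AB: "A ** B = mat 1" using matrix_right_invertible_surjective[of A] by auto
  then have BA: "B ** A = mat 1" using matrix_left_right_inverse by blast
  define \<sigma> where "\<sigma> i = inv_into UNIV b (\<eta> i)" for i
  have "b (\<sigma> i) = \<eta> i" if "i \<in> I" for i
    using that Bs(1) b unfolding \<sigma>_def by (metis bij_betw_inv_into_right image_subset_iff)
  moreover from this have "inj_on \<sigma> I" using inj by (metis inj_on_def)
  moreover have "B $ k \<bullet> b l = (if k = l then 1 else 0)" for k l
    using arg_cong[OF BA, of "\<lambda>M. M $ k $ l"]
    by (simp add: matrix_matrix_mult_def A_def inner_vec_def mat_def)
  moreover have "(\<Sum>l\<in>UNIV. (B $ l \<bullet> x) *\<^sub>R b l) = x" for x
  proof -
    have "(\<Sum>l\<in>UNIV. (B $ l \<bullet> x) *\<^sub>R b l) = A *v (B *v x)"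
      by (simp add: Av matrix_vector_mul_component)
    then show ?thesis by (simp add: matrix_vector_mul_assoc AB)
  qed
  moreover have "(\<Sum>l\<in>UNIV. (x \<bullet> b l) *\<^sub>R B $ l) = x" for x
  proof -
    have "(\<Sum>l\<in>UNIV. (x \<bullet> b l) *\<^sub>R B $ l) = x v* (A ** B)"
    proof -
      have "(x v* A) v* B = (\<Sum>l\<in>UNIV. (x \<bullet> b l) *\<^sub>R B $ l)"
        by (simp add: vec_eq_iff vector_matrix_mult_def A_def inner_vec_def mult.commute)
      then show ?thesis by (simp add: vector_matrix_mul_assoc)
    qed
    then show ?thesis by (simp add: AB)
  qed
  ultimately show thesis using that[of \<sigma> b "\<lambda>l. B $ l"] by blast
qed

section \<open>Coordinates on the zero level\<close>

text \<open>A frame chooses a set \<open>I\<close> of facets, a basis \<open>b\<^sub>k\<close> of \<open>\<real>\<^sup>n\<close> in which the conormal vector of the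
  facet \<open>i \<in> I\<close> has the index \<open>pos i\<close>, and the dual basis. A point \<open>(a, \<alpha>, t)\<close> of the model
  consists of coordinates \<open>(a, \<alpha>)\<close> on the slice and of angles \<open>t\<close> along the orbit; for \<open>k = pos i\<close>
  with \<open>i \<in> I\<close> the pair \<open>(a\<^sub>k, \<alpha>\<^sub>k)\<close> encodes \<open>z\<^sub>i\<close>.\<close>

datatype ('n, 'N) frame =
  Frame (facets: "'N set") (pos: "'N \<Rightarrow> 'n") (basis_vec: "'n \<Rightarrow> real^'n") (dual_vec: "'n \<Rightarrow> real^'n")

type_synonym ('n, 'N) level_model = "(real^'n) \<times> (real^'n) \<times> (real^'N)"

text \<open>The standard symplectic form; it will represent the reduced form in every chart of the
  quotient.\<close>

definition red_form :: "(real^'n) \<times> (real^'n) \<Rightarrow> (real^'n) \<times> (real^'n) \<Rightarrow> real" where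
  "red_form u v = fst u \<bullet> snd v - fst v \<bullet> snd u"

definition level_proj :: "('n, 'N) level_model \<Rightarrow> (real^'n) \<times> (real^'n)" where
  "level_proj e = (fst e, fst (snd e))"

text \<open>\<open>saturated\<close> extracts the arithmetic of unimodularity. It yields both the
  independence of the conormal vectors at a point and the freeness of the action.\<close>

locale toric_data =
  fixes U :: "(real^'n::finite) set" and \<eta> :: "'N::finite \<Rightarrow> real^'n" and \<kappa> :: "'N \<Rightarrow> real"
  assumes open_U: "open U" and integral: "\<And>i. integral_vector (\<eta> i)"
    and saturated: "\<And>x I a j. x \<in> U \<Longrightarrow> x \<in> polyhedron_face \<eta> \<kappa> I \<Longrightarrow>
      integral_vector (\<Sum>i\<in>I. a i *\<^sub>R \<eta> i) \<Longrightarrow> j \<in> I \<Longrightarrow> a j \<in> \<int>"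
begin

definition lifted_level :: "('n, 'N) total_model set" where
  "lifted_level = {y. fst y \<in> U \<and> (\<forall>i. fst y \<bullet> \<eta> i + snd (snd y) $ i \<bullet> snd (snd y) $ i = \<kappa> i)}"

definition adapted :: "('n, 'N) frame \<Rightarrow> bool" where
  "adapted q \<longleftrightarrow>
     (\<forall>a. \<forall>j\<in>facets q. integral_vector (\<Sum>i\<in>facets q. a i *\<^sub>R \<eta> i) \<longrightarrow> a j \<in> \<int>) \<and>
     inj_on (pos q) (facets q) \<and> (\<forall>i\<in>facets q. basis_vec q (pos q i) = \<eta> i) \<and>
     (\<forall>k l. dual_vec q k \<bullet> basis_vec q l = (if k = l then 1 else 0)) \<and>
     (\<forall>x. (\<Sum>k\<in>UNIV. (x \<bullet> basis_vec q k) *\<^sub>R dual_vec q k) = x) \<and>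
     (\<forall>x. (\<Sum>k\<in>UNIV. (dual_vec q k \<bullet> x) *\<^sub>R basis_vec q k) = x)"

lemma adaptedD:
  assumes "adapted q"
  shows adapted_saturated: "integral_vector (\<Sum>i\<in>facets q. a i *\<^sub>R \<eta> i) \<Longrightarrow> j \<in> facets q \<Longrightarrow> a j \<in> \<int>"
    and adapted_inj: "inj_on (pos q) (facets q)"
    and adapted_vec: "i \<in> facets q \<Longrightarrow> basis_vec q (pos q i) = \<eta> i"
    and adapted_dual: "dual_vec q k \<bullet> basis_vec q l = (if k = l then 1 else 0)"
    and adapted_expand: "(\<Sum>k\<in>UNIV. (x \<bullet> basis_vec q k) *\<^sub>R dual_vec q k) = x"
    and adapted_coexpand: "(\<Sum>k\<in>UNIV. (dual_vec q k \<bullet> x) *\<^sub>R basis_vec q k) = x"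
  using assms unfolding adapted_def by blast+

definition facet_at :: "('n, 'N) frame \<Rightarrow> 'n \<Rightarrow> 'N" where
  "facet_at q = inv_into (facets q) (pos q)"

lemma facet_at_pos: "adapted q \<Longrightarrow> i \<in> facets q \<Longrightarrow> facet_at q (pos q i) = i"
  unfolding facet_at_def by (simp add: adapted_inj)

lemma facet_at_mem: "k \<in> pos q ` facets q \<Longrightarrow> facet_at q k \<in> facets q \<and> pos q (facet_at q k) = k"
  unfolding facet_at_def by (simp add: inv_into_into f_inv_into_f)

text \<open>For \<open>k = pos q i\<close> the level equation gives \<open>\<langle>x,
  \<eta>\<^sub>i\<rangle> = \<kappa>\<^sub>i - |z\<^sub>i|\<^sup>2\<close>, and the squared modulus
  is half of \<open>a\<^sup>2 + \<alpha>\<^sup>2\<close>.\<close>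

definition base_coord :: "('n, 'N) frame \<Rightarrow> ('n, 'N) level_model \<Rightarrow> 'n \<Rightarrow> real" where
  "base_coord q e k =
     (if k \<in> pos q ` facets q then \<kappa> (facet_at q k) - ((fst e $ k)\<^sup>2 + (fst (snd e) $ k)\<^sup>2) / 2 else fst e $ k)"

definition base_point :: "('n, 'N) frame \<Rightarrow> ('n, 'N) level_model \<Rightarrow> real^'n" where
  "base_point q e = (\<Sum>k\<in>UNIV. base_coord q e k *\<^sub>R dual_vec q k)"

text \<open>The conormal directions of the facets are left out, since angles in these directions are
  supplied by the orbit.\<close>

definition angle :: "('n, 'N) frame \<Rightarrow> ('n, 'N) level_model \<Rightarrow> real^'n" where
  "angle q e = (\<Sum>k\<in>UNIV. (if k \<in> pos q ` facets q then 0 else fst (snd e) $ k) *\<^sub>R basis_vec q k)"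

text \<open>Off the facets the level equation fixes the modulus, and the phase is normalised to 0 by
  moving along the orbit.\<close>

definition fibre_coord :: "('n, 'N) frame \<Rightarrow> ('n, 'N) level_model \<Rightarrow> 'N \<Rightarrow> complex" where
  "fibre_coord q e i =
     (if i \<in> facets q then Complex (fst e $ pos q i / sqrt 2) (fst (snd e) $ pos q i / sqrt 2)
      else of_real (sqrt (\<kappa> i - base_point q e \<bullet> \<eta> i)))"

definition slice :: "('n, 'N) frame \<Rightarrow> ('n, 'N) level_model \<Rightarrow> ('n, 'N) total_model" where
  "slice q e = (base_point q e, angle q e, \<chi> i. fibre_coord q e i)"

definition level_map :: "('n, 'N) frame \<Rightarrow> ('n, 'N) level_model \<Rightarrow> ('n, 'N) total_model" where
  "level_map q e = lift_act \<eta> 0 (snd (snd e)) (slice q e)"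

text \<open>The strict inequalities keep the arguments of the roots positive. The angles
  \<open>t\<close> are unrestricted, so injectivity has to be obtained by shrinking.\<close>

definition domain :: "('n, 'N) frame \<Rightarrow> ('n, 'N) level_model set" where
  "domain q = {e. base_point q e \<in> U \<and> (\<forall>j. j \<notin> facets q \<longrightarrow> base_point q e \<bullet> \<eta> j < \<kappa> j)}"

section \<open>The slice and its translates inside the zero level\<close>

lemma slice_cong: "level_proj e = level_proj e' \<Longrightarrow> slice q e = slice q e'"
  by (simp add: level_proj_def slice_def fibre_coord_def base_point_def base_coord_def angle_def cong: if_cong)

lemma domain_cong: "level_proj e = level_proj e' \<Longrightarrow> e \<in> domain q \<longleftrightarrow> e' \<in> domain q"
  by (simp add: level_proj_def domain_def base_point_def base_coord_def cong: if_cong)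

lemma base_point_vec: "adapted q \<Longrightarrow> base_point q e \<bullet> basis_vec q k = base_coord q e k"
  by (simp add: base_point_def inner_sum_left adapted_dual if_distrib[of "(*) _"] cong: if_cong)

lemma base_point_facet:
  assumes "adapted q" "i \<in> facets q"
  shows "base_point q e \<bullet> \<eta> i = \<kappa> i - ((fst e $ pos q i)\<^sup>2 + (fst (snd e) $ pos q i)\<^sup>2) / 2"
  using base_point_vec[OF assms(1), of e "pos q i"] assms
  by (simp add: adapted_vec base_coord_def facet_at_pos)

lemma fibre_coord_norm:
  assumes "adapted q" "e \<in> domain q"
  shows "base_point q e \<bullet> \<eta> i + fibre_coord q e i \<bullet> fibre_coord q e i = \<kappa> i"
proof (cases "i \<in> facets q")
  case True
  then show ?thesis
    by (simp add: fibre_coord_def base_point_facet[OF assms(1)] inner_complex_def power2_eq_square add_divide_distrib)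
next
  case False
  then have "0 \<le> \<kappa> i - base_point q e \<bullet> \<eta> i"
    using assms(2) by (simp add: domain_def less_imp_le)
  then show ?thesis
    using False by (simp add: fibre_coord_def inner_complex_def flip: power2_eq_square)
qed

lemma inner_lift_act: "snd (snd (lift_act \<eta> s t y)) $ i \<bullet> snd (snd (lift_act \<eta> s t y)) $ i = snd (snd y) $ i \<bullet> snd (snd y) $ i"
  by (simp add: lift_act_def norm_mult flip: power2_norm_eq_inner)

lemma lift_act_level: "y \<in> lifted_level \<Longrightarrow> lift_act \<eta> s t y \<in> lifted_level"
  unfolding lifted_level_def by (simp add: inner_lift_act) (simp add: lift_act_def)

lemma slice_level: "adapted q \<Longrightarrow> e \<in> domain q \<Longrightarrow> slice q e \<in> lifted_level"
  using fibre_coord_norm by (simp add: lifted_level_def slice_def domain_def)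

lemma level_map_level: "adapted q \<Longrightarrow> e \<in> domain q \<Longrightarrow> level_map q e \<in> lifted_level"
  by (simp add: level_map_def lift_act_level slice_level)

lemma smooth_at_base_point [smooth_intros]: "smooth_at (base_point q) e"
  unfolding base_point_def[abs_def]
proof (intro smooth_intros)
  fix k
  show "smooth_at (\<lambda>e. base_coord q e k) e"
    by (cases "k \<in> pos q ` facets q") (simp_all only: base_coord_def divide_inverse if_True if_False, (intro smooth_intros)+)
qed

lemma smooth_at_angle [smooth_intros]: "smooth_at (angle q) e"
  unfolding angle_def[abs_def]
proof (intro smooth_intros)
  fix k
  show "smooth_at (\<lambda>e. if k \<in> pos q ` facets q then 0 else fst (snd e) $ k) e"
    by (cases "k \<in> pos q ` facets q") (simp_all only: if_True if_False, (intro smooth_intros)+)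
qed

lemma smooth_at_fibre_coord: "e \<in> domain q \<Longrightarrow> smooth_at (\<lambda>e. fibre_coord q e i) e"
  by (cases "i \<in> facets q")
    (auto simp: fibre_coord_def divide_inverse domain_def intro!: smooth_intros)

lemma smooth_at_slice: "e \<in> domain q \<Longrightarrow> smooth_at (slice q) e"
  unfolding slice_def[abs_def] by (intro smooth_intros smooth_at_fibre_coord)

lemma smooth_at_level_map: "e \<in> domain q \<Longrightarrow> smooth_at (level_map q) e"
  unfolding level_map_def[abs_def] by (intro smooth_intros smooth_at_slice)

lemma open_domain: "open (domain q)"
proof -
  have c: "continuous_on UNIV (base_point q)"
    by (intro continuous_at_imp_continuous_on ballI smooth_at_isCont smooth_at_base_point)
  have "domain q = base_point q -` U \<inter> (\<Inter>j\<in>- facets q. {e. base_point q e \<bullet> \<eta> j < \<kappa> j})"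
    by (auto simp: domain_def)
  moreover have "open (base_point q -` U)" using c open_U by (simp add: open_vimage)
  moreover have "open {e. base_point q e \<bullet> \<eta> j < \<kappa> j}" for j
    using c by (intro open_Collect_less continuous_intros) auto
  ultimately show ?thesis by (simp only:) (intro open_Int open_INT ballI finite; assumption)
qed

text \<open>The inverse of the parametrization of the level. The angle of \<open>z\<^sub>j\<close>, \<open>j \<notin> I\<close>, is taken in the branch
  around \<open>t\<^sub>j\<close>; no branch is needed for \<open>i \<in> I\<close>, where the angle is a coordinate of the lift of \<open>\<theta>\<close>.\<close>

definition turn :: "real^'N \<Rightarrow> ('n, 'N) total_model \<Rightarrow> 'N \<Rightarrow> real" where
  "turn t y j = t $ j + Im (Ln (exp (- \<i> * of_real (t $ j)) * snd (snd y) $ j))"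

text \<open>Removing the rotations off the facets leaves \<open>angle\<close> plus the facet part of
  the orbit. In the basis of the frame these occupy complementary coordinates, so the dual basis
  reads off both.\<close>

definition rest :: "('n, 'N) frame \<Rightarrow> real^'N \<Rightarrow> ('n, 'N) total_model \<Rightarrow> real^'n" where
  "rest q t y = fst (snd y) - (\<Sum>j\<in>- facets q. turn t y j *\<^sub>R \<eta> j)"

definition gauge :: "('n, 'N) frame \<Rightarrow> real^'N \<Rightarrow> ('n, 'N) total_model \<Rightarrow> 'N \<Rightarrow> real" where
  "gauge q t y i = (if i \<in> facets q then dual_vec q (pos q i) \<bullet> rest q t y else turn t y i)"

text \<open>The coordinate of a facet, rotated back by its angle and rescaled, is
  \<open>a + \<i> * \<alpha>\<close>.\<close>

definition normal :: "('n, 'N) frame \<Rightarrow> real^'N \<Rightarrow> ('n, 'N) total_model \<Rightarrow> 'n \<Rightarrow> complex" where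
  "normal q t y k = of_real (sqrt 2) *
     (exp (- \<i> * of_real (gauge q t y (facet_at q k))) * snd (snd y) $ facet_at q k)"

definition level_inv :: "('n, 'N) frame \<Rightarrow> real^'N \<Rightarrow> ('n, 'N) total_model \<Rightarrow> ('n, 'N) level_model" where
  "level_inv q t y =
     (\<chi> k. if k \<in> pos q ` facets q then Re (normal q t y k) else fst y \<bullet> basis_vec q k,
      \<chi> k. if k \<in> pos q ` facets q then Im (normal q t y k) else dual_vec q k \<bullet> rest q t y,
      \<chi> i. gauge q t y i)"

lemma smooth_at_turn:
  "exp (- \<i> * of_real (t $ j)) * snd (snd y) $ j \<notin> \<real>\<^sub>\<le>\<^sub>0 \<Longrightarrow> smooth_at (\<lambda>y. turn t y j) y"
  unfolding turn_def by (intro smooth_intros)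

text \<open>\<open>level_inv\<close> is a formula on the whole covering rather than on the level, so
  it can be composed with ambient smooth maps. The condition keeps clear of the branch cut of
  \<open>Ln\<close>.\<close>

lemma smooth_at_level_inv:
  assumes "\<And>j. j \<notin> facets q \<Longrightarrow> exp (- \<i> * of_real (t $ j)) * snd (snd y) $ j \<notin> \<real>\<^sub>\<le>\<^sub>0"
  shows "smooth_at (level_inv q t) y"
proof -
  have r: "smooth_at (rest q t) y"
    unfolding rest_def[abs_def] by (intro smooth_intros smooth_at_turn assms) auto
  have g: "smooth_at (\<lambda>y. gauge q t y i) y" for i
    by (cases "i \<in> facets q") (auto simp: gauge_def intro!: smooth_intros r smooth_at_turn assms)
  have n: "smooth_at (\<lambda>y. normal q t y k) y" for k
    unfolding normal_def by (intro smooth_intros g)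
  have "smooth_at (\<lambda>y. if k \<in> pos q ` facets q then Re (normal q t y k) else fst y \<bullet> basis_vec q k) y" for k
    by (cases "k \<in> pos q ` facets q") (simp_all only: if_True if_False, (intro smooth_intros n)+)
  moreover have "smooth_at (\<lambda>y. if k \<in> pos q ` facets q then Im (normal q t y k) else dual_vec q k \<bullet> rest q t y) y" for k
    by (cases "k \<in> pos q ` facets q") (simp_all only: if_True if_False, (intro smooth_intros n r)+)
  ultimately show ?thesis
    unfolding level_inv_def[abs_def] by (intro smooth_intros g) auto
qed

lemma sum_facets:
  assumes "adapted q"
  shows "(\<Sum>i\<in>facets q. f i *\<^sub>R \<eta> i) = (\<Sum>k\<in>UNIV. (if k \<in> pos q ` facets q then f (facet_at q k) else 0) *\<^sub>R basis_vec q k)"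
proof -
  have "(\<Sum>i\<in>facets q. f i *\<^sub>R \<eta> i) = (\<Sum>k\<in>pos q ` facets q. f (facet_at q k) *\<^sub>R basis_vec q k)"
    by (simp add: sum.reindex[OF adapted_inj[OF assms]] facet_at_pos[OF assms] adapted_vec[OF assms])
  also have "\<dots> = (\<Sum>k\<in>UNIV. (if k \<in> pos q ` facets q then f (facet_at q k) else 0) *\<^sub>R basis_vec q k)"
    by (simp add: sum.mono_neutral_right[of UNIV "pos q ` facets q"])
  finally show ?thesis .
qed

lemma sum_split_facets:
  "(\<Sum>i\<in>UNIV. f i) = (\<Sum>i\<in>facets q. f i) + (\<Sum>i\<in>- facets q. f i)" for f :: "'N \<Rightarrow> real^'n"
  by (simp add: Compl_eq_Diff_UNIV sum.subset_diff[of "facets q" UNIV] add.commute)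

text \<open>Polar coordinates: \<open>Ln\<close> is taken after turning by \<open>- t $ j\<close>,
  and the summand \<open>t $ j\<close> turns back. Every branch works, since
  \<open>exp (Ln w) = w\<close> for all nonzero \<open>w\<close>.\<close>

lemma exp_turn:
  assumes "snd (snd y) $ j \<noteq> 0"
  shows "exp (\<i> * of_real (turn t y j)) * of_real (norm (snd (snd y) $ j)) = snd (snd y) $ j"
proof -
  define w where "w = exp (- \<i> * of_real (t $ j)) * snd (snd y) $ j"
  have w: "w \<noteq> 0" "norm w = norm (snd (snd y) $ j)"
    using assms by (simp_all add: w_def norm_mult)
  have "exp (\<i> * of_real (Im (Ln w))) * of_real (norm w) = w"
  proof -
    have "of_real (norm w) = exp (of_real (Re (Ln w)) :: complex)"
      using w(1) by (simp add: exp_of_real)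
    then have "exp (\<i> * of_real (Im (Ln w))) * of_real (norm w) = exp (of_real (Re (Ln w)) + \<i> * of_real (Im (Ln w)))"
      by (simp add: exp_add mult.commute)
    also have "\<dots> = w" by (simp only: complex_eq[symmetric] exp_Ln[OF w(1)])
    finally show ?thesis .
  qed
  then have "exp (\<i> * of_real (t $ j)) * (exp (\<i> * of_real (Im (Ln w))) * of_real (norm w)) = snd (snd y) $ j"
    by (simp add: w_def exp_minus)
  moreover have "turn t y j = t $ j + Im (Ln w)" by (simp add: turn_def w_def)
  ultimately show ?thesis
    by (simp add: w(2) exp_add distrib_left mult.assoc)
qed

text \<open>Any \<open>t\<close> will do: another branch of the angles off the facets is compensated
  by \<open>rest\<close> and \<open>normal\<close>, so the point of the covering itself is recovered
  and not only its image in the total space.\<close>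

lemma level_inv_right:
  assumes q: "adapted q" and y: "y \<in> lifted_level" and nz: "\<And>j. j \<notin> facets q \<Longrightarrow> snd (snd y) $ j \<noteq> 0"
  shows "level_map q (level_inv q t y) = y" "level_inv q t y \<in> domain q"
proof -
  define e where "e = level_inv q t y"
  have U: "fst y \<in> U" and lev: "\<And>i. fst y \<bullet> \<eta> i + (norm (snd (snd y) $ i))\<^sup>2 = \<kappa> i"
    using y by (auto simp: lifted_level_def power2_norm_eq_inner)
  have nrm: "(Re (normal q t y k))\<^sup>2 + (Im (normal q t y k))\<^sup>2 = 2 * (norm (snd (snd y) $ facet_at q k))\<^sup>2" for k
    unfolding cmod_power2[symmetric] by (simp add: normal_def norm_mult power_mult_distrib)
  have "base_coord q e k = fst y \<bullet> basis_vec q k" for k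
  proof (cases "k \<in> pos q ` facets q")
    case True
    then have "\<eta> (facet_at q k) = basis_vec q k"
      using facet_at_mem[OF True] adapted_vec[OF q] by metis
    then show ?thesis
      using True nrm[of k] lev[of "facet_at q k"] by (simp add: base_coord_def e_def level_inv_def)
  next
    case False
    then show ?thesis by (simp add: base_coord_def e_def level_inv_def)
  qed
  then have bp: "base_point q e = fst y"
    by (simp add: base_point_def adapted_expand[OF q])
  show dom: "level_inv q t y \<in> domain q"
    unfolding domain_def e_def[symmetric] mem_Collect_eq bp
  proof (intro conjI allI impI U)
    fix j assume "j \<notin> facets q"
    then have "(norm (snd (snd y) $ j))\<^sup>2 > 0" using nz[of j] by simp
    then show "fst y \<bullet> \<eta> j < \<kappa> j" using lev[of j] by linarith
  qed
  \<comment> \<open>Facet positions carry the orbit angles and the other positions the slice angles;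
    together they give the full expansion of \<open>rest\<close>.\<close>
  have "angle q e + (\<Sum>i\<in>facets q. gauge q t y i *\<^sub>R \<eta> i) = (\<Sum>k\<in>UNIV. (dual_vec q k \<bullet> rest q t y) *\<^sub>R basis_vec q k)"
    unfolding sum_facets[OF q] angle_def sum.distrib[symmetric]
  proof (rule sum.cong[OF refl])
    fix k
    show "(if k \<in> pos q ` facets q then 0 else fst (snd e) $ k) *\<^sub>R basis_vec q k +
          (if k \<in> pos q ` facets q then gauge q t y (facet_at q k) else 0) *\<^sub>R basis_vec q k =
          (dual_vec q k \<bullet> rest q t y) *\<^sub>R basis_vec q k"
      using facet_at_mem[of k q] by (auto simp: e_def level_inv_def gauge_def)
  qed
  also have "\<dots> = rest q t y" by (rule adapted_coexpand[OF q])
  finally have "angle q e + (\<Sum>i\<in>facets q. gauge q t y i *\<^sub>R \<eta> i) = rest q t y" .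
  moreover have "(\<Sum>i\<in>- facets q. gauge q t y i *\<^sub>R \<eta> i) = (\<Sum>i\<in>- facets q. turn t y i *\<^sub>R \<eta> i)"
    by (rule sum.cong) (auto simp: gauge_def)
  ultimately have ang: "angle q e + (\<Sum>i\<in>UNIV. gauge q t y i *\<^sub>R \<eta> i) = fst (snd y)"
    by (simp add: sum_split_facets[of _ q] rest_def algebra_simps)
  have fib: "exp (\<i> * of_real (gauge q t y i)) * fibre_coord q e i = snd (snd y) $ i" for i
  proof (cases "i \<in> facets q")
    case True
    have "Complex (Re w / sqrt 2) (Im w / sqrt 2) = w / of_real (sqrt 2)" for w
      by (simp add: complex_eq_iff)
    then have "fibre_coord q e i = normal q t y (pos q i) / of_real (sqrt 2)"
      using True by (simp add: fibre_coord_def e_def level_inv_def)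
    also have "\<dots> = exp (- \<i> * of_real (gauge q t y i)) * snd (snd y) $ i"
      by (simp add: normal_def facet_at_pos[OF q True])
    finally show ?thesis by (simp add: exp_minus)
  next
    case False
    have "\<kappa> i - fst y \<bullet> \<eta> i = (norm (snd (snd y) $ i))\<^sup>2" using lev[of i] by simp
    then show ?thesis
      using False exp_turn[OF nz[OF False]] by (simp add: fibre_coord_def bp gauge_def)
  qed
  have "snd (snd e) $ i = gauge q t y i" for i by (simp add: e_def level_inv_def)
  then show "level_map q (level_inv q t y) = y"
    unfolding e_def[symmetric] level_map_def lift_act_def slice_def
    by (simp add: prod_eq_iff vec_eq_iff bp ang fib)
qed

lemma exp_domain:
  assumes "e \<in> domain q" "j \<notin> facets q"
  obtains r where "r > 0" "snd (snd (level_map q e)) $ j = exp (\<i> * of_real (snd (snd e) $ j)) * of_real r"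
proof
  show "sqrt (\<kappa> j - base_point q e \<bullet> \<eta> j) > 0" using assms by (simp add: domain_def)
  show "snd (snd (level_map q e)) $ j = exp (\<i> * of_real (snd (snd e) $ j)) * of_real (sqrt (\<kappa> j - base_point q e \<bullet> \<eta> j))"
    using assms by (simp add: level_map_def lift_act_def slice_def fibre_coord_def)
qed

text \<open>Here the branch matters: off the facets the angle is recovered by \<open>Ln\<close>,
  which inverts \<open>exp\<close> when the imaginary part lies between \<open>- pi\<close> and
  \<open>pi\<close>. For facets the angle is read from the lift of \<open>\<theta>\<close>.\<close>

lemma level_inv_left:
  assumes q: "adapted q" and e: "e \<in> domain q" and t: "\<And>j. j \<notin> facets q \<Longrightarrow> \<bar>snd (snd e) $ j - t $ j\<bar> < pi"
  shows "level_inv q t (level_map q e) = e"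
proof -
  define y where "y = level_map q e"
  obtain a \<alpha> \<tau> where e': "e = (a, \<alpha>, \<tau>)" by (cases e)
  have tu: "turn t y j = \<tau> $ j" if j: "j \<notin> facets q" for j
  proof -
    obtain r where r: "r > 0" "snd (snd y) $ j = exp (\<i> * of_real (\<tau> $ j)) * of_real r"
      using exp_domain[OF e j] by (auto simp: y_def e')
    have "exp (- \<i> * of_real (t $ j)) * snd (snd y) $ j = exp (Complex (ln r) (\<tau> $ j - t $ j))"
      using r(1) by (simp add: r(2) Complex_eq exp_add exp_diff exp_minus exp_of_real algebra_simps divide_inverse)
    then have "Ln (exp (- \<i> * of_real (t $ j)) * snd (snd y) $ j) = Complex (ln r) (\<tau> $ j - t $ j)"
      using t[OF j] by (simp add: e' Ln_exp)
    then show ?thesis by (simp add: turn_def)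
  qed
  have re: "rest q t y = (\<Sum>k\<in>UNIV. (if k \<in> pos q ` facets q then \<tau> $ facet_at q k else \<alpha> $ k) *\<^sub>R basis_vec q k)"
  proof -
    have "(\<Sum>j\<in>- facets q. turn t y j *\<^sub>R \<eta> j) = (\<Sum>j\<in>- facets q. \<tau> $ j *\<^sub>R \<eta> j)"
      by (rule sum.cong) (auto simp: tu)
    moreover have "fst (snd y) = angle q e + (\<Sum>i\<in>UNIV. \<tau> $ i *\<^sub>R \<eta> i)"
      by (simp add: y_def level_map_def lift_act_def slice_def e')
    ultimately have "rest q t y = angle q e + (\<Sum>i\<in>facets q. \<tau> $ i *\<^sub>R \<eta> i)"
      by (simp add: rest_def sum_split_facets[of _ q])
    also have "\<dots> = (\<Sum>k\<in>UNIV. (if k \<in> pos q ` facets q then \<tau> $ facet_at q k else \<alpha> $ k) *\<^sub>R basis_vec q k)"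
      unfolding sum_facets[OF q] angle_def sum.distrib[symmetric] by (rule sum.cong) (auto simp: e')
    finally show ?thesis .
  qed
  have co: "dual_vec q k \<bullet> rest q t y = (if k \<in> pos q ` facets q then \<tau> $ facet_at q k else \<alpha> $ k)" for k
    unfolding re by (simp add: inner_sum_right adapted_dual[OF q] if_distrib[of "(*) _"] cong: if_cong)
  have ga: "gauge q t y i = \<tau> $ i" for i
    by (simp add: gauge_def co tu facet_at_pos[OF q])
  have no: "normal q t y k = Complex (a $ k) (\<alpha> $ k)" if k: "k \<in> pos q ` facets q" for k
  proof -
    have "snd (snd y) $ facet_at q k = exp (\<i> * of_real (\<tau> $ facet_at q k)) * Complex (a $ k / sqrt 2) (\<alpha> $ k / sqrt 2)"
      using facet_at_mem[OF k] by (simp add: y_def level_map_def lift_act_def slice_def fibre_coord_def e')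
    then have "normal q t y k = of_real (sqrt 2) * Complex (a $ k / sqrt 2) (\<alpha> $ k / sqrt 2)"
      by (simp add: normal_def ga exp_minus)
    then show ?thesis by (simp add: complex_eq_iff)
  qed
  have "fst y \<bullet> basis_vec q k = a $ k" if "k \<notin> pos q ` facets q" for k
    using that base_point_vec[OF q, of e k]
    by (simp add: y_def level_map_def lift_act_def slice_def base_coord_def e')
  then show ?thesis
    unfolding y_def[symmetric] by (auto simp: level_inv_def no co ga e' vec_eq_iff)
qed

lemma exists_adapted_frame:
  assumes y: "y \<in> lifted_level"
  shows "\<exists>q. adapted q \<and> facets q = {i. snd (snd y) $ i = 0}"
proof -
  define I where "I = {i. snd (snd y) $ i = 0}"
  have lev: "fst y \<bullet> \<eta> i + snd (snd y) $ i \<bullet> snd (snd y) $ i = \<kappa> i" for i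
    using y by (simp add: lifted_level_def)
  have le: "fst y \<bullet> \<eta> i \<le> \<kappa> i" for i
    using lev[of i] inner_ge_zero[of "snd (snd y) $ i"] by linarith
  have face: "fst y \<in> polyhedron_face \<eta> \<kappa> I"
  proof -
    have "fst y \<bullet> \<eta> i = \<kappa> i" if "i \<in> I" for i using lev[of i] that by (simp add: I_def)
    then show ?thesis using le by (simp add: polyhedron_face_def polyhedron_of_def)
  qed
  have sat: "a j \<in> \<int>" if "integral_vector (\<Sum>i\<in>I. a i *\<^sub>R \<eta> i)" "j \<in> I" for a j
    using saturated[OF _ face that] y by (simp add: lifted_level_def)
  have ind: "a j = 0" if a: "(\<Sum>i\<in>I. a i *\<^sub>R \<eta> i) = 0" and j: "j \<in> I" for a j
  proof (rule ccontr)
    assume "a j \<noteq> 0"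
    \<comment> \<open>Divided by \<open>2 * a j\<close>, the relation still has the integral value
      0, but its coefficient at \<open>j\<close> is one half, against saturation.\<close>
    have "(\<Sum>i\<in>I. (a i / (2 * a j)) *\<^sub>R \<eta> i) = (1 / (2 * a j)) *\<^sub>R (\<Sum>i\<in>I. a i *\<^sub>R \<eta> i)"
      by (simp add: scaleR_sum_right)
    then have "integral_vector (\<Sum>i\<in>I. (a i / (2 * a j)) *\<^sub>R \<eta> i)"
      using a by (simp add: integral_vector_0)
    from sat[OF this j] have "(1 / 2 :: real) \<in> \<int>" using \<open>a j \<noteq> 0\<close> by simp
    then show False using Ints_nonzero_abs_ge1[of "1 / 2 :: real"] by simp
  qed
  show ?thesis
  proof (rule dual_basis_extension[where I = I and \<eta> = \<eta>])
    show "a j = 0" if "(\<Sum>i\<in>I. a i *\<^sub>R \<eta> i) = 0" "j \<in> I" for a j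
      using ind that by blast
    fix \<sigma> b and b' :: "'n \<Rightarrow> real^'n"
    assume "inj_on \<sigma> I" "\<And>i. i \<in> I \<Longrightarrow> b (\<sigma> i) = \<eta> i"
      "\<And>k l. b' k \<bullet> b l = (if k = l then 1 else 0)"
      "\<And>x. (\<Sum>k\<in>UNIV. (x \<bullet> b k) *\<^sub>R b' k) = x" "\<And>x. (\<Sum>k\<in>UNIV. (b' k \<bullet> x) *\<^sub>R b k) = x"
    then have "adapted (Frame I \<sigma> b b')" using sat by (simp add: adapted_def)
    then show ?thesis by (intro exI[of _ "Frame I \<sigma> b b'"]) (simp add: I_def)
  qed
qed

end

section \<open>The given form in the coordinates of a frame\<close>

lemma has_derivative_unique_eventually:
  assumes "(f has_derivative f') (at x)" "(g has_derivative g') (at x)" "\<forall>\<^sub>F y in nhds x. f y = g y"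
  shows "f' = g'"
proof -
  obtain S where "open S" "x \<in> S" "\<And>y. y \<in> S \<Longrightarrow> f y = g y"
    using assms(3) unfolding eventually_nhds by blast
  with assms(1) have "(g has_derivative f') (at x)"
    using has_derivative_transform_within_open by blast
  then show ?thesis using assms(2) has_derivative_unique by blast
qed

context toric_data
begin

lemma has_derivative_angle: "(angle q has_derivative angle q) (at e)"
proof -
  have "(angle q has_derivative (\<lambda>u. \<Sum>k\<in>UNIV. (if k \<in> pos q ` facets q then 0 else fst (snd u) $ k) *\<^sub>R basis_vec q k)) (at e)"
    unfolding angle_def[abs_def]
  proof (intro derivative_intros has_derivative_scaleR_left)
    fix k
    show "((\<lambda>e. if k \<in> pos q ` facets q then 0 else fst (snd e) $ k) has_derivative
        (\<lambda>u. if k \<in> pos q ` facets q then 0 else fst (snd u) $ k)) (at e)"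
      by (cases "k \<in> pos q ` facets q") (simp_all only: if_True if_False, (intro derivative_intros)+)
  qed
  then show ?thesis by (simp add: angle_def[abs_def])
qed

lemma inner_angle:
  "w \<bullet> angle q v = (\<Sum>k\<in>- pos q ` facets q. (w \<bullet> basis_vec q k) * fst (snd v) $ k)"
proof -
  have "w \<bullet> angle q v = (\<Sum>k\<in>UNIV. if k \<in> pos q ` facets q then 0 else (w \<bullet> basis_vec q k) * fst (snd v) $ k)"
    unfolding angle_def inner_sum_right by (rule sum.cong) auto
  also have "\<dots> = (\<Sum>k\<in>- pos q ` facets q. (w \<bullet> basis_vec q k) * fst (snd v) $ k)"
    by (simp add: sum.If_cases Compl_eq)
  finally show ?thesis .
qed

text \<open>In the coordinates of a frame the reduced form is the standard one: the torus directions lie in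
  its kernel because the moment map is constant on the level, and the coordinate
  \<open>(a + \<i> \<alpha>) / \<surd>2\<close> of a disc turns \<open>\<surd>-1 dz \<and> dz\<^sup>*\<close> into \<open>da \<and> d\<alpha>\<close>.\<close>

lemma total_form_level_map:
  assumes q: "adapted q" and e: "e \<in> domain q"
  shows "total_form c p (frechet_derivative (level_map q) (at e) u) (frechet_derivative (level_map q) (at e) v) =
    red_form (level_proj u) (level_proj v)"
proof -
  define P where "P = pos q ` facets q"
  \<comment> \<open>The derivatives of the base point and of the fibre coordinates stay abstract.
    What is needed about them comes from differentiating equations that they satisfy, so the square
    root is never differentiated.\<close>
  define X where "X = frechet_derivative (base_point q) (at e)"
  define Z where "Z i = frechet_derivative (\<lambda>e. fibre_coord q e i) (at e)" for i
  define z where "z i = fibre_coord q e i" for i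
  have X: "(base_point q has_derivative X) (at e)"
    unfolding X_def by (intro smooth_at_has_derivative smooth_at_base_point)
  have Z: "((\<lambda>e. fibre_coord q e i) has_derivative Z i) (at e)" for i
    unfolding Z_def by (intro smooth_at_has_derivative smooth_at_fibre_coord e)
  have dom: "\<forall>\<^sub>F e' in nhds e. e' \<in> domain q"
    using e open_domain by (rule eventually_nhds_in_open[rotated])
  have Xb: "X w \<bullet> basis_vec q k = fst w $ k" if "k \<notin> P" for k w
  proof -
    have "(\<lambda>w. X w \<bullet> basis_vec q k) = (\<lambda>w. fst w $ k)"
    proof (rule has_derivative_unique)
      show "((\<lambda>e. base_point q e \<bullet> basis_vec q k) has_derivative (\<lambda>w. X w \<bullet> basis_vec q k)) (at e)"
        by (intro has_derivative_inner_left X)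
      show "((\<lambda>e. base_point q e \<bullet> basis_vec q k) has_derivative (\<lambda>w. fst w $ k)) (at e)"
        using that by (simp add: base_point_vec[OF q] base_coord_def P_def) (intro derivative_intros)
    qed
    then show ?thesis by meson
  qed
  have level: "X w \<bullet> \<eta> i = - 2 * (z i \<bullet> Z i w)" for w i
  proof -
    have "(\<lambda>w. X w \<bullet> \<eta> i + (z i \<bullet> Z i w + Z i w \<bullet> z i)) = (\<lambda>w. 0)"
    proof (rule has_derivative_unique_eventually)
      show "((\<lambda>e. base_point q e \<bullet> \<eta> i + fibre_coord q e i \<bullet> fibre_coord q e i) has_derivative
          (\<lambda>w. X w \<bullet> \<eta> i + (z i \<bullet> Z i w + Z i w \<bullet> z i))) (at e)"
        unfolding z_def by (intro has_derivative_add has_derivative_inner_left X has_derivative_inner Z)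
      show "((\<lambda>_. \<kappa> i) has_derivative (\<lambda>w. 0)) (at e)" by simp
      show "\<forall>\<^sub>F y in nhds e. base_point q y \<bullet> \<eta> i + fibre_coord q y i \<bullet> fibre_coord q y i = \<kappa> i"
        using dom by eventually_elim (rule fibre_coord_norm[OF q])
    qed
    from fun_cong[OF this, of w] show ?thesis by (simp add: inner_commute)
  qed
  have Z_facet: "Z i w = Complex (fst w $ pos q i / sqrt 2) (fst (snd w) $ pos q i / sqrt 2)" if "i \<in> facets q" for i w
  proof -
    have "Z i = (\<lambda>w. of_real (fst w $ pos q i / sqrt 2) + \<i> * of_real (fst (snd w) $ pos q i / sqrt 2))"
    proof (rule has_derivative_unique[OF Z])
      show "((\<lambda>e. fibre_coord q e i) has_derivative
          (\<lambda>w. of_real (fst w $ pos q i / sqrt 2) + \<i> * of_real (fst (snd w) $ pos q i / sqrt 2))) (at e)"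
        using that by (simp only: fibre_coord_def if_True Complex_eq divide_inverse)
          (intro has_derivative_add has_derivative_mult_right has_derivative_of_real has_derivative_mult_left
            has_derivative_vec_nth has_derivative_fst has_derivative_snd has_derivative_ident)
    qed
    then show ?thesis by (simp add: Complex_eq)
  qed
  \<comment> \<open>A real coordinate contributes nothing to
    \<open>Im (Z i v * cnj (Z i u))\<close>, so only the discs of the facets remain.\<close>
  have Z_free: "Im (Z i w) = 0" if "i \<notin> facets q" for i w
  proof -
    have "(\<lambda>w. Im (Z i w)) = (\<lambda>w. 0)"
    proof (rule has_derivative_unique)
      show "((\<lambda>e. Im (fibre_coord q e i)) has_derivative (\<lambda>w. Im (Z i w))) (at e)"
        by (rule bounded_linear.has_derivative[OF bounded_linear_Im Z])
      show "((\<lambda>e. Im (fibre_coord q e i)) has_derivative (\<lambda>w. 0)) (at e)"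
        using that by (simp add: fibre_coord_def)
    qed
    then show ?thesis by meson
  qed
  define L where "L w = (X w, angle q w + (\<Sum>i\<in>UNIV. snd (snd w) $ i *\<^sub>R \<eta> i),
    \<chi> i. exp (\<i> * of_real (snd (snd e) $ i)) * (\<i> * of_real (snd (snd w) $ i) * z i + Z i w))" for w
  have "(level_map q has_derivative L) (at e)"
  proof -
    have "((\<lambda>e. exp (\<i> * of_real (snd (snd e) $ i)) * fibre_coord q e i) has_derivative
        (\<lambda>w. exp (\<i> * of_real (snd (snd e) $ i)) * (\<i> * of_real (snd (snd w) $ i) * z i + Z i w))) (at e)" for i
    proof -
      have "((\<lambda>e. \<i> * of_real (snd (snd e) $ i)) has_derivative (\<lambda>w. \<i> * of_real (snd (snd w) $ i))) (at e)"
        by (intro has_derivative_mult_right has_derivative_of_real has_derivative_vec_nth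
            has_derivative_snd has_derivative_ident)
      moreover have "(exp has_derivative (*) (exp (\<i> * of_real (snd (snd e) $ i)))) (at (\<i> * of_real (snd (snd e) $ i)))"
        using DERIV_exp has_field_derivative_def by blast
      ultimately have "((\<lambda>e. exp (\<i> * of_real (snd (snd e) $ i))) has_derivative
          (\<lambda>w. exp (\<i> * of_real (snd (snd e) $ i)) * (\<i> * of_real (snd (snd w) $ i)))) (at e)"
        by (rule has_derivative_compose)
      from has_derivative_mult[OF this Z[of i]] show ?thesis
        by (simp add: z_def algebra_simps)
    qed
    then have 3: "((\<lambda>e. \<chi> i. exp (\<i> * of_real (snd (snd e) $ i)) * fibre_coord q e i) has_derivative
        (\<lambda>w. \<chi> i. exp (\<i> * of_real (snd (snd e) $ i)) * (\<i> * of_real (snd (snd w) $ i) * z i + Z i w))) (at e)"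
      by (rule has_derivative_vec_lambda)
    have 2: "((\<lambda>e. angle q e + (\<Sum>i\<in>UNIV. snd (snd e) $ i *\<^sub>R \<eta> i)) has_derivative
       (\<lambda>w. angle q w + (\<Sum>i\<in>UNIV. snd (snd w) $ i *\<^sub>R \<eta> i))) (at e)"
      by (intro has_derivative_add has_derivative_angle has_derivative_sum has_derivative_scaleR_left
          has_derivative_vec_nth has_derivative_snd has_derivative_ident)
    show ?thesis
      unfolding level_map_def[abs_def] lift_act_def slice_def L_def[abs_def]
      using has_derivative_Pair[OF X has_derivative_Pair[OF 2 3]] by simp
  qed
  then have L: "frechet_derivative (level_map q) (at e) = L"
    by (rule frechet_derivative_at[symmetric])
  define \<tau> where "\<tau> w i = snd (snd w) $ i" for w :: "('n, 'N) level_model" and i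
  \<comment> \<open>The rotations produce terms with \<open>z i \<bullet> Z i w\<close>, which the
    differentiated level equation turns into pairings of \<open>X\<close> with
    \<open>\<eta> i\<close>; these will cancel the orbit part of the angles. The term with both
    rotations is real and drops out.\<close>
  have disc: "2 * Im (snd (snd (L v)) $ i * cnj (snd (snd (L u)) $ i)) =
     2 * Im (Z i v * cnj (Z i u)) - \<tau> v i * (X u \<bullet> \<eta> i) + \<tau> u i * (X v \<bullet> \<eta> i)" for i
  proof -
    have "Im (snd (snd (L v)) $ i * cnj (snd (snd (L u)) $ i)) =
        Im ((\<i> * of_real (\<tau> v i) * z i + Z i v) * cnj (\<i> * of_real (\<tau> u i) * z i + Z i u))"
      by (simp only: L_def snd_conv vec_lambda_beta Im_mult_cnj_exp \<tau>_def)
    also have "\<dots> = Im (Z i v * cnj (Z i u)) + \<tau> v i * (z i \<bullet> Z i u) - \<tau> u i * (z i \<bullet> Z i v)"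
      by (simp add: inner_complex_def algebra_simps)
    finally show ?thesis by (simp add: level algebra_simps)
  qed
  have ang: "X w \<bullet> angle q w' = (\<Sum>k\<in>- P. fst w $ k * fst (snd w') $ k)" for w w'
    unfolding inner_angle P_def[symmetric] by (rule sum.cong) (auto simp: Xb)
  have "(\<Sum>i\<in>UNIV. 2 * Im (Z i v * cnj (Z i u))) = (\<Sum>i\<in>facets q. 2 * Im (Z i v * cnj (Z i u)))"
    by (rule sum.mono_neutral_right) (auto simp: Z_free)
  also have "\<dots> = (\<Sum>i\<in>facets q. fst u $ pos q i * fst (snd v) $ pos q i - fst v $ pos q i * fst (snd u) $ pos q i)"
  proof (rule sum.cong[OF refl])
    fix i assume "i \<in> facets q"
    have half: "x / sqrt 2 * (y / sqrt 2) = x * y / 2" for x y :: real by simp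
    show "2 * Im (Z i v * cnj (Z i u)) =
       fst u $ pos q i * fst (snd v) $ pos q i - fst v $ pos q i * fst (snd u) $ pos q i"
      unfolding Z_facet[OF \<open>i \<in> facets q\<close>] by (simp add: half algebra_simps)
  qed
  also have "\<dots> = (\<Sum>k\<in>P. fst u $ k * fst (snd v) $ k - fst v $ k * fst (snd u) $ k)"
    unfolding P_def sum.reindex[OF adapted_inj[OF q]] by simp
  finally have Zsum: "(\<Sum>i\<in>UNIV. 2 * Im (Z i v * cnj (Z i u))) =
     (\<Sum>k\<in>P. fst u $ k * fst (snd v) $ k - fst v $ k * fst (snd u) $ k)" .
  have Lw: "L w = (fst (L w), fst (snd (L w)), snd (snd (L w)))" for w by simp
  have "total_form c p (L u) (L v) =
      fst (L u) \<bullet> fst (snd (L v)) - fst (L v) \<bullet> fst (snd (L u)) +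
      (\<Sum>i\<in>UNIV. 2 * Im (snd (snd (L v)) $ i * cnj (snd (snd (L u)) $ i)))"
    by (subst Lw[of u], subst Lw[of v], subst total_form_eq) (simp add: sum_distrib_left)
  also have "\<dots> = X u \<bullet> angle q v - X v \<bullet> angle q u + (\<Sum>i\<in>UNIV. 2 * Im (Z i v * cnj (Z i u)))"
    unfolding disc by (simp add: L_def \<tau>_def inner_add_right inner_sum_right sum.distrib sum_subtractf)
  also have "\<dots> = (\<Sum>k\<in>- P. fst u $ k * fst (snd v) $ k - fst v $ k * fst (snd u) $ k) +
      (\<Sum>k\<in>P. fst u $ k * fst (snd v) $ k - fst v $ k * fst (snd u) $ k)"
    unfolding ang Zsum by (simp add: sum_subtractf)
  also have "\<dots> = (\<Sum>k\<in>UNIV. fst u $ k * fst (snd v) $ k - fst v $ k * fst (snd u) $ k)"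
    by (simp add: Compl_eq_Diff_UNIV sum.subset_diff[of P UNIV])
  also have "\<dots> = red_form (level_proj u) (level_proj v)"
    by (simp add: red_form_def level_proj_def inner_vec_def sum_subtractf)
  finally show ?thesis by (simp add: L)
qed

text \<open>Taking for \<open>t\<close> the angles of \<open>e\<close> itself centres the branch at
  the point, so \<open>level_inv\<close> inverts \<open>level_map\<close> on both sides nearby. The
  abstract \<open>R\<close> hides this choice.\<close>

lemma level_inv_nhds:
  assumes q: "adapted q" and e: "e \<in> domain q"
  obtains R where "smooth_at R (level_map q e)" "R (level_map q e) = e"
    "\<forall>\<^sub>F y in nhds (level_map q e). y \<in> lifted_level \<longrightarrow> R y \<in> domain q \<and> level_map q (R y) = y"
    "\<forall>\<^sub>F e' in nhds e. R (level_map q e') = e'"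
proof -
  define t where "t = snd (snd e)"
  have pos: "exp (- \<i> * of_real (t $ j)) * snd (snd (level_map q e)) $ j \<notin> \<real>\<^sub>\<le>\<^sub>0"
    "snd (snd (level_map q e)) $ j \<noteq> 0" if j: "j \<notin> facets q" for j
  proof -
    obtain r where r: "r > 0" "snd (snd (level_map q e)) $ j = exp (\<i> * of_real (t $ j)) * of_real r"
      using exp_domain[OF e j] by (auto simp: t_def)
    then have "exp (- \<i> * of_real (t $ j)) * snd (snd (level_map q e)) $ j = of_real r"
      by (simp add: exp_minus)
    then show "exp (- \<i> * of_real (t $ j)) * snd (snd (level_map q e)) $ j \<notin> \<real>\<^sub>\<le>\<^sub>0"
      using r(1) by (simp add: complex_nonpos_Reals_iff)
    show "snd (snd (level_map q e)) $ j \<noteq> 0" using r by simp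
  qed
  show thesis
  proof (rule that[of "level_inv q t"])
    show "smooth_at (level_inv q t) (level_map q e)"
      by (rule smooth_at_level_inv) (rule pos(1))
    show "level_inv q t (level_map q e) = e"
      by (rule level_inv_left[OF q e]) (simp add: t_def)
    have "\<forall>\<^sub>F y in nhds (level_map q e). \<forall>j\<in>- facets q. snd (snd y) $ j \<noteq> 0"
    proof (intro eventually_ball_finite ballI)
      fix j assume "j \<in> - facets q"
      moreover have "open {y :: ('n, 'N) total_model. snd (snd y) $ j \<noteq> 0}"
        by (intro open_Collect_neq continuous_intros)
      ultimately show "\<forall>\<^sub>F y in nhds (level_map q e). snd (snd y) $ j \<noteq> 0"
        using pos(2)[of j] eventually_nhds_in_open by fastforce
    qed simp
    then show "\<forall>\<^sub>F y in nhds (level_map q e). y \<in> lifted_level \<longrightarrow>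
        level_inv q t y \<in> domain q \<and> level_map q (level_inv q t y) = y"
      by eventually_elim (use level_inv_right[OF q] in blast)
    have "\<forall>\<^sub>F e' in nhds e. \<forall>j\<in>UNIV. \<bar>snd (snd e') $ j - t $ j\<bar> < pi"
    proof (intro eventually_ball_finite ballI)
      fix j
      have "open {e' :: ('n, 'N) level_model. \<bar>snd (snd e') $ j - t $ j\<bar> < pi}"
        by (intro open_Collect_less continuous_intros)
      then show "\<forall>\<^sub>F e' in nhds e. \<bar>snd (snd e') $ j - t $ j\<bar> < pi"
        using eventually_nhds_in_open[of "{e' :: ('n, 'N) level_model. \<bar>snd (snd e') $ j - t $ j\<bar> < pi}" e]
        by (simp add: t_def)
    qed simp
    moreover have "\<forall>\<^sub>F e' in nhds e. e' \<in> domain q"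
      using e open_domain by (rule eventually_nhds_in_open[rotated])
    ultimately show "\<forall>\<^sub>F e' in nhds e. level_inv q t (level_map q e') = e'"
      by eventually_elim (use level_inv_left[OF q] in blast)
  qed
qed

text \<open>The local inverse is smooth on the ambient space, so composing it with a germ
  \<open>h\<close> into the level gives the smooth factor \<open>G\<close>, and the chain rule
  compares the forms. Changes of charts and induced maps are treated through this
  factorization.\<close>

lemma level_lift:
  assumes q: "adapted q" and e: "e \<in> domain q" and h: "smooth_at h x" "h x = level_map q e"
    and lev: "\<forall>\<^sub>F y in nhds x. h y \<in> lifted_level"
  obtains G where "smooth_at G x" "G x = e" "\<forall>\<^sub>F y in nhds x. G y \<in> domain q \<and> level_map q (G y) = h y"
    "\<And>c p u v. total_form c p (frechet_derivative h (at x) u) (frechet_derivative h (at x) v) =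
       red_form (level_proj (frechet_derivative G (at x) u)) (level_proj (frechet_derivative G (at x) v))"
    "frechet_derivative h (at x) = frechet_derivative (level_map q) (at e) \<circ> frechet_derivative G (at x)"
proof -
  obtain R where "smooth_at R (level_map q e)" "R (level_map q e) = e"
    "\<forall>\<^sub>F y in nhds (level_map q e). y \<in> lifted_level \<longrightarrow> R y \<in> domain q \<and> level_map q (R y) = y"
    by (rule level_inv_nhds[OF q e])
  note R = this[folded h(2)]
  have sm: "smooth_at (\<lambda>y. R (h y)) x" using h(1) R(1) by (rule smooth_at_compose)
  obtain S where S: "open S" "h x \<in> S" "\<And>y. y \<in> S \<Longrightarrow> y \<in> lifted_level \<Longrightarrow> R y \<in> domain q \<and> level_map q (R y) = y"
    using R(3) unfolding eventually_nhds by blast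
  have "\<forall>\<^sub>F y in nhds x. h y \<in> S" by (rule smooth_at_eventually_in[OF h(1) S(1,2)])
  with lev have ev: "\<forall>\<^sub>F y in nhds x. R (h y) \<in> domain q \<and> level_map q (R (h y)) = h y"
    by eventually_elim (use S(3) in blast)
  have "(h has_derivative frechet_derivative (level_map q) (at e) \<circ> frechet_derivative (\<lambda>y. R (h y)) (at x)) (at x)"
  proof -
    have "((\<lambda>y. level_map q (R (h y))) has_derivative
        (\<lambda>u. frechet_derivative (level_map q) (at e) (frechet_derivative (\<lambda>y. R (h y)) (at x) u))) (at x)"
      using smooth_at_has_derivative[OF smooth_at_level_map[OF e]] R(2)
      by (intro has_derivative_compose[OF smooth_at_has_derivative[OF sm]]) simp
    moreover obtain T where "open T" "x \<in> T" "\<And>y. y \<in> T \<Longrightarrow> level_map q (R (h y)) = h y"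
      using ev unfolding eventually_nhds by blast
    ultimately show ?thesis
      unfolding comp_def using has_derivative_transform_within_open by blast
  qed
  then have D: "frechet_derivative h (at x) =
      frechet_derivative (level_map q) (at e) \<circ> frechet_derivative (\<lambda>y. R (h y)) (at x)"
    by (rule frechet_derivative_at[symmetric])
  show thesis
    by (rule that[of "\<lambda>y. R (h y)", OF sm R(2) ev _ D]) (simp add: D total_form_level_map[OF q e])
qed

lemma exists_level_param:
  assumes y: "y \<in> lifted_level"
  obtains q e where "adapted q" "e \<in> domain q" "level_map q e = y"
proof -
  obtain q where q: "adapted q" "facets q = {i. snd (snd y) $ i = 0}"
    using exists_adapted_frame[OF y] by blast
  \<comment> \<open>The right inverse accepts every \<open>t\<close>; 0 is an arbitrary
    choice.\<close>
  have "level_map q (level_inv q 0 y) = y" "level_inv q 0 y \<in> domain q"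
    using level_inv_right[OF q(1) y] q(2) by simp_all
  then show thesis using that q(1) by blast
qed

text \<open>Freeness of the action. A coordinate off the facets does not vanish and forces its angle
  difference to be a period. In the equation for \<open>\<theta>\<close> these terms are integral,
  so the combination over the facets is integral too, and saturation makes the remaining differences
  periods.\<close>

lemma stabilizer_trivial:
  assumes q: "adapted q" and e: "(a, \<alpha>, t) \<in> domain q"
    and eq: "total_proj (level_map q (a, \<alpha>, t)) = total_proj (level_map q (a, \<alpha>, t'))"
  shows "torus_of t = torus_of t'"
proof -
  define m where "m i = (t $ i - t' $ i) / (2 * pi)" for i
  obtain k where k: "integral_vector k" "level_map q (a, \<alpha>, t) = level_map q (a, \<alpha>, t') + lattice_shift k"
    using eq total_proj_eq_iff by blast
  have sl: "slice q (a, \<alpha>, t) = slice q (a, \<alpha>, t')" by (rule slice_cong) (simp add: level_proj_def)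
  have m_free: "m j \<in> \<int>" if j: "j \<notin> facets q" for j
  proof -
    obtain r where r: "r > 0" "snd (snd (level_map q (a, \<alpha>, t))) $ j = exp (\<i> * of_real (t $ j)) * of_real r"
      using exp_domain[OF e j] by auto
    have "snd (snd (level_map q (a, \<alpha>, t'))) $ j * exp (\<i> * of_real (t $ j)) =
        snd (snd (level_map q (a, \<alpha>, t))) $ j * exp (\<i> * of_real (t' $ j))"
      by (simp add: level_map_def lift_act_def sl)
    moreover have "snd (snd (level_map q (a, \<alpha>, t'))) $ j = snd (snd (level_map q (a, \<alpha>, t))) $ j"
      by (simp add: k(2) lattice_shift_def)
    ultimately have "exp (\<i> * of_real (t $ j)) = exp (\<i> * of_real (t' $ j))" using r by simp
    then obtain n :: int where "\<i> * of_real (t $ j) = \<i> * of_real (t' $ j) + of_real (of_int (2 * n) * pi) * \<i>"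
      unfolding exp_eq by blast
    then have "\<i> * of_real (t $ j) = \<i> * of_real (t' $ j + 2 * of_int n * pi)" by (simp add: algebra_simps)
    then have "t $ j = t' $ j + 2 * of_int n * pi" by (simp only: mult_cancel_left of_real_eq_iff) simp
    then have "m j = of_int n" by (simp add: m_def)
    then show ?thesis by simp
  qed
  have "(\<Sum>i\<in>UNIV. m i *\<^sub>R \<eta> i) = k"
  proof -
    have "(\<Sum>i\<in>UNIV. t $ i *\<^sub>R \<eta> i) - (\<Sum>i\<in>UNIV. t' $ i *\<^sub>R \<eta> i) = (2 * pi) *\<^sub>R k"
      using arg_cong[OF k(2), of "\<lambda>y. fst (snd y)"]
      by (simp add: level_map_def lift_act_def sl lattice_shift_def algebra_simps)
    then have "(1 / (2 * pi)) *\<^sub>R (\<Sum>i\<in>UNIV. (t $ i - t' $ i) *\<^sub>R \<eta> i) = k"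
      by (simp add: scaleR_left_diff_distrib sum_subtractf)
    then show ?thesis by (simp add: m_def scaleR_sum_right)
  qed
  then have "(\<Sum>i\<in>facets q. m i *\<^sub>R \<eta> i) = k - (\<Sum>i\<in>- facets q. m i *\<^sub>R \<eta> i)"
    by (simp add: sum_split_facets[of _ q] algebra_simps)
  moreover have "integral_vector (\<Sum>i\<in>- facets q. m i *\<^sub>R \<eta> i)"
    by (intro integral_vector_sum integral_vector_scaleR integral m_free) auto
  ultimately have "integral_vector (\<Sum>i\<in>facets q. m i *\<^sub>R \<eta> i)"
    using k(1) integral_vector_add integral_vector_minus by (metis diff_conv_add_uminus)
  then have "m i \<in> \<int>" for i using m_free adapted_saturated[OF q] by blast
  then have "integral_vector (\<chi> i. m i)" by (simp add: integral_vector_def)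
  moreover have "t = t' + (2 * pi) *\<^sub>R (\<chi> i. m i)" by (simp add: m_def vec_eq_iff)
  ultimately show ?thesis using torus_of_eq_iff_ex by blast
qed

end

section \<open>The zero level and the reduced space\<close>

text \<open>Compactness of the torus in the form used below: representatives can be found in a fixed
  compact box.\<close>

lemma torus_of_cbox: "\<exists>t' \<in> cbox 0 (\<chi> i. 2 * pi). torus_of t' = torus_of (t :: real^'m::finite)"
proof -
  define k :: "real^'m" where "k = (\<chi> i. of_int \<lfloor>t $ i / (2 * pi)\<rfloor>)"
  have k: "integral_vector k" by (simp add: k_def integral_vector_def)
  have "t - (2 * pi) *\<^sub>R k \<in> cbox 0 (\<chi> i. 2 * pi)"
    unfolding mem_box_cart
  proof (intro allI)
    fix i
    define r where "r = t $ i / (2 * pi)"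
    have "(t - (2 * pi) *\<^sub>R k) $ i = (r - of_int \<lfloor>r\<rfloor>) * (2 * pi)"
      by (simp add: k_def left_diff_distrib flip: r_def) (simp add: r_def)
    moreover have "0 \<le> (r - of_int \<lfloor>r\<rfloor>) * (2 * pi)" by (intro mult_nonneg_nonneg) auto
    moreover have "(r - of_int \<lfloor>r\<rfloor>) * (2 * pi) \<le> 1 * (2 * pi)"
      by (intro mult_right_mono) (auto, linarith)
    ultimately show "0 $ i \<le> (t - (2 * pi) *\<^sub>R k) $ i \<and> (t - (2 * pi) *\<^sub>R k) $ i \<le> (\<chi> i. 2 * pi) $ i"
      by simp
  qed
  moreover have "torus_of (t - (2 * pi) *\<^sub>R k) = torus_of t"
    using torus_of_add_lattice[OF k, of "t - (2 * pi) *\<^sub>R k"] by simp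
  ultimately show ?thesis by blast
qed

lemma inj_on_total_proj_ball: "inj_on total_proj (ball (y :: ('n::finite, 'N::finite) total_model) 1)"
proof (rule inj_onI)
  fix u v assume uv: "u \<in> ball y 1" "v \<in> ball y 1" "total_proj u = total_proj v"
  have "fst (snd w) \<in> ball (fst (snd y)) 1" if "w \<in> ball y 1" for w
    using that dist_fst_le[of "snd y" "snd w"] dist_snd_le[of y w] by simp
  then have "fst (snd u) = fst (snd v)"
    using inj_on_torus_of_ball[of "fst (snd y)"] uv by (cases u; cases v) (auto dest: inj_onD)
  then show "u = v" using uv(3) by (cases u; cases v) auto
qed

text \<open>The section of \<open>level_proj\<close> with all orbit angles 0, through which charts
  of the quotient lift to the slice.\<close>

definition level_embed :: "(real^'n::finite) \<times> (real^'n) \<Rightarrow> ('n, 'N::finite) level_model" where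
  "level_embed d = (fst d, snd d, 0)"

lemma level_proj_embed [simp]: "level_proj (level_embed d) = d"
  by (simp add: level_proj_def level_embed_def)

lemma bounded_linear_level_proj: "bounded_linear level_proj"
  unfolding level_proj_def[abs_def]
  by (intro bounded_linear_Pair bounded_linear_fst bounded_linear_compose[OF bounded_linear_fst bounded_linear_snd])

lemma bounded_linear_level_embed: "bounded_linear level_embed"
  unfolding level_embed_def[abs_def]
  by (intro bounded_linear_Pair bounded_linear_fst bounded_linear_snd bounded_linear_zero)

context toric_data
begin

section \<open>Topology of the zero level and of the orbit space\<close>

lemma zero_level_iff: "total_proj y \<in> zero_level U \<eta> \<kappa> \<longleftrightarrow> y \<in> lifted_level"
  by (cases y) (auto simp: zero_level_def lifted_level_def total_moment_def vec_eq_iff power2_norm_eq_inner)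

lemma zero_level_eq: "zero_level U \<eta> \<kappa> = total_proj ` lifted_level"
proof (intro set_eqI iffI)
  fix p assume "p \<in> zero_level U \<eta> \<kappa>"
  moreover obtain y where "total_proj y = p" using total_proj_surj by blast
  ultimately show "p \<in> total_proj ` lifted_level" using zero_level_iff by blast
qed (auto simp: zero_level_iff simp del: total_proj_eq)

lemma zero_level_subset: "zero_level U \<eta> \<kappa> \<subseteq> topspace (total_topology U)"
  by (auto simp: zero_level_def topspace_total)

abbreviation "level_top \<equiv> subtopology (total_topology U) (zero_level U \<eta> \<kappa>)"
abbreviation "red_top \<equiv> reduced_topology U \<eta> \<kappa>"

lemma topspace_level: "topspace level_top = zero_level U \<eta> \<kappa>"
  using zero_level_subset by auto

lemma lifted_level_subset: "lifted_level \<subseteq> U \<times> UNIV"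
  by (auto simp: lifted_level_def)

text \<open>Openness passes from the whole covering to the level because \<open>lifted_level\<close>
  is the full preimage of the zero level.\<close>

lemma level_maps:
  "continuous_map (top_of_set lifted_level) level_top total_proj"
  "open_map (top_of_set lifted_level) level_top total_proj"
proof -
  show "continuous_map (top_of_set lifted_level) level_top total_proj"
    using continuous_map_from_subtopology_mono[OF total_proj_maps(1)[OF open_U] lifted_level_subset]
    by (auto simp: continuous_map_in_subtopology zero_level_iff)
  show "open_map (top_of_set lifted_level) level_top total_proj"
    unfolding open_map_def
  proof (intro allI impI)
    fix W assume "openin (top_of_set lifted_level) W"
    then obtain T where T: "open T" "W = lifted_level \<inter> T" by (auto simp: openin_open)
    have "total_proj ` W = total_proj ` ((U \<times> UNIV) \<inter> T) \<inter> zero_level U \<eta> \<kappa>"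
      using lifted_level_subset zero_level_iff by (auto simp: T(2))
    moreover have "openin (top_of_set (U \<times> UNIV)) ((U \<times> UNIV) \<inter> T)"
      using T(1) by (rule openin_open_Int)
    then have "openin (total_topology U) (total_proj ` ((U \<times> UNIV) \<inter> T))"
      using total_proj_maps(2)[OF open_U] unfolding open_map_def by blast
    ultimately show "openin level_top (total_proj ` W)"
      by (auto simp: openin_subtopology)
  qed
qed

definition orbit_map :: "('n, 'N) total_model \<Rightarrow> ('n, 'N) total_space set" where
  "orbit_map y = orbit \<eta> (total_proj y)"

lemma total_act_torus: "total_act \<eta> (0, torus_of t) (total_proj y) = total_proj (lift_act \<eta> 0 t y)"
  using total_act_proj[where \<eta> = \<eta>, OF integral, of 0 t y] by (simp add: torus_of_0)

lemma orbit_act: "orbit \<eta> (total_act \<eta> (0, t) p) = orbit \<eta> p"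
proof -
  have "total_act \<eta> (0, s) (total_act \<eta> (0, t) p) = total_act \<eta> (0, s + t) p" for s
    using torus_act_add[where \<eta> = \<eta>, OF integral, of "(0, s)" "(0, t)" p] by simp
  then have "orbit \<eta> (total_act \<eta> (0, t) p) = range (\<lambda>s. total_act \<eta> (0, s + t) p)"
    by (simp add: orbit_def)
  also have "\<dots> = (\<lambda>s. total_act \<eta> (0, s) p) ` range (\<lambda>s. s + t)" by (simp only: image_image)
  also have "range (\<lambda>s. s + t) = UNIV" by (metis diff_add_cancel surjI)
  finally show ?thesis by (simp add: orbit_def)
qed

lemma orbit_map_act: "orbit_map (lift_act \<eta> 0 t y) = orbit_map y"
  unfolding orbit_map_def total_act_torus[symmetric] by (rule orbit_act)

lemma orbit_map_level_map: "level_proj e = level_proj e' \<Longrightarrow> orbit_map (level_map q e) = orbit_map (level_map q e')"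
  unfolding level_map_def using slice_cong[of e e' q] by (simp add: orbit_map_act)

text \<open>Bounding the angle by a compact box makes the orbit relation closed and gives sequences
  of angles limit points.\<close>

lemma orbit_map_eq_iff:
  "orbit_map y = orbit_map y' \<longleftrightarrow> (\<exists>t\<in>cbox 0 (\<chi> i. 2 * pi). total_proj y' = total_proj (lift_act \<eta> 0 t y))"
proof
  assume "orbit_map y = orbit_map y'"
  moreover have "total_proj y' \<in> orbit_map y'"
    using torus_act_0[where \<eta> = \<eta>, OF integral, of "total_proj y'"]
    by (auto simp: orbit_map_def orbit_def zero_prod_def intro!: range_eqI[of _ _ 0])
  ultimately obtain t where "total_proj y' = total_act \<eta> (0, t) (total_proj y)"
    by (auto simp: orbit_map_def orbit_def)
  moreover obtain t' where "t' \<in> cbox 0 (\<chi> i. 2 * pi)" "torus_of t' = t"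
    using torus_of_cbox[of "rep_torus t"] by (auto simp: torus_of_rep)
  ultimately show "\<exists>t\<in>cbox 0 (\<chi> i. 2 * pi). total_proj y' = total_proj (lift_act \<eta> 0 t y)"
    using total_act_torus by metis
next
  assume "\<exists>t\<in>cbox 0 (\<chi> i. 2 * pi). total_proj y' = total_proj (lift_act \<eta> 0 t y)"
  then show "orbit_map y = orbit_map y'"
    using orbit_map_act by (metis orbit_map_def)
qed

lemma topspace_red: "topspace red_top = orbit_map ` lifted_level"
  unfolding reduced_topology_def topspace_quotient_topology topspace_level
  by (simp add: zero_level_eq orbit_map_def[abs_def] image_image)

text \<open>The orbits meeting \<open>W\<close> sweep out the union of all translates of
  \<open>W\<close>, each of which is open; hence the orbit map is open.\<close>

lemma red_maps:
  "continuous_map (top_of_set lifted_level) red_top orbit_map"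
  "open_map (top_of_set lifted_level) red_top orbit_map"
proof -
  show "continuous_map (top_of_set lifted_level) red_top orbit_map"
    using continuous_map_compose[OF level_maps(1) quotient_imp_continuous_map[OF quotient_map_quotient_topology]]
    by (simp add: orbit_map_def[abs_def] comp_def reduced_topology_def)
  show "open_map (top_of_set lifted_level) red_top orbit_map"
    unfolding open_map_def
  proof (intro allI impI)
    fix W assume W: "openin (top_of_set lifted_level) W"
    then have sub: "W \<subseteq> lifted_level" using openin_subset by fastforce
    define W' where "W' t = {y \<in> lifted_level. lift_act \<eta> 0 (- t) y \<in> W}" for t
    have W': "openin (top_of_set lifted_level) (W' t)" for t
      unfolding W'_def
      by (rule continuous_openin_preimage[OF _ _ W, of lifted_level, simplified vimage_def Int_def mem_Collect_eq])
        (auto intro!: continuous_intros lift_act_level)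
    have inv: "lift_act \<eta> 0 t (lift_act \<eta> 0 (- t) y) = y" "lift_act \<eta> 0 (- t) (lift_act \<eta> 0 t y) = y" for t y
      using lift_act_add[of \<eta> 0 0 t "- t" y] lift_act_add[of \<eta> 0 0 "- t" t y] by simp_all
    have "{p \<in> topspace level_top. orbit \<eta> p \<in> orbit_map ` W} = (\<Union>t. total_proj ` W' t)"
    proof (intro set_eqI iffI)
      fix p assume "p \<in> {p \<in> topspace level_top. orbit \<eta> p \<in> orbit_map ` W}"
      then obtain y y' where y: "y \<in> lifted_level" "p = total_proj y" "y' \<in> W" "orbit_map y = orbit_map y'"
        unfolding topspace_level zero_level_eq orbit_map_def by auto
      then obtain t where t: "total_proj y = total_proj (lift_act \<eta> 0 t y')"
        using orbit_map_eq_iff by metis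
      then have "lift_act \<eta> 0 t y' \<in> W' t"
        using y sub by (auto simp: W'_def inv intro: lift_act_level)
      then show "p \<in> (\<Union>t. total_proj ` W' t)" using y t by auto
    next
      fix p assume "p \<in> (\<Union>t. total_proj ` W' t)"
      then obtain t y where y: "p = total_proj y" "y \<in> lifted_level" "lift_act \<eta> 0 (- t) y \<in> W"
        by (auto simp: W'_def)
      then have "orbit \<eta> p = orbit_map (lift_act \<eta> 0 (- t) y)"
        by (simp only: orbit_map_act) (simp add: orbit_map_def)
      then show "p \<in> {p \<in> topspace level_top. orbit \<eta> p \<in> orbit_map ` W}"
        using y by (auto simp: topspace_level zero_level_iff simp del: topspace_subtopology)
    qed
    moreover have "openin level_top (\<Union>t. total_proj ` W' t)"
      using level_maps(2) W' unfolding open_map_def by blast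
    moreover have "orbit_map ` W \<subseteq> orbit \<eta> ` topspace level_top"
      using sub unfolding topspace_level by (auto simp: orbit_map_def zero_level_eq simp del: total_proj_eq)
    ultimately show "openin red_top (orbit_map ` W)"
      by (simp add: reduced_topology_def openin_quotient_topology del: topspace_subtopology)
  qed
qed

text \<open>The orbit relation is the projection of a closed set along the compact box of angles,
  and such a projection is closed.\<close>

lemma Hausdorff_space_red: "Hausdorff_space red_top"
proof (rule Hausdorff_space_open_image[OF red_maps(2) topspace_red[symmetric]])
  define T where "T = {(t, y, y'). total_proj y' = total_proj (lift_act \<eta> 0 t (y :: ('n, 'N) total_model))}"
  have "T = (\<lambda>w. (snd (snd w), lift_act \<eta> 0 (fst w) (fst (snd w)))) -`
      {(y, y'). \<exists>k. integral_vector k \<and> y = y' + lattice_shift k}"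
    by (auto simp: T_def total_proj_eq_iff)
  moreover have "closed \<dots>"
    by (intro closed_vimage closed_total_kernel continuous_intros)
  ultimately have "closed T" by simp
  from closed_compact_projection[OF compact_cbox this]
  show "closed {w. \<exists>t. t \<in> cbox 0 (\<chi> i. 2 * pi) \<and> (t, w) \<in> T}" .
  show "orbit_map y = orbit_map y' \<longleftrightarrow> (y, y') \<in> {w. \<exists>t. t \<in> cbox 0 (\<chi> i. 2 * pi) \<and> (t, w) \<in> T}" for y y'
    by (auto simp: orbit_map_eq_iff T_def)
qed

lemma Hausdorff_space_level: "Hausdorff_space level_top"
  using smooth_manifold_total[OF open_U] unfolding smooth_manifold_def by (blast intro: Hausdorff_space_subtopology)

text \<open>Near a point of the image, every point \<open>y\<close> of the level is
  \<open>level_map q (R y)\<close> for the local inverse \<open>R\<close>, and continuity keeps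
  \<open>R y\<close> in \<open>W\<close>.\<close>

lemma openin_level_map_image:
  assumes q: "adapted q" and W: "open W" "W \<subseteq> domain q"
  shows "openin (top_of_set lifted_level) (level_map q ` W)"
proof (subst openin_subopen, intro ballI)
  fix y assume "y \<in> level_map q ` W"
  then obtain e where e: "e \<in> W" "y = level_map q e" by auto
  then have "e \<in> domain q" using W by auto
  obtain R where R: "smooth_at R (level_map q e)" "R (level_map q e) = e"
    "\<forall>\<^sub>F y in nhds (level_map q e). y \<in> lifted_level \<longrightarrow> R y \<in> domain q \<and> level_map q (R y) = y"
    by (rule level_inv_nhds[OF q \<open>e \<in> domain q\<close>])
  have "\<forall>\<^sub>F y in nhds (level_map q e). R y \<in> W"
    by (rule smooth_at_eventually_in[OF R(1) W(1)]) (simp add: R(2) e)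
  with R(3) have "\<forall>\<^sub>F y in nhds (level_map q e). y \<in> lifted_level \<longrightarrow> y \<in> level_map q ` W"
    by eventually_elim (metis imageI)
  then obtain S where S: "open S" "y \<in> S" "\<And>y. y \<in> S \<Longrightarrow> y \<in> lifted_level \<Longrightarrow> y \<in> level_map q ` W"
    unfolding eventually_nhds e(2) by blast
  show "\<exists>T. openin (top_of_set lifted_level) T \<and> y \<in> T \<and> T \<subseteq> level_map q ` W"
    using S level_map_level[OF q \<open>e \<in> domain q\<close>] e(2)
    by (intro exI[of _ "lifted_level \<inter> S"]) (auto simp: openin_open_Int)
qed

section \<open>Charts of the level and of the quotient\<close>

lemma continuous_on_level_map: "V \<subseteq> domain q \<Longrightarrow> continuous_on V (level_map q)"
  by (intro continuous_at_imp_continuous_on ballI smooth_at_isCont smooth_at_level_map) auto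

definition level_atlas :: "(('n, 'N) total_space, ('n, 'N) level_model) chart set" where
  "level_atlas = {((\<lambda>e. total_proj (level_map q e)) ` V, inv_into V (\<lambda>e. total_proj (level_map q e))) | q V.
     adapted q \<and> open V \<and> V \<subseteq> domain q \<and> inj_on (\<lambda>e. total_proj (level_map q e)) V}"

definition red_map :: "('n, 'N) frame \<Rightarrow> (real^'n) \<times> (real^'n) \<Rightarrow> ('n, 'N) total_space set" where
  "red_map q d = orbit_map (level_map q (level_embed d))"

text \<open>The orbit does not see the angles \<open>t\<close>, so \<open>level_embed\<close> may
  fill in 0.\<close>

lemma red_map_level_proj: "red_map q (level_proj e) = orbit_map (level_map q e)"
  unfolding red_map_def by (rule orbit_map_level_map) simp

definition red_domain :: "('n, 'N) frame \<Rightarrow> ((real^'n) \<times> (real^'n)) set" where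
  "red_domain q = level_embed -` domain q"

lemma red_domain_level_proj: "level_proj e \<in> red_domain q \<longleftrightarrow> e \<in> domain q"
  unfolding red_domain_def vimage_eq by (rule domain_cong) simp

definition red_atlas :: "(('n, 'N) total_space set, (real^'n) \<times> (real^'n)) chart set" where
  "red_atlas = {(red_map q ` V, inv_into V (red_map q)) | q V.
     adapted q \<and> open V \<and> V \<subseteq> red_domain q \<and> inj_on (red_map q) V}"

lemma open_red_domain: "open (red_domain q)"
  unfolding red_domain_def
  by (intro open_vimage open_domain linear_continuous_on bounded_linear_level_embed)

lemma chart_param_level:
  assumes q: "adapted q" and V: "open V" "V \<subseteq> domain q" "inj_on (\<lambda>e. total_proj (level_map q e)) V"
  shows "chart_param level_top ((\<lambda>e. total_proj (level_map q e)) ` V, inv_into V (\<lambda>e. total_proj (level_map q e))) V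
    (\<lambda>e. total_proj (level_map q e))"
  unfolding chart_param_def
proof (intro conjI allI impI ballI)
  have "continuous_map (top_of_set V) (top_of_set lifted_level) (level_map q)"
    using V(2) continuous_on_level_map level_map_level[OF q] by auto
  from continuous_map_compose[OF this level_maps(1)]
  show "continuous_map (top_of_set V) level_top (\<lambda>e. total_proj (level_map q e))"
    by (simp add: comp_def)
  fix W assume W: "open W \<and> W \<subseteq> V"
  then have "openin (top_of_set lifted_level) (level_map q ` W)"
    using V by (intro openin_level_map_image[OF q]) auto
  then have "openin level_top (total_proj ` level_map q ` W)"
    using level_maps(2) unfolding open_map_def by blast
  then show "openin level_top ((\<lambda>e. total_proj (level_map q e)) ` W)" by (simp add: image_image)
qed (use V(1) inv_into_f_f[OF V(3)] in auto)

lemma chart_param_red: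
  assumes q: "adapted q" and V: "open V" "V \<subseteq> red_domain q" "inj_on (red_map q) V"
  shows "chart_param red_top (red_map q ` V, inv_into V (red_map q)) V (red_map q)"
  unfolding chart_param_def
proof (intro conjI allI impI ballI)
  have "continuous_on V (\<lambda>d. level_map q (level_embed d))"
    by (rule continuous_on_compose2[OF continuous_on_level_map[OF order_refl]])
      (use V(2) in \<open>auto simp: red_domain_def intro: linear_continuous_on bounded_linear_level_embed\<close>)
  then have "continuous_map (top_of_set V) (top_of_set lifted_level) (\<lambda>d. level_map q (level_embed d))"
    using V(2) level_map_level[OF q] by (auto simp: red_domain_def)
  from continuous_map_compose[OF this red_maps(1)]
  show "continuous_map (top_of_set V) red_top (red_map q)"
    by (simp add: comp_def red_map_def[abs_def])
  fix W assume W: "open W \<and> W \<subseteq> V"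
  \<comment> \<open>Adding all angles to \<open>W\<close> gives an open set in the model of the
    level, to which the openness of \<open>level_map\<close> applies; \<open>orbit_map\<close> is
    open and forgets the angles again.\<close>
  have "openin (top_of_set lifted_level) (level_map q ` (level_proj -` W))"
  proof (rule openin_level_map_image[OF q])
    show "open (level_proj -` W)"
      using W by (intro open_vimage linear_continuous_on bounded_linear_level_proj) auto
    show "level_proj -` W \<subseteq> domain q" using W V(2) red_domain_level_proj by blast
  qed
  then have "openin red_top (orbit_map ` level_map q ` (level_proj -` W))"
    using red_maps(2) unfolding open_map_def by blast
  moreover have "orbit_map ` level_map q ` (level_proj -` W) = red_map q ` W"
  proof -
    have "surj (level_proj :: ('n, 'N) level_model \<Rightarrow> _)" by (metis level_proj_embed surjI)
    then have "level_proj ` ((level_proj :: ('n, 'N) level_model \<Rightarrow> _) -` W) = W"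
      by (simp only: surj_image_vimage_eq)
    note eq = this
    have "orbit_map ` level_map q ` (level_proj -` W) =
        red_map q ` level_proj ` ((level_proj :: ('n, 'N) level_model \<Rightarrow> _) -` W)"
      by (simp only: image_image red_map_level_proj)
    then show ?thesis by (simp only: eq)
  qed
  ultimately show "openin red_top (red_map q ` W)" by simp
qed (use V in auto)

lemma level_atlasE:
  assumes "c \<in> level_atlas"
  obtains q V where "adapted q" "V \<subseteq> domain q" "chart_param level_top c V (\<lambda>e. total_proj (level_map q e))"
  using assms chart_param_level unfolding level_atlas_def by blast

lemma red_atlasE:
  assumes "c \<in> red_atlas"
  obtains q V where "adapted q" "V \<subseteq> red_domain q" "chart_param red_top c V (red_map q)"
  using assms chart_param_red unfolding red_atlas_def by blast

text \<open>Two causes of failure are excluded: \<open>level_map\<close> has a local left inverse,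
  and \<open>total_proj\<close> is injective on unit balls.\<close>

lemma locally_inj_level:
  assumes q: "adapted q" and e: "e \<in> domain q"
  obtains V where "open V" "e \<in> V" "V \<subseteq> domain q" "inj_on (\<lambda>e. total_proj (level_map q e)) V"
proof -
  obtain R where R: "\<forall>\<^sub>F e' in nhds e. R (level_map q e') = e'"
    by (rule level_inv_nhds[OF q e])
  have "\<forall>\<^sub>F e' in nhds e. level_map q e' \<in> ball (level_map q e) 1"
    by (rule smooth_at_eventually_in[OF smooth_at_level_map[OF e]]) auto
  moreover have "\<forall>\<^sub>F e' in nhds e. e' \<in> domain q"
    using e open_domain by (rule eventually_nhds_in_open[rotated])
  ultimately have "\<forall>\<^sub>F e' in nhds e. R (level_map q e') = e' \<and> level_map q e' \<in> ball (level_map q e) 1 \<and> e' \<in> domain q"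
    using R by eventually_elim auto
  then obtain V where V: "open V" "e \<in> V"
    "\<And>e'. e' \<in> V \<Longrightarrow> R (level_map q e') = e' \<and> level_map q e' \<in> ball (level_map q e) 1 \<and> e' \<in> domain q"
    unfolding eventually_nhds by blast
  have "inj_on (\<lambda>e. total_proj (level_map q e)) V"
  proof (rule inj_onI)
    fix x y assume xy: "x \<in> V" "y \<in> V" "total_proj (level_map q x) = total_proj (level_map q y)"
    then have "level_map q x = level_map q y"
      using V(3) inj_on_total_proj_ball by (meson inj_onD)
    then show "x = y" using V(3) xy by metis
  qed
  with V that show thesis by blast
qed

text \<open>The action being free, an element of the torus moving a point of the slice to a nearby point
  of the slice must be close to \<open>0\<close>; compactness of the torus makes this uniform.\<close>

lemma locally_inj_red:
  assumes q: "adapted q" and d: "d \<in> red_domain q"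
  obtains V where "open V" "d \<in> V" "V \<subseteq> red_domain q" "inj_on (red_map q) V"
proof -
  let ?e = "\<lambda>d t. (fst d, snd d, t) :: ('n, 'N) level_model"
  have dom: "?e x t \<in> domain q \<longleftrightarrow> x \<in> red_domain q" for x t
    using red_domain_level_proj[of "?e x t" q] by (simp add: level_proj_def)
  \<comment> \<open>If injectivity failed on all these balls, there would be sequences
    \<open>x n \<noteq> y n\<close> tending to \<open>d\<close> with equal orbits, related by angles
    in the compact box.\<close>
  have "\<exists>n. inj_on (red_map q) (ball d (inverse (real (Suc n))))"
  proof (rule ccontr)
    assume "\<nexists>n. inj_on (red_map q) (ball d (inverse (real (Suc n))))"
    then have "\<forall>n. \<exists>x y. x \<in> ball d (inverse (real (Suc n))) \<and> y \<in> ball d (inverse (real (Suc n))) \<and>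
        x \<noteq> y \<and> red_map q x = red_map q y"
      unfolding inj_on_def by blast
    then obtain x y where xy: "\<And>n. x n \<in> ball d (inverse (real (Suc n)))" "\<And>n. y n \<in> ball d (inverse (real (Suc n)))"
      "\<And>n. x n \<noteq> y n" "\<And>n. red_map q (x n) = red_map q (y n)" by metis
    have lim: "f \<longlonglongrightarrow> d" if "\<And>n. f n \<in> ball d (inverse (real (Suc n)))" for f
    proof (rule metric_LIMSEQ_I)
      fix r :: real assume "r > 0"
      then obtain N where N: "inverse (real (Suc N)) < r" using reals_Archimedean by blast
      have "dist (f n) d < r" if "n \<ge> N" for n
      proof -
        have "dist (f n) d < inverse (real (Suc n))" using \<open>\<And>n. f n \<in> _\<close>[of n] by (simp add: dist_commute)
        also have "\<dots> \<le> inverse (real (Suc N))" using that by (simp add: field_simps)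
        finally show ?thesis using N by simp
      qed
      then show "\<exists>N. \<forall>n\<ge>N. dist (f n) d < r" by blast
    qed
    have "\<exists>t\<in>cbox 0 (\<chi> i. 2 * pi). total_proj (level_map q (?e (y n) 0)) = total_proj (level_map q (?e (x n) t))" for n
    proof -
      have "orbit_map (level_map q (?e (x n) 0)) = orbit_map (level_map q (?e (y n) 0))"
        using xy(4)[of n] by (simp add: red_map_def level_embed_def)
      then obtain t where "t \<in> cbox 0 (\<chi> i. 2 * pi)"
        "total_proj (level_map q (?e (y n) 0)) = total_proj (lift_act \<eta> 0 t (level_map q (?e (x n) 0)))"
        using orbit_map_eq_iff by blast
      moreover have "lift_act \<eta> 0 t (level_map q (?e (x n) 0)) = level_map q (?e (x n) t)"
        using slice_cong[of "?e (x n) 0" "?e (x n) t" q] by (simp add: level_map_def level_proj_def)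
      ultimately show ?thesis by auto
    qed
    then obtain t where t: "\<And>n. t n \<in> cbox 0 (\<chi> i. 2 * pi)"
      "\<And>n. total_proj (level_map q (?e (y n) 0)) = total_proj (level_map q (?e (x n) (t n)))" by metis
    \<comment> \<open>A limit \<open>t0\<close> of a subsequence of the angles relates the limit
      point to itself, so freeness makes \<open>t0\<close> a period.\<close>
    obtain t0 r where r: "strict_mono r" "(t \<circ> r) \<longlonglongrightarrow> t0"
      using compact_def[THEN iffD1, OF compact_cbox, rule_format, of t, OF t(1)] by blast
    have xr: "(\<lambda>n. x (r n)) \<longlonglongrightarrow> d" and yr: "(\<lambda>n. y (r n)) \<longlonglongrightarrow> d"
      using LIMSEQ_subseq_LIMSEQ[OF lim r(1)] xy(1,2) by (auto simp: comp_def)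
    have tr: "(\<lambda>n. t (r n)) \<longlonglongrightarrow> t0" using r(2) by (simp add: comp_def)
    have cont: "isCont (level_map q) (?e d s)" for s
      using dom d by (intro smooth_at_isCont smooth_at_level_map) auto
    have lim2: "(\<lambda>n. (level_map q (?e (y (r n)) 0), level_map q (?e (x (r n)) (t (r n))))) \<longlonglongrightarrow>
        (level_map q (?e d 0), level_map q (?e d t0))"
      by (intro tendsto_Pair isCont_tendsto_compose[OF cont] tendsto_fst tendsto_snd tendsto_const xr yr tr)
    have mem: "(level_map q (?e (y (r n)) 0), level_map q (?e (x (r n)) (t (r n)))) \<in>
        {(y, y'). \<exists>k. integral_vector k \<and> y = y' + lattice_shift k}" for n
      using t(2)[of "r n"] by (simp add: total_proj_eq_iff)
    have "(level_map q (?e d 0), level_map q (?e d t0)) \<in>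
        {(y, y'). \<exists>k. integral_vector k \<and> y = y' + lattice_shift k}"
      by (rule closed_sequentially[OF closed_total_kernel mem lim2])
    then have "total_proj (level_map q (?e d 0)) = total_proj (level_map q (?e d t0))"
      by (simp add: total_proj_eq_iff)
    then have t0: "torus_of t0 = torus_of 0"
      using stabilizer_trivial[OF q, of "fst d" "snd d" 0 t0] dom[of d 0] d by simp
    then obtain k where k: "integral_vector k" "t0 = (2 * pi) *\<^sub>R k"
      using torus_of_eq_iff_ex[of t0 0] by auto
    have "torus_of (s - t0) = torus_of s" for s
      using torus_of_add_lattice[OF k(1), of "s - t0"] k(2) by simp
    \<comment> \<open>Subtracting the period \<open>t0\<close> leaves the projected points unchanged
      and moves the angles towards 0, into the range where the parametrization of the level is
      injective.\<close>
    then have shift: "total_proj (level_map q (?e z (s - t0))) = total_proj (level_map q (?e z s))" for z s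
      using slice_cong[of "?e z s" "?e z (s - t0)" q]
      by (simp add: level_map_def level_proj_def flip: total_act_torus)
    obtain V where V: "open V" "?e d 0 \<in> V" "inj_on (\<lambda>e. total_proj (level_map q e)) V"
      by (rule locally_inj_level[OF q iffD2[OF dom d], of 0])
    have "(\<lambda>n. ?e (x (r n)) (t (r n) - t0)) \<longlonglongrightarrow> ?e d (t0 - t0)"
      by (intro tendsto_Pair tendsto_diff tendsto_fst tendsto_snd tendsto_const xr tr)
    then have ev1: "\<forall>\<^sub>F n in sequentially. ?e (x (r n)) (t (r n) - t0) \<in> V"
      using V by (intro topological_tendstoD[where S = V]) auto
    have "(\<lambda>n. ?e (y (r n)) 0) \<longlonglongrightarrow> ?e d 0"
      by (intro tendsto_Pair tendsto_fst tendsto_snd tendsto_const yr)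
    then have ev2: "\<forall>\<^sub>F n in sequentially. ?e (y (r n)) 0 \<in> V"
      using V by (intro topological_tendstoD[where S = V]) auto
    from eventually_conj[OF ev1 ev2] obtain n where n: "?e (x (r n)) (t (r n) - t0) \<in> V" "?e (y (r n)) 0 \<in> V"
      using eventually_happens by fastforce
    have "total_proj (level_map q (?e (x (r n)) (t (r n) - t0))) = total_proj (level_map q (?e (y (r n)) 0))"
      by (simp only: shift t(2))
    then have "?e (x (r n)) (t (r n) - t0) = ?e (y (r n)) 0"
      using V(3) n by (meson inj_onD)
    then have "x (r n) = y (r n)" by (simp add: prod_eq_iff)
    then show False using xy(3) by blast
  qed
  then obtain n where "inj_on (red_map q) (ball d (inverse (real (Suc n))))" by blast
  then have "inj_on (red_map q) (ball d (inverse (real (Suc n))) \<inter> red_domain q)"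
    by (rule inj_on_subset) auto
  moreover have "open (ball d (inverse (real (Suc n))) \<inter> red_domain q)" by (intro open_Int open_ball open_red_domain)
  ultimately show thesis
    using d by (intro that[of "ball d (inverse (real (Suc n))) \<inter> red_domain q"]) auto
qed

lemma param_atlas_level: "param_atlas level_top level_atlas"
  unfolding param_atlas_def
proof (intro conjI ballI)
  have "\<exists>c\<in>level_atlas. p \<in> fst c" if p: "p \<in> zero_level U \<eta> \<kappa>" for p
  proof -
    obtain y where y: "y \<in> lifted_level" "p = total_proj y" using p by (auto simp: zero_level_eq simp del: total_proj_eq)
    obtain q e where qe: "adapted q" "e \<in> domain q" "level_map q e = y" by (rule exists_level_param[OF y(1)])
    obtain V where V: "open V" "e \<in> V" "V \<subseteq> domain q" "inj_on (\<lambda>e. total_proj (level_map q e)) V"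
      by (rule locally_inj_level[OF qe(1,2)])
    have "((\<lambda>e. total_proj (level_map q e)) ` V, inv_into V (\<lambda>e. total_proj (level_map q e))) \<in> level_atlas"
      using qe(1) V unfolding level_atlas_def by blast
    moreover have "p \<in> (\<lambda>e. total_proj (level_map q e)) ` V" using V(2) y(2) qe(3) by blast
    ultimately show ?thesis by (metis fst_conv)
  qed
  moreover have "fst c \<subseteq> zero_level U \<eta> \<kappa>" if c: "c \<in> level_atlas" for c
  proof -
    obtain q V where "adapted q" "V \<subseteq> domain q" "fst c = (\<lambda>e. total_proj (level_map q e)) ` V"
      using c by (auto simp: level_atlas_def)
    then show ?thesis using level_map_level[of q] by (auto simp: zero_level_iff simp del: total_proj_eq)
  qed
  ultimately show "(\<Union>c\<in>level_atlas. fst c) = topspace level_top"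
    unfolding topspace_level by blast
  show "\<exists>D \<phi>. chart_param level_top c D \<phi>" if "c \<in> level_atlas" for c
    using level_atlasE[OF that] by metis
qed

lemma param_atlas_red: "param_atlas red_top red_atlas"
  unfolding param_atlas_def
proof (intro conjI ballI)
  have "\<exists>c\<in>red_atlas. p \<in> fst c" if p: "p \<in> topspace red_top" for p
  proof -
    obtain y where y: "y \<in> lifted_level" "p = orbit_map y" using p by (auto simp: topspace_red)
    obtain q e where qe: "adapted q" "e \<in> domain q" "level_map q e = y" by (rule exists_level_param[OF y(1)])
    have "level_proj e \<in> red_domain q" using qe(2) red_domain_level_proj by blast
    then obtain V where V: "open V" "level_proj e \<in> V" "V \<subseteq> red_domain q" "inj_on (red_map q) V"
      by (rule locally_inj_red[OF qe(1)])
    have "(red_map q ` V, inv_into V (red_map q)) \<in> red_atlas"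
      using qe(1) V unfolding red_atlas_def by blast
    moreover have "p \<in> red_map q ` V"
      using V(2) y(2) qe(3) red_map_level_proj[of q e] by (metis imageI)
    ultimately show ?thesis by (metis fst_conv)
  qed
  moreover have "fst c \<subseteq> topspace red_top" if "c \<in> red_atlas" for c
    using that level_map_level by (fastforce simp: red_atlas_def topspace_red red_map_def red_domain_def)
  ultimately show "(\<Union>c\<in>red_atlas. fst c) = topspace red_top" by blast
  show "\<exists>D \<phi>. chart_param red_top c D \<phi>" if "c \<in> red_atlas" for c
    using red_atlasE[OF that] by metis
qed

text \<open>A deck transformation moves the lift \<open>F\<close> to the sheet of the chart, and
  \<open>level_lift\<close> then writes it in coordinates.\<close>

lemma local_lift_level:
  assumes c: "chart_param X c D \<phi>" and d: "d \<in> level_atlas" and p: "p \<in> fst c" "f p \<in> fst d"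
    and F: "smooth_at F (snd c p)"
    and ev: "\<forall>\<^sub>F y in nhds (snd c p). F y \<in> lifted_level \<and> f (\<phi> y) = total_proj (F y)"
  obtains g where "local_lift X c level_top d f (snd c p) g"
proof -
  obtain q V where qV: "adapted q" "V \<subseteq> domain q" and ch: "chart_param level_top d V (\<lambda>e. total_proj (level_map q e))"
    by (rule level_atlasE[OF d])
  note p1 = chart_param_mem[OF c p(1)] and p2 = chart_param_mem[OF ch p(2)]
  have "total_proj (level_map q (snd d (f p))) = total_proj (F (snd c p))"
    using eventually_nhds_x_imp_x[OF ev] p1 p2 by simp
  then obtain k where k: "integral_vector k" "F (snd c p) + lattice_shift k = level_map q (snd d (f p))"
    using total_proj_eq_iff by metis
  have e: "snd d (f p) \<in> domain q" using p2 qV by auto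
  have "\<forall>\<^sub>F y in nhds (snd c p). F y + lattice_shift k \<in> lifted_level"
    using ev by eventually_elim (metis k(1) total_proj_shift zero_level_iff)
  with qV(1) e _ k(2) obtain G where G: "smooth_at G (snd c p)" "G (snd c p) = snd d (f p)"
    "\<forall>\<^sub>F y in nhds (snd c p). G y \<in> domain q \<and> level_map q (G y) = F y + lattice_shift k"
    by (rule level_lift[where h = "\<lambda>y. F y + lattice_shift k"]) (intro smooth_intros F)
  have "local_lift X c level_top d f (snd c p) G"
  proof (rule local_liftI[OF c ch _ _ G(1)])
    show "\<forall>\<^sub>F y in nhds (snd c p). f (\<phi> y) = total_proj (level_map q (G y))"
      using ev G(3) by eventually_elim (simp add: k(1))
  qed (use p1 p2 G(2) in auto)
  then show thesis by (rule that)
qed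

text \<open>Besides the sheet, an angle \<open>t\<close> has to be matched: the value of the lift
  lies on the right orbit but perhaps off the slice. The angle is stored in \<open>e\<close> and
  forgotten by \<open>level_proj\<close>. The second conclusion makes different charts agree on the
  reduced form.\<close>

lemma local_lift_red:
  assumes c: "chart_param X c D \<phi>" and d: "d \<in> red_atlas" and p: "p \<in> fst c" "f p \<in> fst d"
    and F: "smooth_at F (snd c p)"
    and ev: "\<forall>\<^sub>F y in nhds (snd c p). F y \<in> lifted_level \<and> f (\<phi> y) = orbit_map (F y)"
  obtains g where "local_lift X c red_top d f (snd c p) g"
    "\<And>c' p' u v. total_form c' p' (frechet_derivative F (at (snd c p)) u) (frechet_derivative F (at (snd c p)) v) =
       red_form (frechet_derivative g (at (snd c p)) u) (frechet_derivative g (at (snd c p)) v)"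
proof -
  obtain q V where qV: "adapted q" "V \<subseteq> red_domain q" and ch: "chart_param red_top d V (red_map q)"
    by (rule red_atlasE[OF d])
  note p1 = chart_param_mem[OF c p(1)] and p2 = chart_param_mem[OF ch p(2)]
  define b where "b = snd d (f p)"
  have "orbit_map (level_map q (level_embed b)) = orbit_map (F (snd c p))"
    using eventually_nhds_x_imp_x[OF ev] p1 p2 by (simp add: b_def red_map_def)
  then obtain t where "total_proj (F (snd c p)) = total_proj (lift_act \<eta> 0 t (level_map q (level_embed b)))"
    using orbit_map_eq_iff by blast
  moreover define e where "e = (fst b, snd b, t)"
  have be: "level_proj e = b" by (simp add: e_def level_proj_def)
  have "lift_act \<eta> 0 t (level_map q (level_embed b)) = level_map q e"
    using slice_cong[of "level_embed b" e q] be by (simp add: level_map_def) (simp add: level_embed_def e_def)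
  ultimately have "total_proj (F (snd c p)) = total_proj (level_map q e)" by simp
  then obtain k where k: "integral_vector k" "F (snd c p) + lattice_shift k = level_map q e"
    using total_proj_eq_iff by metis
  have e: "e \<in> domain q" using p2 qV be red_domain_level_proj[of e q] by (auto simp: b_def)
  have "\<forall>\<^sub>F y in nhds (snd c p). F y + lattice_shift k \<in> lifted_level"
    using ev by eventually_elim (metis k(1) total_proj_shift zero_level_iff)
  with qV(1) e _ k(2) obtain G where G: "smooth_at G (snd c p)" "G (snd c p) = e"
    "\<forall>\<^sub>F y in nhds (snd c p). G y \<in> domain q \<and> level_map q (G y) = F y + lattice_shift k"
    "\<And>c' p' u v. total_form c' p' (frechet_derivative (\<lambda>y. F y + lattice_shift k) (at (snd c p)) u)
        (frechet_derivative (\<lambda>y. F y + lattice_shift k) (at (snd c p)) v) =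
       red_form (level_proj (frechet_derivative G (at (snd c p)) u)) (level_proj (frechet_derivative G (at (snd c p)) v))"
    by (rule level_lift[where h = "\<lambda>y. F y + lattice_shift k"]) (intro smooth_intros F, rule that, assumption+)
  have D: "frechet_derivative (\<lambda>y. level_proj (G y)) (at (snd c p)) = (\<lambda>u. level_proj (frechet_derivative G (at (snd c p)) u))"
    by (rule frechet_derivative_at[symmetric])
      (rule bounded_linear.has_derivative[OF bounded_linear_level_proj smooth_at_has_derivative[OF G(1)]])
  have "local_lift X c red_top d f (snd c p) (\<lambda>y. level_proj (G y))"
  proof (rule local_liftI[OF c ch _ _ smooth_at_linear[OF bounded_linear_level_proj G(1)]])
    have sh: "orbit_map (F y + lattice_shift k) = orbit_map (F y)" for y
      by (simp add: orbit_map_def k(1))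
    show "\<forall>\<^sub>F y in nhds (snd c p). f (\<phi> y) = red_map q (level_proj (G y))"
      using ev G(3) by eventually_elim (simp add: red_map_level_proj sh)
  qed (use p1 p2 G(2) be in \<open>auto simp: b_def\<close>)
  then show thesis
    by (rule that) (use G(4) in \<open>simp add: D frechet_derivative_add_const smooth_at_differentiable[OF F]\<close>)
qed

end

section \<open>Manifold structures, the submersion and the reduced form\<close>

lemma bilinear_red_form: "bilinear red_form"
  unfolding bilinear_def linear_iff red_form_def by (auto simp: inner_simps algebra_simps)

lemma red_form_antisym: "red_form u v = - red_form v u"
  by (simp add: red_form_def)

lemma red_form_nondegenerate:
  assumes "\<And>v. red_form u v = 0"
  shows "u = 0"
  using assms[of "(0, fst u)"] assms[of "(snd u, 0)"]
  by (simp add: red_form_def prod_eq_iff inner_commute)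

context toric_data
begin

lemma level_chart:
  assumes "c \<in> level_atlas" "p \<in> fst c"
  obtains q V where "adapted q" "snd c p \<in> domain q"
    "chart_param level_top c V (\<lambda>e. total_proj (level_map q e))"
    "smooth_at (level_map q) (snd c p)" "\<forall>\<^sub>F e in nhds (snd c p). level_map q e \<in> lifted_level"
proof -
  obtain q V where q: "adapted q" "V \<subseteq> domain q" and c: "chart_param level_top c V (\<lambda>e. total_proj (level_map q e))"
    by (rule level_atlasE[OF assms(1)])
  have "\<forall>\<^sub>F e in nhds (snd c p). e \<in> V"
    using chart_param_open[OF c] chart_param_mem[OF c assms(2)] by (auto intro: eventually_nhds_in_open)
  then have "\<forall>\<^sub>F e in nhds (snd c p). level_map q e \<in> lifted_level"
    by eventually_elim (use q level_map_level in auto)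
  moreover have "snd c p \<in> domain q" using chart_param_mem[OF c assms(2)] q by auto
  ultimately show thesis using that q(1) c smooth_at_level_map by blast
qed

lemma smooth_manifold_level: "smooth_manifold level_top level_atlas"
  unfolding smooth_manifold_def
proof (intro conjI)
  show "Hausdorff_space level_top" by (rule Hausdorff_space_level)
  show "second_countable_space level_top"
    by (rule second_countable_space_open_image[OF level_maps]) (simp only: topspace_level, rule zero_level_eq[symmetric])
  show "smooth_atlas level_top level_atlas"
  proof (rule smooth_atlasI[OF param_atlas_level])
    fix c d p
    assume *: "c \<in> level_atlas" "d \<in> level_atlas" "p \<in> fst c" "p \<in> fst d"
    obtain q V where c: "chart_param level_top c V (\<lambda>e. total_proj (level_map q e))"
      and sm: "smooth_at (level_map q) (snd c p)" and ev: "\<forall>\<^sub>F e in nhds (snd c p). level_map q e \<in> lifted_level"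
      by (rule level_chart[OF *(1,3)])
    from ev have "\<forall>\<^sub>F e in nhds (snd c p). level_map q e \<in> lifted_level \<and> total_proj (level_map q e) = total_proj (level_map q e)"
      by simp
    with sm show "\<exists>g. local_lift level_top c level_top d (\<lambda>p. p) (snd c p) g"
      using local_lift_level[where f = "\<lambda>p. p", OF c *(2,3,4)] by blast
  qed
qed

text \<open>Over a chart of the quotient, \<open>level_map q\<close> after
  \<open>level_embed\<close> lifts the chart to the level. Maps on the quotient become maps into the
  level through it, and the given form pulls back to the standard one.\<close>

lemma red_chart:
  assumes "c \<in> red_atlas" "p \<in> fst c"
  obtains q V where "adapted q" "level_embed (snd c p) \<in> domain q" "V \<subseteq> red_domain q"
    "chart_param red_top c V (red_map q)"
    "smooth_at (\<lambda>d. level_map q (level_embed d)) (snd c p)"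
    "\<forall>\<^sub>F d in nhds (snd c p). level_map q (level_embed d) \<in> lifted_level"
    "\<And>c' p' u v. total_form c' p' (frechet_derivative (\<lambda>d. level_map q (level_embed d)) (at (snd c p)) u)
      (frechet_derivative (\<lambda>d. level_map q (level_embed d)) (at (snd c p)) v) = red_form u v"
proof -
  obtain q V where q: "adapted q" "V \<subseteq> red_domain q" and c: "chart_param red_top c V (red_map q)"
    by (rule red_atlasE[OF assms(1)])
  have "\<forall>\<^sub>F d in nhds (snd c p). d \<in> V"
    using chart_param_open[OF c] chart_param_mem[OF c assms(2)] by (auto intro: eventually_nhds_in_open)
  then have ev: "\<forall>\<^sub>F d in nhds (snd c p). level_map q (level_embed d) \<in> lifted_level"
    by eventually_elim (use q level_map_level in \<open>auto simp: red_domain_def\<close>)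
  have dom: "level_embed (snd c p) \<in> domain q"
    using chart_param_mem[OF c assms(2)] q by (auto simp: red_domain_def)
  have sm: "smooth_at (\<lambda>d. level_map q (level_embed d)) (snd c p)"
    by (rule smooth_at_compose[OF smooth_at_linear[OF bounded_linear_level_embed smooth_at_ident] smooth_at_level_map[OF dom]])
  have "frechet_derivative (\<lambda>d. level_map q (level_embed d)) (at (snd c p)) =
      (\<lambda>u. frechet_derivative (level_map q) (at (level_embed (snd c p))) (level_embed u))"
    by (rule frechet_derivative_at[symmetric], rule has_derivative_compose)
      (rule bounded_linear_imp_has_derivative[OF bounded_linear_level_embed],
        rule smooth_at_has_derivative[OF smooth_at_level_map[OF dom]])
  then have "total_form c' p' (frechet_derivative (\<lambda>d. level_map q (level_embed d)) (at (snd c p)) u)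
      (frechet_derivative (\<lambda>d. level_map q (level_embed d)) (at (snd c p)) v) = red_form u v" for c' p' u v
    by (simp add: total_form_level_map[OF q(1) dom])
  with q(1) dom q(2) c sm ev show thesis by (rule that)
qed

text \<open>By the chain rule, the derivative of the local left inverse is a left inverse of the
  derivative.\<close>

lemma inj_level_map_deriv:
  assumes q: "adapted q" and e: "e \<in> domain q"
  shows "inj (frechet_derivative (level_map q) (at e))"
proof -
  obtain R where R: "smooth_at R (level_map q e)" "\<forall>\<^sub>F e' in nhds e. R (level_map q e') = e'"
    by (rule level_inv_nhds[OF q e])
  have "((\<lambda>e. R (level_map q e)) has_derivative
      (\<lambda>u. frechet_derivative R (at (level_map q e)) (frechet_derivative (level_map q) (at e) u))) (at e)"
    by (rule has_derivative_compose[OF smooth_at_has_derivative[OF smooth_at_level_map[OF e]] smooth_at_has_derivative[OF R(1)]])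
  from has_derivative_unique_eventually[OF this has_derivative_ident R(2)] show ?thesis
    by (metis inj_def)
qed

lemma embedded_submanifold_level: "embedded_submanifold (total_topology U) (total_atlas U) (zero_level U \<eta> \<kappa>) level_atlas"
  unfolding embedded_submanifold_def immersion_def
proof (intro conjI ballI)
  show "zero_level U \<eta> \<kappa> \<subseteq> topspace (total_topology U)" by (rule zero_level_subset)
  show "smooth_manifold level_top level_atlas" by (rule smooth_manifold_level)
  have lift: "\<exists>g. local_lift level_top c (total_topology U) d (\<lambda>p. p) (snd c p) g \<and> inj (frechet_derivative g (at (snd c p)))"
    if *: "c \<in> level_atlas" "d \<in> total_atlas U" "p \<in> fst c" "p \<in> fst d" for c d p
  proof -
    obtain q V where q: "adapted q" "snd c p \<in> domain q" and c: "chart_param level_top c V (\<lambda>e. total_proj (level_map q e))"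
      and sm: "smooth_at (level_map q) (snd c p)"
      by (rule level_chart[OF *(1,3)])
    obtain k where "local_lift level_top c (total_topology U) d (\<lambda>p. p) (snd c p) (\<lambda>e. level_map q e + lattice_shift k)"
      using local_lift_total[where f = "\<lambda>p. p", OF open_U c *(2-4) sm] by auto
    moreover have "inj (frechet_derivative (\<lambda>e. level_map q e + lattice_shift k) (at (snd c p)))"
      unfolding frechet_derivative_add_const[OF smooth_at_differentiable[OF sm]] by (rule inj_level_map_deriv[OF q])
    ultimately show ?thesis by blast
  qed
  show "smooth_map level_top level_atlas (total_topology U) (total_atlas U) (\<lambda>p. p)"
  proof (rule smooth_mapI[OF param_atlas_level param_atlas_total[OF open_U]])
    show "\<exists>g. local_lift level_top c (total_topology U) d (\<lambda>p. p) (snd c p) g"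
      if "c \<in> level_atlas" "d \<in> total_atlas U" "p \<in> fst c" "p \<in> fst d" for c d p
      using lift[OF that] by blast
  qed simp
  fix c d p assume "c \<in> level_atlas" "d \<in> total_atlas U" "p \<in> fst c \<inter> (\<lambda>p. p) -` fst d"
  then obtain g where "local_lift level_top c (total_topology U) d (\<lambda>p. p) (snd c p) g" "inj (frechet_derivative g (at (snd c p)))"
    using lift[of c d p] by auto
  then show "inj (coord_deriv (\<lambda>p. p) c d (snd c p))" by (simp add: local_lift_deriv)
qed

text \<open>\<open>level_map\<close> itself lifts the orbit map; evaluating the given form on its
  derivative in two ways shows what the coordinate representation does to
  \<open>red_form\<close>.\<close>

lemma orbit_lift:
  assumes "c \<in> level_atlas" "d \<in> red_atlas" "p \<in> fst c" "orbit \<eta> p \<in> fst d"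
  obtains g where "local_lift level_top c red_top d (orbit \<eta>) (snd c p) g"
    "\<And>u v. red_form (frechet_derivative g (at (snd c p)) u) (frechet_derivative g (at (snd c p)) v) =
       red_form (level_proj u) (level_proj v)"
proof -
  obtain q V where q: "adapted q" "snd c p \<in> domain q" and c: "chart_param level_top c V (\<lambda>e. total_proj (level_map q e))"
    and sm: "smooth_at (level_map q) (snd c p)" and ev: "\<forall>\<^sub>F e in nhds (snd c p). level_map q e \<in> lifted_level"
    by (rule level_chart[OF assms(1,3)])
  have "\<forall>\<^sub>F e in nhds (snd c p). level_map q e \<in> lifted_level \<and> orbit \<eta> (total_proj (level_map q e)) = orbit_map (level_map q e)"
    using ev by eventually_elim (simp add: orbit_map_def)
  then obtain g where "local_lift level_top c red_top d (orbit \<eta>) (snd c p) g"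
    "\<And>c' p' u v. total_form c' p' (frechet_derivative (level_map q) (at (snd c p)) u)
        (frechet_derivative (level_map q) (at (snd c p)) v) =
       red_form (frechet_derivative g (at (snd c p)) u) (frechet_derivative g (at (snd c p)) v)"
    by (rule local_lift_red[where f = "orbit \<eta>", OF c assms(2-4) sm]) (rule that, assumption+)
  then show thesis by (intro that) (simp_all add: total_form_level_map[OF q])
qed

text \<open>The differential of the orbit map is onto because it intertwines the forms and the reduced
  form is nondegenerate.\<close>

lemma submersion_orbit: "submersion level_top level_atlas red_top red_atlas (orbit \<eta>)"
  unfolding submersion_def
proof (intro conjI ballI)
  show "smooth_map level_top level_atlas red_top red_atlas (orbit \<eta>)"
  proof (rule smooth_mapI[OF param_atlas_level param_atlas_red])
    show "orbit \<eta> ` topspace level_top \<subseteq> topspace red_top"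
      by (simp add: reduced_topology_def topspace_quotient_topology)
    fix c d p
    assume "c \<in> level_atlas" "d \<in> red_atlas" "p \<in> fst c" "orbit \<eta> p \<in> fst d"
    then show "\<exists>g. local_lift level_top c red_top d (orbit \<eta>) (snd c p) g"
      by (rule orbit_lift) blast
  qed
  fix c d p assume *: "c \<in> level_atlas" "d \<in> red_atlas" "p \<in> fst c \<inter> orbit \<eta> -` fst d"
  obtain g where g: "local_lift level_top c red_top d (orbit \<eta>) (snd c p) g"
    "\<And>u v. red_form (frechet_derivative g (at (snd c p)) u) (frechet_derivative g (at (snd c p)) v) =
       red_form (level_proj u) (level_proj v)"
    using orbit_lift[OF *(1,2), of p] *(3) by blast
  define D where "D = frechet_derivative g (at (snd c p))"
  have "linear D"
    using g(1) smooth_at_has_derivative has_derivative_linear unfolding local_lift_def D_def by blast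
  then have lin: "linear (\<lambda>w. D (level_embed w))"
    using linear_compose[OF bounded_linear.linear[OF bounded_linear_level_embed]] by (simp add: comp_def)
  moreover have "inj (\<lambda>w. D (level_embed w))"
  proof (subst linear_injective_0[OF lin], intro allI impI)
    fix w assume "D (level_embed w) = 0"
    then have "red_form (D (level_embed w)) (D (level_embed v)) = 0" for v
      by (simp add: red_form_def)
    then have "red_form w v = 0" for v by (simp add: D_def g(2))
    then show "w = 0" by (rule red_form_nondegenerate)
  qed
  \<comment> \<open>The slice directions and the model of the quotient have the same dimension, so
    injectivity is enough.\<close>
  ultimately have "surj (\<lambda>w. D (level_embed w))" by (rule linear_injective_imp_surjective) simp
  then have "surj D" unfolding surj_def by metis
  then show "surj (coord_deriv (orbit \<eta>) c d (snd c p))"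
    by (simp add: local_lift_deriv[OF g(1)] D_def)
qed

lemma is_pullback_level:
  "is_pullback level_atlas (total_atlas U) (\<lambda>p. p) total_form (\<lambda>_ _ u v. red_form (level_proj u) (level_proj v))"
proof (rule is_pullbackI)
  fix c d p assume *: "c \<in> level_atlas" "d \<in> total_atlas U" "p \<in> fst c" "p \<in> fst d"
  obtain q V where q: "adapted q" "snd c p \<in> domain q" and c: "chart_param level_top c V (\<lambda>e. total_proj (level_map q e))"
    and sm: "smooth_at (level_map q) (snd c p)"
    by (rule level_chart[OF *(1,3)])
  obtain k where "local_lift level_top c (total_topology U) d (\<lambda>p. p) (snd c p) (\<lambda>e. level_map q e + lattice_shift k)"
    using local_lift_total[where f = "\<lambda>p. p", OF open_U c *(2-4) sm] by auto
  then show "\<exists>g. local_lift level_top c (total_topology U) d (\<lambda>p. p) (snd c p) g \<and>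
    (\<forall>u v. red_form (level_proj u) (level_proj v) =
      total_form d (g (snd c p)) (frechet_derivative g (at (snd c p)) u) (frechet_derivative g (at (snd c p)) v))"
    by (intro exI[of _ "\<lambda>e. level_map q e + lattice_shift k"])
      (simp add: frechet_derivative_add_const[OF smooth_at_differentiable[OF sm]] total_form_level_map[OF q])
qed

lemma is_pullback_orbit:
  "is_pullback level_atlas red_atlas (orbit \<eta>) (\<lambda>_ _. red_form) (\<lambda>_ _ u v. red_form (level_proj u) (level_proj v))"
proof (rule is_pullbackI)
  fix c d p
  assume "c \<in> level_atlas" "d \<in> red_atlas" "p \<in> fst c" "orbit \<eta> p \<in> fst d"
  then show "\<exists>g. local_lift level_top c red_top d (orbit \<eta>) (snd c p) g \<and>
    (\<forall>u v. red_form (level_proj u) (level_proj v) =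
      red_form (frechet_derivative g (at (snd c p)) u) (frechet_derivative g (at (snd c p)) v))"
    by (rule orbit_lift) metis
qed

section \<open>The induced torus action\<close>

definition red_act :: "'n torus \<Rightarrow> ('n, 'N) total_space set \<Rightarrow> ('n, 'N) total_space set" where
  "red_act s orb = total_act \<eta> (s, 0) ` orb"

lemma red_act_orbit: "red_act s (orbit \<eta> p) = orbit \<eta> (total_act \<eta> (s, 0) p)"
proof -
  have "total_act \<eta> (s, 0) (total_act \<eta> (0, t) p) = total_act \<eta> (0, t) (total_act \<eta> (s, 0) p)" for t
    using torus_act_add[where \<eta> = \<eta>, OF integral, of "(s, 0)" "(0, t)" p]
      torus_act_add[where \<eta> = \<eta>, OF integral, of "(0, t)" "(s, 0)" p] by simp
  then show ?thesis by (simp add: red_act_def orbit_def image_image)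
qed

lemma red_act_orbit_map: "red_act (torus_of s) (orbit_map y) = orbit_map (lift_act \<eta> s 0 y)"
  using total_act_proj[where \<eta> = \<eta>, OF integral, of s 0 y]
  by (simp add: orbit_map_def red_act_orbit torus_of_0 del: total_proj_eq)

lemma red_act_in:
  assumes "p \<in> topspace red_top"
  shows "red_act s p \<in> topspace red_top"
proof -
  obtain y where "y \<in> lifted_level" "p = orbit_map y" using assms by (auto simp: topspace_red)
  then show ?thesis
    using red_act_orbit_map[of "rep_torus s" y] lift_act_level[of y]
    by (simp add: topspace_red torus_of_rep)
qed

text \<open>With \<open>\<sigma> = 0\<close> and \<open>f\<close> the identity this is a change of
  charts; other \<open>\<sigma>\<close> give the induced action. In both cases the lift is only
  translated in the angles, so its derivative and the value of the form do not change.\<close>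

lemma red_lift:
  assumes c: "c \<in> red_atlas" and d: "d \<in> red_atlas" and p: "p \<in> fst c" "f p \<in> fst d"
    and f: "\<And>y. f (orbit_map y) = orbit_map (lift_act \<eta> \<sigma> 0 y)"
  obtains g where "local_lift red_top c red_top d f (snd c p) g"
    "\<And>u v. red_form (frechet_derivative g (at (snd c p)) u) (frechet_derivative g (at (snd c p)) v) = red_form u v"
proof -
  obtain q V where ch: "chart_param red_top c V (red_map q)"
    and sm: "smooth_at (\<lambda>d. level_map q (level_embed d)) (snd c p)"
    and ev: "\<forall>\<^sub>F d in nhds (snd c p). level_map q (level_embed d) \<in> lifted_level"
    and fm: "\<And>c' p' u v. total_form c' p' (frechet_derivative (\<lambda>d. level_map q (level_embed d)) (at (snd c p)) u)
      (frechet_derivative (\<lambda>d. level_map q (level_embed d)) (at (snd c p)) v) = red_form u v"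
    by (rule red_chart[OF c p(1)]) (rule that, assumption+)
  define F where "F d = lift_act \<eta> \<sigma> 0 (level_map q (level_embed d))" for d
  have smF: "smooth_at F (snd c p)" unfolding F_def[abs_def] by (intro smooth_intros sm)
  have "(F has_derivative (\<lambda>u. lift_act (\<lambda>_. 0) 0 0 (frechet_derivative (\<lambda>d. level_map q (level_embed d)) (at (snd c p)) u))) (at (snd c p))"
    unfolding F_def[abs_def]
    by (rule has_derivative_compose[OF smooth_at_has_derivative[OF sm] lift_act_has_derivative])
  then have DF: "frechet_derivative F (at (snd c p)) = frechet_derivative (\<lambda>d. level_map q (level_embed d)) (at (snd c p))"
    using frechet_derivative_at by fastforce
  have "\<forall>\<^sub>F y in nhds (snd c p). F y \<in> lifted_level \<and> f (red_map q y) = orbit_map (F y)"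
    using ev by eventually_elim (simp add: F_def lift_act_level red_map_def f)
  then obtain g where g: "local_lift red_top c red_top d f (snd c p) g"
    "\<And>c' p' u v. total_form c' p' (frechet_derivative F (at (snd c p)) u) (frechet_derivative F (at (snd c p)) v) =
       red_form (frechet_derivative g (at (snd c p)) u) (frechet_derivative g (at (snd c p)) v)"
    by (rule local_lift_red[where f = f, OF ch d p smF]) (rule that, assumption+)
  show thesis by (rule that[OF g(1)]) (simp only: g(2)[of undefined undefined, symmetric] DF fm)
qed

lemma is_pullback_red:
  assumes "\<And>y. f (orbit_map y) = orbit_map (lift_act \<eta> \<sigma> 0 y)"
  shows "is_pullback red_atlas red_atlas f (\<lambda>_ _. red_form) (\<lambda>_ _. red_form)"
proof (rule is_pullbackI)
  fix c d p
  assume "c \<in> red_atlas" "d \<in> red_atlas" "p \<in> fst c" "f p \<in> fst d"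
  then show "\<exists>g. local_lift red_top c red_top d f (snd c p) g \<and>
    (\<forall>u v. red_form u v = red_form (frechet_derivative g (at (snd c p)) u) (frechet_derivative g (at (snd c p)) v))"
    by (rule red_lift[OF _ _ _ _ assms]) metis
qed

lemma red_act_0: "p \<in> topspace red_top \<Longrightarrow> red_act 0 p = p"
  using torus_act_0[where \<eta> = \<eta>, OF integral] by (simp add: red_act_def zero_prod_def)

lemma red_act_add: "red_act (s + t) p = red_act s (red_act t p)"
  using torus_act_add[where \<eta> = \<eta>, OF integral, of "(s, 0)" "(t, 0)"]
  by (simp add: red_act_def image_image)

lemma smooth_manifold_red: "smooth_manifold red_top red_atlas"
  unfolding smooth_manifold_def
proof (intro conjI)
  show "Hausdorff_space red_top" by (rule Hausdorff_space_red)
  show "second_countable_space red_top"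
    by (rule second_countable_space_open_image[OF red_maps]) (simp only: topspace_red)
  show "smooth_atlas red_top red_atlas"
  proof (rule smooth_atlasI[OF param_atlas_red])
    fix c d p
    assume *: "c \<in> red_atlas" "d \<in> red_atlas" "p \<in> fst c" "p \<in> fst d"
    show "\<exists>g. local_lift red_top c red_top d (\<lambda>p. p) (snd c p) g"
      by (rule red_lift[where f = "\<lambda>p. p" and \<sigma> = 0, OF *]) auto
  qed
qed

lemma symplectic_form_red: "symplectic_form red_atlas (\<lambda>_ _. red_form)"
  unfolding symplectic_form_def smooth_2form_def closed_2form_def
proof (intro conjI ballI allI impI)
  show "is_pullback red_atlas red_atlas (\<lambda>p. p) (\<lambda>_ _. red_form) (\<lambda>_ _. red_form)"
    by (rule is_pullback_red[where \<sigma> = 0]) simp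
next
  fix c x u assume "\<forall>v. red_form u v = 0"
  then show "u = 0" using red_form_nondegenerate by blast
qed (auto simp: bilinear_red_form frechet_derivative_const intro: red_form_antisym smooth_on_if_smooth_at smooth_at_const)

lemma smooth_action_red: "smooth_action torus_atlas red_top red_atlas red_act"
  unfolding smooth_action_def
proof (intro conjI ballI allI)
  show "red_act 0 p = p" if "p \<in> topspace red_top" for p using that by (rule red_act_0)
  show "red_act (g + h) p = red_act g (red_act h p)" for p g h by (rule red_act_add)
  show "smooth_map (prod_topology euclidean red_top) (prod_atlas torus_atlas red_atlas) red_top red_atlas
      (\<lambda>(g, p). red_act g p)" (is "smooth_map ?X ?A ?Y ?B ?f")
  proof (rule smooth_mapI)
    show "param_atlas ?X ?A" "param_atlas ?Y ?B"
      by (intro param_atlas_prod param_atlas_torus param_atlas_red)+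
    show "?f ` topspace ?X \<subseteq> topspace ?Y" using red_act_in by auto
    fix c d w
    assume *: "c \<in> ?A" "d \<in> ?B" "w \<in> fst c" "?f w \<in> fst d"
    obtain a b where ab: "a \<in> torus_atlas" "b \<in> red_atlas" "c = (fst a \<times> fst b, map_prod (snd a) (snd b))"
      using *(1) by (auto simp: prod_atlas_def)
    obtain B where a: "chart_param euclidean a B torus_of" by (rule chart_param_torusE[OF ab(1)])
    obtain s p where w: "w = (s, p)" by (cases w)
    have p: "p \<in> fst b" using *(3) by (simp add: w ab(3))
    obtain q V where q: "adapted q" and ch: "chart_param red_top b V (red_map q)"
      and sm: "smooth_at (\<lambda>d. level_map q (level_embed d)) (snd b p)"
      and ev: "\<forall>\<^sub>F d in nhds (snd b p). level_map q (level_embed d) \<in> lifted_level"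
      by (rule red_chart[OF ab(2) p])
    have c: "chart_param ?X c (B \<times> V) (map_prod torus_of (red_map q))"
      unfolding ab(3) by (rule chart_param_prod[OF a ch])
    have sw: "snd c w = (snd a s, snd b p)" by (simp add: ab(3) w)
    \<comment> \<open>Smoothness is required jointly in the group element and the point, so the lift
      is a formula in both.\<close>
    define F where "F y = lift_act \<eta> (fst y) 0 (level_map q (level_embed (snd y)))" for y
    have "smooth_at (\<lambda>y. level_map q (level_embed (snd y))) (snd c w)"
      by (rule smooth_at_compose[of snd, OF smooth_at_snd[OF smooth_at_ident]]) (simp add: sw sm)
    then have smF: "smooth_at F (snd c w)" unfolding F_def[abs_def] by (intro smooth_intros)
    have "\<forall>\<^sub>F y in nhds (snd c w). level_map q (level_embed (snd y)) \<in> lifted_level"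
    proof -
      obtain S where S: "open S" "snd b p \<in> S" "\<And>d. d \<in> S \<Longrightarrow> level_map q (level_embed d) \<in> lifted_level"
        using ev unfolding eventually_nhds by blast
      then have "\<forall>\<^sub>F y in nhds (snd c w). y \<in> UNIV \<times> S"
        by (intro eventually_nhds_in_open open_Times) (auto simp: sw)
      then show ?thesis by eventually_elim (use S(3) in auto)
    qed
    then have "\<forall>\<^sub>F y in nhds (snd c w). F y \<in> lifted_level \<and> ?f (map_prod torus_of (red_map q) y) = orbit_map (F y)"
      by eventually_elim (auto simp: F_def red_map_def lift_act_level red_act_orbit_map)
    then show "\<exists>g. local_lift ?X c ?Y d ?f (snd c w) g"
      by (rule local_lift_red[where f = ?f, OF c *(2-4) smF]) blast
  qed
qed

section \<open>The induced moment map\<close>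

definition red_moment :: "('n, 'N) total_space set \<Rightarrow> real^'n" where
  "red_moment orb = fst (SOME p. p \<in> orb)"

text \<open>The choice in \<open>red_moment\<close> is harmless, as the action leaves
  \<open>x\<close> fixed.\<close>

lemma red_moment_orbit: "red_moment (orbit \<eta> p) = fst p"
proof -
  have "q \<in> orbit \<eta> p \<Longrightarrow> fst q = fst p" for q
    by (cases p) (auto simp: orbit_def total_act_def)
  moreover have "\<exists>q. q \<in> orbit \<eta> p" by (auto simp: orbit_def)
  ultimately show ?thesis unfolding red_moment_def by (metis someI_ex)
qed

lemma red_moment_orbit_map: "red_moment (orbit_map y) = fst y"
  by (cases y) (simp add: orbit_map_def red_moment_orbit)

lemma red_moment_red_map: "red_moment (red_map q d) = base_point q (level_embed d)"
  by (simp add: red_map_def red_moment_orbit_map level_map_def lift_act_def slice_def)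

text \<open>Instead of computing the induced field in a chart, its flow is lifted to the level and
  factored through \<open>level_map\<close> as \<open>G\<close>. The derivative of
  \<open>level_map\<close> sends the velocity \<open>w\<close> of \<open>G\<close> to the
  translation vector \<open>(0, \<xi>, 0)\<close>, whose contraction with the given form is minus
  the differential of \<open>\<langle>x, \<xi>\<rangle>\<close>.\<close>

lemma moment_map_red: "moment_map torus_of red_top red_atlas (\<lambda>_ _. red_form) red_act red_moment"
  unfolding moment_map_def
proof (intro conjI allI ballI)
  show "smooth_map red_top red_atlas euclidean (open_atlas UNIV) red_moment"
  proof (rule smooth_mapI[OF param_atlas_red])
    show "param_atlas euclidean (open_atlas (UNIV :: (real^'n) set))" using param_atlas_open[OF open_UNIV] by simp
    fix c d p
    assume *: "c \<in> red_atlas" "d \<in> open_atlas (UNIV :: (real^'n) set)" "p \<in> fst c" "red_moment p \<in> fst d"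
    obtain q V where ch: "chart_param red_top c V (red_map q)"
      by (rule red_chart[OF *(1,3)])
    have d: "chart_param euclidean d UNIV (\<lambda>x. x)"
      using *(2) chart_param_open_chart[OF open_UNIV] by (simp add: open_atlas_def)
    have "local_lift red_top c euclidean d red_moment (snd c p) (\<lambda>d. base_point q (level_embed d))"
    proof (rule local_liftI[OF ch d])
      show "smooth_at (\<lambda>d. base_point q (level_embed d)) (snd c p)"
        by (rule smooth_at_compose[OF smooth_at_linear[OF bounded_linear_level_embed smooth_at_ident] smooth_at_base_point])
    qed (use chart_param_mem[OF ch *(3)] in \<open>auto simp: red_moment_red_map\<close>)
    then show "\<exists>g. local_lift red_top c euclidean d red_moment (snd c p) g" by blast
  qed simp
next
  fix s p assume "p \<in> topspace red_top"
  then obtain y where "p = orbit_map y" by (auto simp: topspace_red)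
  then show "red_moment (red_act s p) = red_moment p"
    using red_act_orbit_map[of "rep_torus s" y] by (simp add: torus_of_rep red_moment_orbit_map lift_act_def)
next
  fix \<xi> :: "real^'n" and c p v
  assume *: "c \<in> red_atlas" "p \<in> fst c"
  obtain q V where q: "adapted q" and dom: "level_embed (snd c p) \<in> domain q" and V: "V \<subseteq> red_domain q"
    and ch: "chart_param red_top c V (red_map q)"
    and ev: "\<forall>\<^sub>F d in nhds (snd c p). level_map q (level_embed d) \<in> lifted_level"
    by (rule red_chart[OF *])
  define d where "d = snd c p"
  define e :: "('n, 'N) level_model" where "e = level_embed d"
  have d: "d \<in> V" "red_map q d = p" using chart_param_mem[OF ch *(2)] by (auto simp: d_def)
  have e: "e \<in> domain q" using dom by (simp add: e_def d_def)
  \<comment> \<open>The angle along the orbit is 0, written as \<open>r *\<^sub>R 0\<close> to match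
    the rule for one-parameter subgroups.\<close>
  define h where "h r = lift_act \<eta> (r *\<^sub>R \<xi>) (r *\<^sub>R 0) (level_map q e)" for r :: real
  have smh: "smooth_at h 0" unfolding h_def[abs_def] by (intro smooth_intros)
  have h0: "h 0 = level_map q e" by (simp add: h_def)
  have levh: "\<forall>\<^sub>F r in nhds 0. h r \<in> lifted_level"
    by (rule always_eventually) (simp add: h_def lift_act_level level_map_level[OF q e])
  obtain G where G: "smooth_at G 0" "G 0 = e" "\<forall>\<^sub>F r in nhds 0. G r \<in> domain q \<and> level_map q (G r) = h r"
    "frechet_derivative h (at 0) = frechet_derivative (level_map q) (at e) \<circ> frechet_derivative G (at 0)"
    by (rule level_lift[OF q e smh h0 levh]) (rule that, assumption+)
  have h': "frechet_derivative h (at 0) 1 = (0, \<xi>, 0)"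
  proof -
    have "(h has_vector_derivative (0, \<xi> + (\<Sum>i\<in>UNIV. (0 :: real^'N) $ i *\<^sub>R \<eta> i),
        \<chi> i. \<i> * of_real ((0 :: real^'N) $ i) * snd (snd (level_map q e)) $ i)) (at 0)"
      unfolding h_def[abs_def] by (rule lift_act_has_vector_derivative)
    then have "(h has_derivative (\<lambda>r. r *\<^sub>R (0, \<xi>, 0))) (at 0)"
      by (simp add: has_vector_derivative_def flip: zero_vec_def)
    then have "frechet_derivative h (at 0) = (\<lambda>r. r *\<^sub>R (0, \<xi>, 0))"
      by (rule frechet_derivative_at[symmetric])
    then show ?thesis by simp
  qed
  define w where "w = frechet_derivative G (at 0) 1"
  have ind: "induced_field torus_of red_act \<xi> c p = level_proj w"
  proof (rule induced_field_eq[OF ch])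
    show "level_proj (G 0) \<in> V" using d by (simp add: G(2) e_def)
    have "((\<lambda>r. level_proj (G r)) has_derivative (\<lambda>r. level_proj (frechet_derivative G (at 0) r))) (at 0)"
      by (rule bounded_linear.has_derivative[OF bounded_linear_level_proj smooth_at_has_derivative[OF G(1)]])
    moreover have "(\<lambda>r. level_proj (frechet_derivative G (at 0) r)) = (\<lambda>r. r *\<^sub>R level_proj w)"
    proof
      fix r
      have "linear (\<lambda>r. level_proj (frechet_derivative G (at 0) r))"
        using calculation has_derivative_linear by blast
      from linear_cmul[OF this, of r 1] show "level_proj (frechet_derivative G (at 0) r) = r *\<^sub>R level_proj w"
        by (simp add: w_def)
    qed
    ultimately show "((\<lambda>r. level_proj (G r)) has_vector_derivative level_proj w) (at 0)"
      by (simp add: has_vector_derivative_def)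
    show "\<forall>\<^sub>F r in nhds 0. red_act (torus_of (r *\<^sub>R \<xi>)) p = red_map q (level_proj (G r))"
      using G(3)
    proof eventually_elim
      fix r assume "G r \<in> domain q \<and> level_map q (G r) = h r"
      then have "orbit_map (lift_act \<eta> (r *\<^sub>R \<xi>) 0 (level_map q e)) = red_map q (level_proj (G r))"
        by (simp add: red_map_level_proj h_def)
      then show "red_act (torus_of (r *\<^sub>R \<xi>)) p = red_map q (level_proj (G r))"
        by (simp add: red_act_orbit_map e_def red_map_def flip: d(2))
    qed
  qed
  define D where "D = frechet_derivative (level_map q) (at e)"
  have D: "(level_map q has_derivative D) (at e)"
    unfolding D_def by (intro smooth_at_has_derivative smooth_at_level_map e)
  have "red_form (level_proj w) v = red_form (level_proj w) (level_proj (level_embed v :: ('n, 'N) level_model))" by simp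
  \<comment> \<open>The form may be evaluated in the covering on any lifts of the two vectors. The
    arguments \<open>undefined\<close> stand for a chart and a point, on which its coefficients do
    not depend.\<close>
  also have "\<dots> = total_form undefined undefined (D w) (D (level_embed v))"
    unfolding D_def by (rule total_form_level_map[OF q e, symmetric])
  also have "D w = (0, \<xi>, 0)" using h' G(4) by (simp add: D_def w_def)
  also have "total_form undefined undefined (0, \<xi>, 0) (D (level_embed v)) = - (fst (D (level_embed v)) \<bullet> \<xi>)"
    by (cases "D (level_embed v)") (simp add: total_form_eq)
  also have "fst (D (level_embed v)) \<bullet> \<xi> = frechet_derivative (\<lambda>d. base_point q (level_embed d) \<bullet> \<xi>) (at d) v"
  proof -
    have "((\<lambda>d. fst (level_map q (level_embed d)) \<bullet> \<xi>) has_derivative (\<lambda>v. fst (D (level_embed v)) \<bullet> \<xi>)) (at d)"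
      using D unfolding e_def
      by (intro has_derivative_inner_left has_derivative_fst
          has_derivative_compose[OF bounded_linear_imp_has_derivative[OF bounded_linear_level_embed]])
    then have "((\<lambda>d. base_point q (level_embed d) \<bullet> \<xi>) has_derivative (\<lambda>v. fst (D (level_embed v)) \<bullet> \<xi>)) (at d)"
      by (simp add: level_map_def lift_act_def slice_def)
    from fun_cong[OF frechet_derivative_at[OF this], of v] show ?thesis by simp
  qed
  also have "frechet_derivative (\<lambda>d. base_point q (level_embed d) \<bullet> \<xi>) (at d) =
      frechet_derivative (\<lambda>x. red_moment (inv_into (fst c) (snd c) x) \<bullet> \<xi>) (at d)"
    by (rule frechet_derivative_cong_open[OF chart_param_open[OF ch] d(1)])
      (simp add: chart_param_inv[OF ch] red_moment_red_map)
  finally show "red_form (induced_field torus_of red_act \<xi> c p) v =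
      - frechet_derivative (\<lambda>x. red_moment (inv_into (fst c) (snd c) x) \<bullet> \<xi>) (at (snd c p)) v"
    by (simp add: ind d_def)
qed

lemma hamiltonian_space_red:
  "hamiltonian_space torus_atlas torus_of red_top red_atlas (\<lambda>_ _. red_form) red_act red_moment"
  unfolding hamiltonian_space_def
  by (intro conjI allI smooth_manifold_red symplectic_form_red smooth_action_red moment_map_red)
    (rule is_pullback_red, rule red_act_orbit_map[of "rep_torus _", unfolded torus_of_rep])

lemma image_red_moment: "red_moment ` topspace red_top = U \<inter> polyhedron_of \<eta> \<kappa>"
proof -
  have "fst ` lifted_level = U \<inter> polyhedron_of \<eta> \<kappa>"
  proof (intro set_eqI iffI)
    fix x assume "x \<in> fst ` lifted_level"
    then obtain z where y: "(x, z) \<in> lifted_level" by auto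
    then have y: "x \<in> U" "\<And>i. x \<bullet> \<eta> i + snd z $ i \<bullet> snd z $ i = \<kappa> i"
      by (auto simp: lifted_level_def)
    have "x \<bullet> \<eta> i \<le> \<kappa> i" for i using y(2)[of i] inner_ge_zero[of "snd z $ i"] by linarith
    then show "x \<in> U \<inter> polyhedron_of \<eta> \<kappa>" using y(1) by (simp add: polyhedron_of_def)
  next
    fix x assume x: "x \<in> U \<inter> polyhedron_of \<eta> \<kappa>"
    \<comment> \<open>A point over \<open>x\<close> with angle 0 and real coordinates of the modulus
      prescribed by the level equation.\<close>
    have "(x, 0, \<chi> i. of_real (sqrt (\<kappa> i - x \<bullet> \<eta> i))) \<in> lifted_level"
      using x by (simp add: lifted_level_def polyhedron_of_def inner_complex_def flip: power2_eq_square)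
    then show "x \<in> fst ` lifted_level" by force
  qed
  then show ?thesis by (simp add: topspace_red image_image red_moment_orbit_map)
qed

end

text \<open>The point \<open>x\<close> witnesses that the face of \<open>I\<close> meets the
  unimodular set, so the lattice condition supplies a subtorus for \<open>I\<close>.\<close>

lemma toric_data_unimodular:
  assumes "open U" "\<And>i. integral_vector (\<eta> i)" "unimodular_set \<eta> \<kappa> (U \<inter> polyhedron_of \<eta> \<kappa>)"
  shows "toric_data U \<eta> \<kappa>"
proof
  fix x I a j
  assume x: "x \<in> U" "x \<in> polyhedron_face \<eta> \<kappa> I" and int: "integral_vector (\<Sum>i\<in>I. a i *\<^sub>R \<eta> i)" and j: "j \<in> I"
  have "U \<inter> polyhedron_of \<eta> \<kappa> \<inter> polyhedron_face \<eta> \<kappa> I \<noteq> {}"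
    using x by (auto simp: polyhedron_face_def)
  then obtain H where "subtorus H" "lattice_basis (integral_lattice H) I \<eta>"
    using assms(3) unfolding unimodular_set_def by blast
  then show "a j \<in> \<int>" using int j by (rule lattice_saturated)
qed (use assms in auto)

theorem theorem2p10:
  fixes U :: "(real^'n::finite) set"
    and \<eta> :: "'N::finite \<Rightarrow> real^'n"
    and \<kappa> :: "'N \<Rightarrow> real"
  assumes "open U"
    and "\<forall>i. integral_vector (\<eta> i)"
    and "unimodular_set \<eta> \<kappa> (U \<inter> polyhedron_of \<eta> \<kappa>)"
  shows
    "hamiltonian_space (prod_atlas torus_atlas torus_atlas) (map_prod torus_of torus_of)
       (total_topology U) (total_atlas U) total_form (total_act \<eta>) (total_moment \<eta> \<kappa>) \<and>
     (\<exists>(B :: (('n, 'N) total_space, (real^'n) \<times> (real^'n) \<times> (real^'N)) chart set)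
       (A :: (('n, 'N) total_space set, (real^'n) \<times> (real^'n)) chart set)
       \<omega>\<^sub>\<Delta> act\<^sub>\<Delta> \<Phi>\<^sub>\<Delta>.
       embedded_submanifold (total_topology U) (total_atlas U) (zero_level U \<eta> \<kappa>) B \<and>
       submersion (subtopology (total_topology U) (zero_level U \<eta> \<kappa>)) B
         (reduced_topology U \<eta> \<kappa>) A (orbit \<eta>) \<and>
       (\<exists>\<beta>. is_pullback B (total_atlas U) (\<lambda>p. p) total_form \<beta> \<and>
            is_pullback B A (orbit \<eta>) \<omega>\<^sub>\<Delta> \<beta>) \<and>
       (\<forall>s. \<forall>p \<in> zero_level U \<eta> \<kappa>. act\<^sub>\<Delta> s (orbit \<eta> p) = orbit \<eta> (total_act \<eta> (s, 0) p)) \<and>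
       (\<forall>p \<in> zero_level U \<eta> \<kappa>. \<Phi>\<^sub>\<Delta> (orbit \<eta> p) = fst (total_moment \<eta> \<kappa> p)) \<and>
       hamiltonian_space torus_atlas torus_of (reduced_topology U \<eta> \<kappa>) A \<omega>\<^sub>\<Delta> act\<^sub>\<Delta> \<Phi>\<^sub>\<Delta> \<and>
       \<Phi>\<^sub>\<Delta> ` topspace (reduced_topology U \<eta> \<kappa>) = U \<inter> polyhedron_of \<eta> \<kappa>)"
proof -
  interpret toric_data U \<eta> \<kappa>
    using assms by (intro toric_data_unimodular) auto
  show ?thesis
  proof (intro conjI exI ballI allI)
    show "hamiltonian_space (prod_atlas torus_atlas torus_atlas) (map_prod torus_of torus_of)
       (total_topology U) (total_atlas U) total_form (total_act \<eta>) (total_moment \<eta> \<kappa>)"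
      by (rule hamiltonian_space_total[OF open_U integral])
    show "embedded_submanifold (total_topology U) (total_atlas U) (zero_level U \<eta> \<kappa>) level_atlas"
      by (rule embedded_submanifold_level)
    show "submersion level_top level_atlas red_top red_atlas (orbit \<eta>)" by (rule submersion_orbit)
    \<comment> \<open>The witness \<open>\<beta>\<close> is the restriction of the given form to the
      level; its kernel consists of the orbit directions.\<close>
    show "is_pullback level_atlas (total_atlas U) (\<lambda>p. p) total_form (\<lambda>_ _ u v. red_form (level_proj u) (level_proj v))"
      by (rule is_pullback_level)
    show "is_pullback level_atlas red_atlas (orbit \<eta>) (\<lambda>_ _. red_form) (\<lambda>_ _ u v. red_form (level_proj u) (level_proj v))"
      by (rule is_pullback_orbit)
    show "red_act s (orbit \<eta> p) = orbit \<eta> (total_act \<eta> (s, 0) p)" for s p by (rule red_act_orbit)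
    show "red_moment (orbit \<eta> p) = fst (total_moment \<eta> \<kappa> p)" for p
      by (cases p) (simp add: red_moment_orbit total_moment_def)
    show "hamiltonian_space torus_atlas torus_of red_top red_atlas (\<lambda>_ _. red_form) red_act red_moment"
      by (rule hamiltonian_space_red)
    show "red_moment ` topspace red_top = U \<inter> polyhedron_of \<eta> \<kappa>" by (rule image_red_moment)
  qed
qed

end
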